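(* Let $n\ge3$, $0\le p\le n$, $\beta=n-2p$, and let $(M,h)$ be an oriented $n$-dimensional Einstein manifold with $Ric(h)=\tfrac{2J}{n}(n-1)h$, $J\in\mathbb{R}$ constant. Let $m\in\mathbb{N}$, $\varphi\in\Omega^p(M)$, and let $\lambda\in\mathbb{C}$ with $\lambda\ne\beta$ and $\lambda\neq\tfrac{\beta}{2}-N$ for all $N\in\{1,\dots,m\}$. Then, with boundary data $\omega^{(-)}_0=0$, $\omega^{(+)}_0=\varphi$ (and vanishing odd-index coefficients), the recurrence relations (R$-$), (R$+$) of the context are solved up to index $2m$ by $$\omega^{(-)}_{2m'}=\mathcal{T}^{(-)}_{m'}(\lambda)\varphi,\qquad\omega^{(+)}_{2m'}=\mathcal{T}^{(+)}_{m'}(\lambda)\varphi,\qquad 1\le m'\le m,$$ where $\mathcal{T}^{(\pm)}_{m'}(\lambda)$ are the operators defined in the context. If $\lambda=\tfrac{\beta}{2}-N$ for some $N\in\{1,\dots,m\}$ (and $\lambda\neq\beta$), these formulas give the solution for all indices $m'<N$.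
   Context: $\delta^h$ is the codifferential (formal adjoint of $d$) and $\Delta^h=d\delta^h+\delta^hd$ on $(M,h)$; $\Omega^{-1}(M)=0$. Recurrences, for forms $\omega^{(+)}_j\in\Omega^p(M)$, $\omega^{(-)}_j\in\Omega^{p-1}(M)$ (zero for negative index), $j\ge1$: (R$-$) $A_j\omega^{(-)}_j=B_j\tfrac{J}{2n}\omega^{(-)}_{j-2}+C_j(\tfrac{J}{2n})^2\omega^{(-)}_{j-4}+D_j(\tfrac{J}{2n})^3\omega^{(-)}_{j-6}+\Delta^h\omega^{(-)}_{j-2}-\tfrac{J}{2n}\Delta^h\omega^{(-)}_{j-4}+2\delta^h\omega^{(+)}_{j-2}+2\tfrac{J}{2n}\delta^h\omega^{(+)}_{j-4}$, (R$+$) $a_j\omega^{(+)}_j=b_j\tfrac{J}{2n}\omega^{(+)}_{j-2}+c_j(\tfrac{J}{2n})^2\omega^{(+)}_{j-4}+\Delta^h\omega^{(+)}_{j-2}+2d\omega^{(-)}_j-2(\tfrac{J}{2n})^2d\omega^{(-)}_{j-4}$, with $A_j=-[(j-2)(\beta-2\lambda-j+2)+2(\beta-\lambda-j+2)]$, $B_j=-3[(j-4)(\beta-2\lambda-j+4)+2(\beta-\lambda-j+4)]+2(\beta+2)(\lambda+j)$, $C_j=3[(j-6)(\beta-2\lambda-j+6)+2(\beta-\lambda-j+6)]-4(\beta+2)(\lambda+j-3)$, $D_j=-[(j-8)(\beta-2\lambda-j+8)+2(\beta-\lambda-j+8)]+2(\beta+2)(\lambda+j-6)$, $a_j=-j(\beta-2\lambda-j)$,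 $b_j=2[(j-2)(\lambda+j-2)+\lambda(\beta+j-2)]$, $c_j=-(2\lambda+j-4)(\beta+j-4)$. (These are equivalent to the eigenequation $\Delta^{g_+}\omega=\lambda(n-2p-\lambda)\omega$ for $\omega=r^\lambda[\sum_j r^j\omega^{(+)}_j+\tfrac{dr}{r}\wedge\sum_j r^j\omega^{(-)}_j]$ and $g_+=r^{-2}(dr^2+(1-\tfrac{J}{2n}r^2)^2h)$.) Polynomials: $(a)_0=1$, $(a)_k=a(a+1)\cdots(a+k-1)$, $(a)_{-1}=\frac1{a-1}$; $R_k(y;\alpha)=\prod_{l=1}^k[y-(\alpha-l)(\alpha-l+1)]$, $R_0=1$; $R^{(1)}_k(y)=\sum_{j=1}^k(\tfrac\beta2-k+j+1)_{2(k-j)}[y-\tfrac\beta2(\tfrac\beta2+1)]R_{j-1}(y;k)$, $R^{(1)}_0=0$; $s^{(-)}_m(y)=\sum_{k=0}^m\binom mk(\tfrac\beta2-\lambda-m)_{m-k}(-\tfrac\beta2-m-1)_{m-k}R_k(y;0)$; $s^{(+)}_m(y)=\sum_{k=0}^m\binom mk(\tfrac\beta2-\lambda-m)_{m-k}(-\tfrac\beta2-m+1)_{m-k}R_k(y;0)$; $s^{(1)}_m(y)=\sum_{k=0}^m\binom mk(\lambda-\tfrac\beta2+k+1)_{m-k}(\tfrac\beta2+k+1)_{m-k-1}[k(\lambda+\beta+2m)+\tfrac\beta2(\lambda-\beta-2m)]R^{(1)}_k(y)$, where the coefficient for $k=m$ equals $\lambda-\beta+2m$ (also used if $\tfrac\beta2=-m$).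 Operators: $y^{(-)}=\tfrac{n}{2J}\delta^hd+\tfrac\beta2(\tfrac\beta2+1)$, $y^{(+)}=\tfrac{n}{2J}\delta^hd+\tfrac\beta2(\tfrac\beta2-1)$, $y^{(1)}=\tfrac{n}{2J}d\delta^h+\tfrac\beta2(\tfrac\beta2+1)$, and for $m\in\mathbb{N}$ $$\mathcal{T}^{(-)}_m(\lambda)=\Big[(\lambda-\beta)\prod_{k=1}^{m-1}a_{2k}\Big]^{-1}(\tfrac{2J}{n})^{m-1}s^{(-)}_{m-1}(y^{(-)})\circ\delta^h,$$ $$\mathcal{T}^{(+)}_m(\lambda)=\Big[(\lambda-\beta)\prod_{k=1}^{m}a_{2k}\Big]^{-1}(\tfrac{2J}{n})^{m}\Big[(\lambda-\beta)s^{(+)}_m(y^{(+)})+s^{(1)}_m(y^{(1)})\Big].$$ After multiplying out the powers of $\tfrac{2J}{n}$ these expressions are polynomial in $J$, and for $J=0$ they are understood in this multiplied-out form. *)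

theory Defs
  imports
    "HOL-Analysis.Analysis"
    "HOL-Library.Function_Algebras"
    "HOL-Computational_Algebra.Polynomial"
begin

section \<open>Smooth functions on open subsets of Euclidean space\<close>

fun C_k_on :: "nat \<Rightarrow> (real^'n) set \<Rightarrow> (real^'n \<Rightarrow> 'b::real_normed_vector) \<Rightarrow> bool" where
  "C_k_on 0 S f = continuous_on S f"
| "C_k_on (Suc k) S f =
     ((\<forall>x\<in>S. f differentiable (at x)) \<and>
      (\<forall>i. C_k_on k S (\<lambda>x. frechet_derivative f (at x) (axis i 1))))"

definition smooth_on :: "(real^'n) set \<Rightarrow> (real^'n \<Rightarrow> 'b::real_normed_vector) \<Rightarrow> bool" where
  "smooth_on S f \<longleftrightarrow> (\<forall>k. C_k_on k S f)"


section \<open>Oriented manifolds\<close>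

text \<open>The underlying space is a (Hausdorff, second countable) type \<open>'a\<close>; the dimension is
  \<open>CARD('n)\<close>. A chart is a pair of a domain and a coordinate map; outside the domain the values of
  the coordinate map are irrelevant.\<close>

type_synonym ('a, 'n) chart = "'a set \<times> ('a \<Rightarrow> real^'n)"

abbreviation chart_inv :: "('a, 'n) chart \<Rightarrow> real^'n \<Rightarrow> 'a" where
  "chart_inv c \<equiv> inv_into (fst c) (snd c)"

definition is_chart :: "('a::topological_space, 'n::finite) chart \<Rightarrow> bool" where
  "is_chart c \<longleftrightarrow> open (fst c) \<and> open (snd c ` fst c) \<and>
     homeomorphism (fst c) (snd c ` fst c) (snd c) (chart_inv c)"

text \<open>Entry \<open>(i, j)\<close> of \<open>transition_jacobian c c' q\<close> is \<open>\<partial>x'\<^sub>i/\<partial>x\<^sub>j\<close> at \<open>q\<close>, where \<open>x\<close> and \<open>x'\<close> are the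
  coordinates of \<open>c\<close> and \<open>c'\<close>.\<close>

definition transition_jacobian ::
    "('a, 'n::finite) chart \<Rightarrow> ('a, 'n) chart \<Rightarrow> 'a \<Rightarrow> real^'n^'n" where
  "transition_jacobian c c' q =
     jacobian (snd c' \<circ> chart_inv c) (at (snd c q))"

definition oriented_atlas :: "('a::topological_space, 'n::finite) chart set \<Rightarrow> bool" where
  "oriented_atlas A \<longleftrightarrow>
     (\<forall>c\<in>A. is_chart c) \<and> (\<Union>c\<in>A. fst c) = UNIV \<and>
     (\<forall>c\<in>A. \<forall>c'\<in>A.
        smooth_on (snd c ` (fst c \<inter> fst c')) (snd c' \<circ> chart_inv c) \<and>
        (\<forall>q \<in> fst c \<inter> fst c'. det (transition_jacobian c c' q) > 0))"

definition smooth_in_chart ::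
    "('a, 'n::finite) chart \<Rightarrow> ('a \<Rightarrow> 'b::real_normed_vector) \<Rightarrow> bool" where
  "smooth_in_chart c f \<longleftrightarrow> smooth_on (snd c ` fst c) (f \<circ> chart_inv c)"

definition coord_deriv ::
    "('a, 'n::finite) chart \<Rightarrow> 'n \<Rightarrow> ('a \<Rightarrow> 'b::real_normed_vector) \<Rightarrow> 'a \<Rightarrow> 'b" where
  "coord_deriv c i f q = frechet_derivative (f \<circ> chart_inv c) (at (snd c q)) (axis i 1)"


section \<open>Riemannian metrics and Ricci curvature\<close>

text \<open>A metric is given by its Gram matrices with respect to the coordinate frames of the charts.\<close>

type_synonym ('a, 'n) metric = "('a, 'n) chart \<Rightarrow> 'a \<Rightarrow> real^'n^'n"

definition riemannian_metric ::
    "('a, 'n::finite) chart set \<Rightarrow> ('a, 'n) metric \<Rightarrow> bool" where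
  "riemannian_metric A h \<longleftrightarrow>
     (\<forall>c\<in>A. (\<forall>i j. smooth_in_chart c (\<lambda>q. h c q $ i $ j)) \<and>
        (\<forall>q\<in>fst c. transpose (h c q) = h c q \<and> (\<forall>v. v \<noteq> 0 \<longrightarrow> v \<bullet> (h c q *v v) > 0))) \<and>
     (\<forall>c\<in>A. \<forall>c'\<in>A. \<forall>q \<in> fst c \<inter> fst c'.
        h c q = transpose (transition_jacobian c c' q) ** h c' q ** transition_jacobian c c' q)"

definition christoffel ::
    "('a, 'n::finite) metric \<Rightarrow> ('a, 'n) chart \<Rightarrow> 'n \<Rightarrow> 'n \<Rightarrow> 'n \<Rightarrow> 'a \<Rightarrow> real" where
  "christoffel h c k i j q =
     (1/2) * (\<Sum>l\<in>UNIV. matrix_inv (h c q) $ k $ l *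
        (coord_deriv c i (\<lambda>x. h c x $ j $ l) q + coord_deriv c j (\<lambda>x. h c x $ i $ l) q
         - coord_deriv c l (\<lambda>x. h c x $ i $ j) q))"

definition ricci ::
    "('a, 'n::finite) metric \<Rightarrow> ('a, 'n) chart \<Rightarrow> 'a \<Rightarrow> real^'n^'n" where
  "ricci h c q = (\<chi> j k.
     \<Sum>i\<in>UNIV. coord_deriv c i (christoffel h c i j k) q - coord_deriv c j (christoffel h c i i k) q
       + (\<Sum>l\<in>UNIV. christoffel h c i i l q * christoffel h c l j k q
                    - christoffel h c i j l q * christoffel h c l i k q))"

text \<open>The Riemannian measure, characterised by its values \<open>\<integral> sqrt (det h) dx\<close> on Borel subsets of
  coordinate domains.\<close>

definition riemannian_measure ::
    "('a::topological_space, 'n::finite) chart set \<Rightarrow> ('a, 'n) metric \<Rightarrow> 'a measure \<Rightarrow> bool" where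
  "riemannian_measure A h vol \<longleftrightarrow> sets vol = sets borel \<and>
     (\<forall>c\<in>A. \<forall>B\<in>sets borel. B \<subseteq> fst c \<longrightarrow>
        emeasure vol B =
          (\<integral>\<^sup>+x\<in>snd c ` B. ennreal (sqrt (det (h c (chart_inv c x)))) \<partial>lborel))"


section \<open>Differential forms\<close>

text \<open>A (complex-valued) form \<open>\<omega>\<close> is given by its components in the charts: \<open>\<omega> c q [i\<^sub>1, \<dots>, i\<^sub>k]\<close> is
  \<open>\<omega>\<^sub>q(\<partial>\<^bsub>i\<^sub>1\<^esub>, \<dots>, \<partial>\<^bsub>i\<^sub>k\<^esub>)\<close> for the coordinate vector fields of \<open>c\<close>. Meaningless components are zero, so that
  equality of forms is equality of functions. The degree is an integer, and there is no nonzero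
  form of negative degree.\<close>

type_synonym ('a, 'n) form = "('a, 'n) chart \<Rightarrow> 'a \<Rightarrow> 'n list \<Rightarrow> complex"

definition forms :: "('a, 'n::finite) chart set \<Rightarrow> int \<Rightarrow> ('a, 'n) form set" where
  "forms A k = {\<omega>.
     (\<forall>c q I. \<omega> c q I \<noteq> 0 \<longrightarrow> c \<in> A \<and> q \<in> fst c \<and> int (length I) = k) \<and>
     (\<forall>c q I i j. i < j \<and> j < length I \<longrightarrow> \<omega> c q (I[i := I ! j, j := I ! i]) = - \<omega> c q I) \<and>
     (\<forall>c\<in>A. \<forall>I. smooth_in_chart c (\<lambda>q. \<omega> c q I)) \<and>
     (\<forall>c\<in>A. \<forall>c'\<in>A. \<forall>q \<in> fst c \<inter> fst c'. \<forall>I.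
        \<omega> c q I = (\<Sum>K | length K = length I.
          (\<Prod>l<length I. complex_of_real (transition_jacobian c c' q $ (K ! l) $ (I ! l))) * \<omega> c' q K))}"

definition smul :: "complex \<Rightarrow> ('a, 'n) form \<Rightarrow> ('a, 'n) form" where
  "smul a \<omega> = (\<lambda>c q I. a * \<omega> c q I)"

definition ext_deriv :: "('a, 'n::finite) chart set \<Rightarrow> ('a, 'n) form \<Rightarrow> ('a, 'n) form" where
  "ext_deriv A \<omega> = (\<lambda>c q I. if c \<in> A \<and> q \<in> fst c
     then \<Sum>l<length I. (-1) ^ l * coord_deriv c (I ! l) (\<lambda>x. \<omega> c x (take l I @ drop (Suc l) I)) q
     else 0)"

text \<open>Pointwise Hermitian product of \<open>k\<close>-forms. The result does not depend on the chart around \<open>q\<close>.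
  The factor \<open>1/k!\<close> accounts for summing over all index tuples rather than increasing ones.\<close>

definition form_inner ::
    "('a, 'n::finite) chart set \<Rightarrow> ('a, 'n) metric \<Rightarrow> nat \<Rightarrow> ('a, 'n) form \<Rightarrow> ('a, 'n) form \<Rightarrow> 'a \<Rightarrow> complex" where
  "form_inner A h k \<eta> \<omega> q =
     (let c = (SOME c. c \<in> A \<and> q \<in> fst c) in
      (\<Sum>I | length I = k. \<Sum>K | length K = k.
         (\<Prod>l<k. complex_of_real (matrix_inv (h c q) $ (I ! l) $ (K ! l))) * \<eta> c q I * cnj (\<omega> c q K))
      / fact k)"

definition L2_inner ::
    "('a, 'n::finite) chart set \<Rightarrow> ('a, 'n) metric \<Rightarrow> 'a measure \<Rightarrow> int
      \<Rightarrow> ('a, 'n) form \<Rightarrow> ('a, 'n) form \<Rightarrow> complex" where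
  "L2_inner A h vol k \<eta> \<omega> = (\<integral>q. form_inner A h (nat k) \<eta> \<omega> q \<partial>vol)"

definition compactly_supported :: "('a::topological_space, 'n) form \<Rightarrow> bool" where
  "compactly_supported \<omega> \<longleftrightarrow> compact (closure {q. \<exists>c I. \<omega> c q I \<noteq> 0})"

text \<open>\<open>\<delta>\<close> is the formal adjoint of the exterior derivative, in all degrees. On forms this determines
  \<open>\<delta>\<close> uniquely; the case \<open>k = -1\<close> says that it vanishes on functions.\<close>

definition is_codifferential ::
    "('a::topological_space, 'n::finite) chart set \<Rightarrow> ('a, 'n) metric \<Rightarrow> 'a measure
      \<Rightarrow> (('a, 'n) form \<Rightarrow> ('a, 'n) form) \<Rightarrow> bool" where
  "is_codifferential A h vol \<delta> \<longleftrightarrow>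
     (\<forall>k. \<forall>\<omega> \<in> forms A (k + 1). \<delta> \<omega> \<in> forms A k \<and>
        (\<forall>\<eta> \<in> forms A k. compactly_supported \<eta> \<longrightarrow>
           L2_inner A h vol (k + 1) (ext_deriv A \<eta>) \<omega> = L2_inner A h vol k \<eta> (\<delta> \<omega>)))"

definition hodge_laplacian ::
    "('a, 'n::finite) chart set \<Rightarrow> (('a, 'n) form \<Rightarrow> ('a, 'n) form) \<Rightarrow> ('a, 'n) form \<Rightarrow> ('a, 'n) form" where
  "hodge_laplacian A \<delta> \<omega> = ext_deriv A (\<delta> \<omega>) + \<delta> (ext_deriv A \<omega>)"


section \<open>The recurrence relations\<close>

context
  fixes \<beta> lam :: complex
begin

definition A_coeff :: "int \<Rightarrow> complex" where
  "A_coeff i = (let j = of_int i in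
     - ((j - 2) * (\<beta> - 2 * lam - j + 2) + 2 * (\<beta> - lam - j + 2)))"

definition B_coeff :: "int \<Rightarrow> complex" where
  "B_coeff i = (let j = of_int i in
     - 3 * ((j - 4) * (\<beta> - 2 * lam - j + 4) + 2 * (\<beta> - lam - j + 4)) + 2 * (\<beta> + 2) * (lam + j))"

definition C_coeff :: "int \<Rightarrow> complex" where
  "C_coeff i = (let j = of_int i in
     3 * ((j - 6) * (\<beta> - 2 * lam - j + 6) + 2 * (\<beta> - lam - j + 6)) - 4 * (\<beta> + 2) * (lam + j - 3))"

definition D_coeff :: "int \<Rightarrow> complex" where
  "D_coeff i = (let j = of_int i in
     - ((j - 8) * (\<beta> - 2 * lam - j + 8) + 2 * (\<beta> - lam - j + 8)) + 2 * (\<beta> + 2) * (lam + j - 6))"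

definition a_coeff :: "int \<Rightarrow> complex" where
  "a_coeff i = (let j = of_int i in - j * (\<beta> - 2 * lam - j))"

definition b_coeff :: "int \<Rightarrow> complex" where
  "b_coeff i = (let j = of_int i in 2 * ((j - 2) * (lam + j - 2) + lam * (\<beta> + j - 2)))"

definition c_coeff :: "int \<Rightarrow> complex" where
  "c_coeff i = (let j = of_int i in - (2 * lam + j - 4) * (\<beta> + j - 4))"

end

text \<open>Here \<open>\<kappa>\<close> stands for \<open>J/(2n)\<close>.\<close>

definition recurrence_minus ::
    "('a, 'n::finite) chart set \<Rightarrow> (('a, 'n) form \<Rightarrow> ('a, 'n) form) \<Rightarrow> complex \<Rightarrow> complex \<Rightarrow> complex
      \<Rightarrow> (int \<Rightarrow> ('a, 'n) form) \<Rightarrow> (int \<Rightarrow> ('a, 'n) form) \<Rightarrow> int \<Rightarrow> bool" where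
  "recurrence_minus A \<delta> \<kappa> \<beta> lam wm wp j \<longleftrightarrow>
     smul (A_coeff \<beta> lam j) (wm j) =
       smul (B_coeff \<beta> lam j * \<kappa>) (wm (j - 2))
       + smul (C_coeff \<beta> lam j * \<kappa> ^ 2) (wm (j - 4))
       + smul (D_coeff \<beta> lam j * \<kappa> ^ 3) (wm (j - 6))
       + hodge_laplacian A \<delta> (wm (j - 2))
       - smul \<kappa> (hodge_laplacian A \<delta> (wm (j - 4)))
       + smul 2 (\<delta> (wp (j - 2)))
       + smul (2 * \<kappa>) (\<delta> (wp (j - 4)))"

definition recurrence_plus ::
    "('a, 'n::finite) chart set \<Rightarrow> (('a, 'n) form \<Rightarrow> ('a, 'n) form) \<Rightarrow> complex \<Rightarrow> complex \<Rightarrow> complex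
      \<Rightarrow> (int \<Rightarrow> ('a, 'n) form) \<Rightarrow> (int \<Rightarrow> ('a, 'n) form) \<Rightarrow> int \<Rightarrow> bool" where
  "recurrence_plus A \<delta> \<kappa> \<beta> lam wm wp j \<longleftrightarrow>
     smul (a_coeff \<beta> lam j) (wp j) =
       smul (b_coeff \<beta> lam j * \<kappa>) (wp (j - 2))
       + smul (c_coeff \<beta> lam j * \<kappa> ^ 2) (wp (j - 4))
       + hodge_laplacian A \<delta> (wp (j - 2))
       + smul 2 (ext_deriv A (wm j))
       - smul (2 * \<kappa> ^ 2) (ext_deriv A (wm (j - 4)))"

text \<open>\<open>(wm, wp)\<close> is a solution up to index \<open>M\<close> for boundary data \<open>(0, \<phi>)\<close> with \<open>\<phi>\<close> of degree \<open>p\<close>.\<close>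

definition solves_recurrences ::
    "('a, 'n::finite) chart set \<Rightarrow> (('a, 'n) form \<Rightarrow> ('a, 'n) form) \<Rightarrow> complex \<Rightarrow> complex \<Rightarrow> complex
      \<Rightarrow> nat \<Rightarrow> ('a, 'n) form
      \<Rightarrow> (int \<Rightarrow> ('a, 'n) form) \<Rightarrow> (int \<Rightarrow> ('a, 'n) form) \<Rightarrow> int \<Rightarrow> bool" where
  "solves_recurrences A \<delta> \<kappa> \<beta> lam p \<phi> wm wp M \<longleftrightarrow>
     wm 0 = 0 \<and> wp 0 = \<phi> \<and>
     (\<forall>j. j < 0 \<or> odd j \<longrightarrow> wm j = 0 \<and> wp j = 0) \<and>
     (\<forall>j\<le>M. wm j \<in> forms A (int p - 1) \<and> wp j \<in> forms A (int p)) \<and>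
     (\<forall>j\<in>{1..M}. recurrence_minus A \<delta> \<kappa> \<beta> lam wm wp j \<and> recurrence_plus A \<delta> \<kappa> \<beta> lam wm wp j)"


section \<open>The polynomials\<close>

definition R_poly :: "nat \<Rightarrow> complex \<Rightarrow> complex poly" where
  "R_poly k \<alpha> = (\<Prod>l=1..k. [:- ((\<alpha> - of_nat l) * (\<alpha> - of_nat l + 1)), 1:])"

definition R1_poly :: "complex \<Rightarrow> nat \<Rightarrow> complex poly" where
  "R1_poly \<beta> k = (\<Sum>j=1..k.
     smult (pochhammer (\<beta>/2 - of_nat k + of_nat j + 1) (2 * (k - j)))
       ([:- (\<beta>/2 * (\<beta>/2 + 1)), 1:] * R_poly (j - 1) (of_nat k)))"

definition s_minus :: "complex \<Rightarrow> complex \<Rightarrow> nat \<Rightarrow> complex poly" where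
  "s_minus \<beta> lam m = (\<Sum>k\<le>m.
     smult (of_nat (m choose k) * pochhammer (\<beta>/2 - lam - of_nat m) (m - k)
            * pochhammer (- \<beta>/2 - of_nat m - 1) (m - k))
       (R_poly k 0))"

definition s_plus :: "complex \<Rightarrow> complex \<Rightarrow> nat \<Rightarrow> complex poly" where
  "s_plus \<beta> lam m = (\<Sum>k\<le>m.
     smult (of_nat (m choose k) * pochhammer (\<beta>/2 - lam - of_nat m) (m - k)
            * pochhammer (- \<beta>/2 - of_nat m + 1) (m - k))
       (R_poly k 0))"

text \<open>For \<open>k = m\<close> the general expression would contain \<open>(\<beta>/2 + m + 1)\<^bsub>-1\<^esub> = 1/(\<beta>/2 + m)\<close>; this factor
  cancels, and the quotient is \<open>\<lambda> - \<beta> + 2m\<close>.\<close>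

definition s_one_coeff :: "complex \<Rightarrow> complex \<Rightarrow> nat \<Rightarrow> nat \<Rightarrow> complex" where
  "s_one_coeff \<beta> lam m k =
     (if k = m then lam - \<beta> + 2 * of_nat m
      else pochhammer (lam - \<beta>/2 + of_nat k + 1) (m - k)
           * pochhammer (\<beta>/2 + of_nat k + 1) (m - k - 1)
           * (of_nat k * (lam + \<beta> + 2 * of_nat m) + \<beta>/2 * (lam - \<beta> - 2 * of_nat m)))"

definition s_one :: "complex \<Rightarrow> complex \<Rightarrow> nat \<Rightarrow> complex poly" where
  "s_one \<beta> lam m = (\<Sum>k\<le>m. smult (of_nat (m choose k) * s_one_coeff \<beta> lam m k) (R1_poly \<beta> k))"


section \<open>The solution operators\<close>

text \<open>\<open>scaled_eval \<epsilon> N s c E\<close> is the operator \<open>\<epsilon>\<^sup>N s(\<epsilon>\<^sup>-\<^sup>1 E + c)\<close> with the powers of \<open>\<epsilon>\<close> multiplied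
  out, which makes sense for \<open>\<epsilon> = 0\<close> as well, provided \<open>degree s \<le> N\<close>. In our case
  \<open>\<epsilon> = 2J/n\<close>. See \<open>scaled_eval_scalar\<close> and the degree bounds below.\<close>

definition scaled_eval ::
    "complex \<Rightarrow> nat \<Rightarrow> complex poly \<Rightarrow> complex \<Rightarrow> (('a, 'n) form \<Rightarrow> ('a, 'n) form)
      \<Rightarrow> ('a, 'n) form \<Rightarrow> ('a, 'n) form" where
  "scaled_eval \<epsilon> N s c E \<omega> =
     (\<Sum>i\<le>N. smul (\<epsilon> ^ (N - i) * coeff (pcompose s [:c, 1:]) i) ((E ^^ i) \<omega>))"

lemma scaled_eval_scalar:
  fixes \<epsilon> x c :: complex
  assumes "\<epsilon> \<noteq> 0" "degree s \<le> N"
  shows "(\<Sum>i\<le>N. \<epsilon> ^ (N - i) * coeff (pcompose s [:c, 1:]) i * x ^ i) = \<epsilon> ^ N * poly s (x / \<epsilon> + c)"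
proof -
  let ?t = "pcompose s [:c, 1:]"
  have deg: "degree ?t \<le> N"
    using assms(2) by (simp add: degree_pcompose)
  have "poly s (x / \<epsilon> + c) = poly ?t (x / \<epsilon>)"
    by (simp add: poly_pcompose add.commute)
  also have "\<dots> = (\<Sum>i\<le>N. coeff ?t i * (x / \<epsilon>) ^ i)"
    using deg by (subst poly_altdef, intro sum.mono_neutral_left) (auto simp: coeff_eq_0)
  finally show ?thesis
    using assms(1) by (auto simp: sum_distrib_left power_divide power_diff field_simps intro!: sum.cong)
qed

lemma degree_R_poly: "degree (R_poly k \<alpha>) \<le> k"
  unfolding R_poly_def by (rule order_trans[OF degree_prod_sum_le]) auto

lemma degree_R1_poly: "degree (R1_poly \<beta> k) \<le> k"
  unfolding R1_poly_def
proof (intro degree_sum_le order_trans[OF degree_smult_le] order_trans[OF degree_mult_le])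
  fix j assume "j \<in> {1..k}"
  then show "degree [:- (\<beta>/2 * (\<beta>/2 + 1)), 1:] + degree (R_poly (j - 1) (of_nat k)) \<le> k"
    using degree_R_poly[of "j - 1" "of_nat k"] by auto
qed auto

lemma degree_s_minus: "degree (s_minus \<beta> lam m) \<le> m"
  unfolding s_minus_def
  by (intro degree_sum_le order_trans[OF degree_smult_le] order_trans[OF degree_R_poly]) auto

lemma degree_s_plus: "degree (s_plus \<beta> lam m) \<le> m"
  unfolding s_plus_def
  by (intro degree_sum_le order_trans[OF degree_smult_le] order_trans[OF degree_R_poly]) auto

lemma degree_s_one: "degree (s_one \<beta> lam m) \<le> m"
  unfolding s_one_def
  by (intro degree_sum_le order_trans[OF degree_smult_le] order_trans[OF degree_R1_poly]) auto

text \<open>Here \<open>\<epsilon>\<close> stands for \<open>2J/n\<close>; \<open>T_minus\<close> is only used for \<open>m \<ge> 1\<close>.\<close>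

definition T_minus ::
    "('a, 'n::finite) chart set \<Rightarrow> (('a, 'n) form \<Rightarrow> ('a, 'n) form) \<Rightarrow> complex \<Rightarrow> complex \<Rightarrow> complex
      \<Rightarrow> nat \<Rightarrow> ('a, 'n) form \<Rightarrow> ('a, 'n) form" where
  "T_minus A \<delta> \<epsilon> \<beta> lam m \<omega> =
     smul (inverse ((lam - \<beta>) * (\<Prod>k=1..m - 1. a_coeff \<beta> lam (2 * int k))))
       (scaled_eval \<epsilon> (m - 1) (s_minus \<beta> lam (m - 1)) (\<beta>/2 * (\<beta>/2 + 1)) (\<delta> \<circ> ext_deriv A) (\<delta> \<omega>))"

definition T_plus ::
    "('a, 'n::finite) chart set \<Rightarrow> (('a, 'n) form \<Rightarrow> ('a, 'n) form) \<Rightarrow> complex \<Rightarrow> complex \<Rightarrow> complex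
      \<Rightarrow> nat \<Rightarrow> ('a, 'n) form \<Rightarrow> ('a, 'n) form" where
  "T_plus A \<delta> \<epsilon> \<beta> lam m \<omega> =
     smul (inverse ((lam - \<beta>) * (\<Prod>k=1..m. a_coeff \<beta> lam (2 * int k))))
       (smul (lam - \<beta>)
          (scaled_eval \<epsilon> m (s_plus \<beta> lam m) (\<beta>/2 * (\<beta>/2 - 1)) (\<delta> \<circ> ext_deriv A) \<omega>)
        + scaled_eval \<epsilon> m (s_one \<beta> lam m) (\<beta>/2 * (\<beta>/2 + 1)) (ext_deriv A \<circ> \<delta>) \<omega>)"

text \<open>The coefficient sequences: \<open>0\<close> and \<open>\<omega>\<close> at index \<open>0\<close>, the above operators at positive even
  indices, and zero otherwise.\<close>

definition omega_minus ::
    "('a, 'n::finite) chart set \<Rightarrow> (('a, 'n) form \<Rightarrow> ('a, 'n) form) \<Rightarrow> complex \<Rightarrow> complex \<Rightarrow> complex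
      \<Rightarrow> ('a, 'n) form \<Rightarrow> int \<Rightarrow> ('a, 'n) form" where
  "omega_minus A \<delta> \<epsilon> \<beta> lam \<omega> j =
     (if j > 0 \<and> even j then T_minus A \<delta> \<epsilon> \<beta> lam (nat (j div 2)) \<omega> else 0)"

definition omega_plus ::
    "('a, 'n::finite) chart set \<Rightarrow> (('a, 'n) form \<Rightarrow> ('a, 'n) form) \<Rightarrow> complex \<Rightarrow> complex \<Rightarrow> complex
      \<Rightarrow> ('a, 'n) form \<Rightarrow> int \<Rightarrow> ('a, 'n) form" where
  "omega_plus A \<delta> \<epsilon> \<beta> lam \<omega> j =
     (if j = 0 then \<omega>
      else if j > 0 \<and> even j then T_plus A \<delta> \<epsilon> \<beta> lam (nat (j div 2)) \<omega> else 0)"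

end

theory Submission
  imports Defs
begin

text \<open>The recurrences take place in the algebra generated by \<open>d\<close> and \<open>\<delta>\<close>, where \<open>d d = 0\<close> and \<open>\<delta> \<delta> = 0\<close>.
  Put \<open>u = \<delta> d\<close> and \<open>v = d \<delta>\<close>. Then \<open>\<Delta> = u + v\<close>, \<open>\<delta> u = 0\<close>, \<open>d v = 0\<close>, and \<open>\<delta>\<close> carries polynomials in \<open>v\<close>
  applied to \<open>\<phi>\<close> to polynomials in \<open>u\<close> applied to \<open>\<delta> \<phi>\<close>. The claimed coefficients have the form \<open>\<omega>\<^sup>- = P(u) \<delta> \<phi>\<close> and
  \<open>\<omega>\<^sup>+ = F(u) \<phi> + S(v) \<phi>\<close> with \<open>S(0) = 0\<close>, so (R-) and (R+) follow from three identities between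
  polynomials in one variable: the \<open>u\<close>-part of (R+), the \<open>v\<close>-part of (R+), and (R-). All polynomials
  are homogeneous in the variable and \<open>J\<close>, so it is enough to prove the identities for one value of
  \<open>J\<close> and to transfer them coefficient by coefficient; this covers \<open>J = 0\<close> as well.

  The polynomial identities rest on three observations. The sum \<open>R\<^sup>(\<^sup>1\<^sup>)\<^sub>k(y)\<close> telescopes to
  \<open>R\<^sub>k(y) - R\<^sub>k(\<beta>/2 (\<beta>/2 + 1))\<close> (\<open>poly_R1_poly\<close>). The polynomials \<open>s\<^sup>-\<close> and \<open>s\<^sup>+\<close> are two instances of one
  family of continuous dual Hahn polynomials, which satisfies a three-term recurrence
  (\<open>dual_hahn_recurrence\<close>); for \<open>s\<^sup>+\<close> it is already the \<open>u\<close>-part of (R+). Finally \<open>s\<^sup>(\<^sup>1\<^sup>)\<close> is, up to its value at the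
  base point, a combination of three consecutive \<open>s\<^sup>-\<close> (\<open>sigma_one_eq_dual_hahn\<close>); with this
  substitution the other two identities are combinations of three-term recurrences.

  The properties of \<open>d\<close> and \<open>\<delta>\<close> are derived from their definitions in local coordinates. For \<open>d\<close>,
  the symmetry of second derivatives gives both \<open>d d = 0\<close> and the independence of coordinates
  (\<open>ext_deriv_forms\<close>, \<open>ext_deriv_ext_deriv\<close>). The operator \<open>\<delta>\<close> is known only as a formal adjoint, so its
  linearity and \<open>\<delta> \<delta> = 0\<close> follow from the uniqueness of adjoints: a form that is
  orthogonal to all compactly supported forms vanishes (\<open>L2_inner_nondegenerate\<close>).\<close>

section \<open>Alternating sums and pullback of tensor components\<close>

text \<open>The alternating sum that defines the exterior derivative, by recursion on the list of indices. In
  this form the cancellations below become inductions without any index arithmetic.\<close>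

fun alt_sum :: "('n \<Rightarrow> 'n list \<Rightarrow> complex) \<Rightarrow> 'n list \<Rightarrow> complex" where
  "alt_sum g [] = 0"
| "alt_sum g (a # I) = g a I - alt_sum (\<lambda>i L. g i (a # L)) I"

lemma alt_sum_eq_sum:
  "alt_sum g I = (\<Sum>l<length I. (-1) ^ l * g (I ! l) (take l I @ drop (Suc l) I))"
proof (induction I arbitrary: g)
  case (Cons a I)
  show ?case
    unfolding alt_sum.simps(2) Cons.IH length_Cons sum.lessThan_Suc_shift
    by (simp add: sum_negf)
qed simp

lemma alt_sum_cong:
  assumes "\<And>i L. i \<in> set I \<Longrightarrow> set L \<subseteq> set I \<Longrightarrow> Suc (length L) = length I \<Longrightarrow> g i L = g' i L"
  shows "alt_sum g I = alt_sum g' I"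
  unfolding alt_sum_eq_sum
proof (intro sum.cong refl)
  fix l assume l: "l \<in> {..<length I}"
  have "set (take l I) \<subseteq> set I" "set (drop (Suc l) I) \<subseteq> set I"
    by (rule set_take_subset, rule set_drop_subset)
  then have "g (I ! l) (take l I @ drop (Suc l) I) = g' (I ! l) (take l I @ drop (Suc l) I)"
    using l by (intro assms) auto
  then show "(- 1) ^ l * g (I ! l) (take l I @ drop (Suc l) I) = (- 1) ^ l * g' (I ! l) (take l I @ drop (Suc l) I)"
    by simp
qed

lemma alt_sum_add: "alt_sum (\<lambda>i L. g i L + g' i L) I = alt_sum g I + alt_sum g' I"
  by (simp add: alt_sum_eq_sum sum.distrib algebra_simps)

lemma alt_sum_diff: "alt_sum (\<lambda>i L. g i L - g' i L) I = alt_sum g I - alt_sum g' I"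
  by (simp add: alt_sum_eq_sum sum_subtractf algebra_simps)

lemma alt_sum_mult: "alt_sum (\<lambda>i L. c * g i L) I = c * alt_sum g I"
  by (simp add: alt_sum_eq_sum sum_distrib_left algebra_simps)

lemma alt_sum_minus: "alt_sum (\<lambda>i L. - g i L) I = - alt_sum g I"
  by (simp add: alt_sum_eq_sum sum_negf)

lemma alt_sum_sum: "alt_sum (\<lambda>i L. \<Sum>k\<in>S. g k i L) I = (\<Sum>k\<in>S. alt_sum (g k) I)"
  unfolding alt_sum_eq_sum by (subst sum.swap) (simp add: sum_distrib_left)

lemma alt_sum_0: "alt_sum (\<lambda>i L. 0) I = 0"
  by (simp add: alt_sum_eq_sum)

text \<open>Removing entry \<open>i\<close> before entry \<open>j\<close> and removing \<open>j\<close> before \<open>i\<close> give the same remaining list with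
  opposite signs. This cancellation yields \<open>d d = 0\<close>, and it also eliminates the second derivatives
  of a change of coordinates.\<close>

lemma alt_sum_alt_sum_symmetric:
  assumes "\<And>i j L. g i j L = g j i L"
  shows "alt_sum (\<lambda>i. alt_sum (\<lambda>j. g i j)) I = 0"
  using assms
proof (induction I arbitrary: g)
  case (Cons a I)
  have "alt_sum (\<lambda>i L. alt_sum (\<lambda>j L'. g i j (a # L')) L) I = 0"
    by (rule Cons.IH) (rule Cons.prems)
  moreover have "alt_sum (g a) I = alt_sum (\<lambda>i. g i a) I"
    by (rule alt_sum_cong) (rule Cons.prems)
  ultimately show ?case
    by (simp add: alt_sum_diff)
qed simp

text \<open>Adjacent transpositions generate all transpositions, and they are the ones that are compatible with
  recursion on lists.\<close>

definition alternating :: "('n list \<Rightarrow> complex) \<Rightarrow> bool" where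
  "alternating f \<longleftrightarrow> (\<forall>xs a b ys. f (xs @ a # b # ys) = - f (xs @ b # a # ys))"

lemma alternatingD: "alternating f \<Longrightarrow> f (xs @ a # b # ys) = - f (xs @ b # a # ys)"
  unfolding alternating_def by blast

lemma alternating_hd: "alternating f \<Longrightarrow> f (a # b # ys) = - f (b # a # ys)"
  using alternatingD[of f "[]" a b ys] by (simp only: append_Nil)

lemma alternating_Cons: "alternating f \<Longrightarrow> alternating (\<lambda>K. f (a # K))"
  unfolding alternating_def append_Cons[symmetric] by blast

lemma alternating_move:
  assumes "alternating f"
  shows "f (xs @ a # ys @ zs) = (-1) ^ length ys * f (xs @ ys @ a # zs)"
proof (induction ys arbitrary: xs)
  case (Cons b ys)
  have "f (xs @ a # (b # ys) @ zs) = - f ((xs @ [b]) @ a # ys @ zs)"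
    using alternatingD[OF assms, of xs a b "ys @ zs"] by (simp only: append_assoc append_Cons append_Nil)
  also have "\<dots> = - ((-1) ^ length ys * f ((xs @ [b]) @ ys @ a # zs))"
    by (simp only: Cons.IH)
  finally show ?case
    by (simp only: append_assoc append_Cons append_Nil length_Cons power_Suc mult_minus1 minus_mult_left)
qed simp

lemma alternating_swap:
  assumes "alternating f" "i < j" "j < length I"
  shows "f (I[i := I ! j, j := I ! i]) = - f I"
proof -
  define xs ys zs where "xs = take i I" and "ys = take (j - Suc i) (drop (Suc i) I)" and "zs = drop (Suc j) I"
  have len: "length xs = i" "length ys = j - Suc i"
    using assms by (auto simp: xs_def ys_def)
  have "drop (Suc i) I = ys @ I ! j # zs"
    using assms id_take_nth_drop[of "j - Suc i" "drop (Suc i) I"] by (simp add: ys_def zs_def)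
  then have I: "I = xs @ I ! i # ys @ I ! j # zs"
    using assms id_take_nth_drop[of i I] by (simp add: xs_def)
  have "I[i := I ! j, j := I ! i] = (xs @ I ! i # ys @ I ! j # zs)[i := I ! j, j := I ! i]"
    using I by simp
  also have "\<dots> = xs @ I ! j # ys @ I ! i # zs"
  proof -
    have "(xs @ a # ys @ b # zs)[length xs := c, length xs + Suc (length ys) := d] = xs @ c # ys @ d # zs"
      for a b c d by (simp add: list_update_append)
    moreover have "length xs + Suc (length ys) = j"
      using len assms by simp
    ultimately show ?thesis
      using len by metis
  qed
  finally have J: "I[i := I ! j, j := I ! i] = xs @ I ! j # ys @ I ! i # zs" .
  have "f (xs @ I ! j # ys @ I ! i # zs) = - f (xs @ I ! i # ys @ I ! j # zs)"
    using alternatingD[OF assms(1), of "xs @ ys" "I ! j" "I ! i" zs]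
    by (simp add: alternating_move[OF assms(1)])
  then show ?thesis
    using I J by simp
qed

lemma alternating_iff_swap:
  "alternating f \<longleftrightarrow> (\<forall>I i j. i < j \<and> j < length I \<longrightarrow> f (I[i := I ! j, j := I ! i]) = - f I)"
proof (intro iffI allI impI)
  assume *: "\<forall>I i j. i < j \<and> j < length I \<longrightarrow> f (I[i := I ! j, j := I ! i]) = - f I"
  show "alternating f"
    unfolding alternating_def
  proof (intro allI)
    fix xs a b ys
    show "f (xs @ a # b # ys) = - f (xs @ b # a # ys)"
      using *[rule_format, of "length xs" "Suc (length xs)" "xs @ b # a # ys"]
      by (simp add: nth_append list_update_append)
  qed
qed (auto intro: alternating_swap)

lemma alternating_alt_sum:
  assumes "\<And>i. alternating (g i)"
  shows "alternating (alt_sum g)"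
  unfolding alternating_def
proof (intro allI)
  fix xs a b ys
  show "alt_sum g (xs @ a # b # ys) = - alt_sum g (xs @ b # a # ys)"
    using assms
  proof (induction xs arbitrary: g)
    case Nil
    have "alt_sum (\<lambda>i L. g i (a # b # L)) ys = - alt_sum (\<lambda>i L. g i (b # a # L)) ys"
      unfolding alt_sum_minus[symmetric] by (rule alt_sum_cong) (rule alternating_hd[OF Nil])
    then show ?case by simp
  next
    case (Cons c xs)
    have "g c (xs @ a # b # ys) = - g c (xs @ b # a # ys)"
      by (rule alternatingD[OF Cons.prems])
    then show ?case
      using Cons.IH[of "\<lambda>i L. g i (c # L)"] alternating_Cons[OF Cons.prems] by simp
  qed
qed

text \<open>The components of the pullback of a covariant tensor along the linear map with matrix \<open>T\<close>. The
  transformation law of forms is the case in which \<open>T\<close> is the Jacobian of a change of coordinates.\<close>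

fun tens :: "('m \<Rightarrow> 'n \<Rightarrow> complex) \<Rightarrow> ('m list \<Rightarrow> complex) \<Rightarrow> 'n list \<Rightarrow> complex" where
  "tens T f [] = f []"
| "tens T f (a # I) = (\<Sum>k\<in>UNIV. T k a * tens T (\<lambda>K. f (k # K)) I)"

lemma sum_lists_Suc:
  fixes F :: "'n::finite list \<Rightarrow> 'c::comm_monoid_add"
  shows "(\<Sum>K | length K = Suc k. F K) = (\<Sum>j\<in>UNIV. \<Sum>K | length K = k. F (j # K))"
proof -
  have "(\<Sum>K | length K = Suc k. F K) = (\<Sum>(j, K) \<in> UNIV \<times> {K. length K = k}. F (j # K))"
    by (rule sum.reindex_bij_witness[where i = "\<lambda>(j, K). j # K" and j = "\<lambda>K. (hd K, tl K)"])
      (auto simp: length_Suc_conv)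
  then show ?thesis
    by (simp add: sum.cartesian_product)
qed

lemma tens_eq_sum:
  fixes T :: "'m::finite \<Rightarrow> 'n \<Rightarrow> complex"
  shows "tens T f I = (\<Sum>K | length K = length I. (\<Prod>l<length I. T (K ! l) (I ! l)) * f K)"
proof (induction I arbitrary: f)
  case (Cons a I)
  show ?case
    unfolding tens.simps(2) Cons.IH length_Cons sum_lists_Suc prod.lessThan_Suc_shift
    by (simp add: sum_distrib_left mult_ac)
qed simp

lemma tens_cong: "(\<And>K. length K = length I \<Longrightarrow> f K = f' K) \<Longrightarrow> tens T f I = tens T f' I"
proof (induction I arbitrary: f f')
  case (Cons a I)
  have "tens T (\<lambda>K. f (k # K)) I = tens T (\<lambda>K. f' (k # K)) I" for k
    by (rule Cons.IH, rule Cons.prems) simp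
  then show ?case by simp
qed simp

lemma tens_add: "tens T (\<lambda>K. f K + f' K) I = tens T f I + tens T f' I"
  by (induction I arbitrary: f f') (simp_all add: sum.distrib algebra_simps)

lemma tens_mult: "tens T (\<lambda>K. c * f K) I = c * tens T f I"
  by (induction I arbitrary: f) (simp_all add: sum_distrib_left mult_ac)

lemma tens_minus: "tens T (\<lambda>K. - f K) I = - tens T f I"
  using tens_mult[of T "-1"] by simp

lemma tens_diff: "tens T (\<lambda>K. f K - f' K) I = tens T f I - tens T f' I"
  using tens_add[of T f "\<lambda>K. - f' K"] by (simp add: tens_minus)

lemma tens_0: "tens T (\<lambda>K. 0) I = 0"
  using tens_mult[of T 0] by simp

lemma tens_sum: "tens T (\<lambda>K. \<Sum>x\<in>S. f x K) I = (\<Sum>x\<in>S. tens T (f x) I)"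
  by (induction S rule: infinite_finite_induct) (simp_all add: tens_0 tens_add)

lemma tens_compose:
  "tens S (tens T f) I = tens (\<lambda>k a. \<Sum>j\<in>UNIV. T k j * S j a) f I"
proof (induction I arbitrary: f)
  case (Cons a I)
  have "tens S (tens T f) (a # I) = (\<Sum>j\<in>UNIV. S j a * (\<Sum>k\<in>UNIV. T k j * tens S (tens T (\<lambda>K. f (k # K))) I))"
    by (simp add: tens_sum tens_mult)
  also have "\<dots> = (\<Sum>k\<in>UNIV. (\<Sum>j\<in>UNIV. T k j * S j a) * tens S (tens T (\<lambda>K. f (k # K))) I)"
    unfolding sum_distrib_left sum_distrib_right by (subst sum.swap) (simp add: mult_ac)
  finally show ?case
    by (simp add: Cons.IH)
qed simp

lemma tens_id: "tens (\<lambda>k a::'n::finite. if k = a then 1 else 0) f I = f I"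
  by (induction I arbitrary: f) (simp_all add: if_distrib[of "\<lambda>c. c * _"] cong: if_cong)

text \<open>Pullback acts on every slot in the same way, so it commutes with the alternation over the slots.\<close>

lemma tens_alt_sum:
  "alt_sum (\<lambda>i L. \<Sum>k\<in>UNIV. T k i * tens T (g k) L) I = tens T (alt_sum g) I"
proof (induction I arbitrary: g)
  case (Cons a I)
  have "alt_sum (\<lambda>i L. \<Sum>k\<in>UNIV. T k i * tens T (g k) (a # L)) I
      = alt_sum (\<lambda>i L. \<Sum>j\<in>UNIV. T j a * (\<Sum>k\<in>UNIV. T k i * tens T (\<lambda>K. g k (j # K)) L)) I"
    by (rule alt_sum_cong, simp add: sum_distrib_left, subst sum.swap, simp add: mult_ac)
  also have "\<dots> = (\<Sum>j\<in>UNIV. T j a * tens T (alt_sum (\<lambda>k K. g k (j # K))) I)"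
    by (subst alt_sum_sum, subst alt_sum_mult, subst Cons.IH) (rule refl)
  finally show ?case
    by (simp add: tens_diff sum_subtractf right_diff_distrib)
qed simp

text \<open>Differentiating \<open>tens T f\<close> replaces \<open>T\<close> by its derivative \<open>T'\<close> in one slot at a time. If \<open>f\<close> is alternating,
  that slot can be moved to the front, at the cost of exactly the sign that \<open>alt_sum\<close> attaches to it.
  Hence the sum over the slots is again an alternating sum; the lemma is the step from \<open>I\<close> to \<open>a # I\<close>.\<close>

lemma tens_Leibniz_alternating:
  fixes T :: "'m \<Rightarrow> 'n \<Rightarrow> complex" and T' :: "'m \<Rightarrow> 'n \<Rightarrow> complex"
  shows "alternating f \<Longrightarrow>
    alt_sum (\<lambda>j L. \<Sum>k\<in>UNIV. T' k j * tens T (\<lambda>K. f (k # K)) L) (a # I)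
    = (\<Sum>k\<in>UNIV. T' k a * tens T (\<lambda>K. f (k # K)) I)
      + (\<Sum>k\<in>UNIV. T k a * alt_sum (\<lambda>j L. \<Sum>m\<in>UNIV. T' m j * tens T (\<lambda>K. f (k # m # K)) L) I)"
proof -
  assume f: "alternating f"
  have "alt_sum (\<lambda>j L. \<Sum>m\<in>UNIV. T' m j * tens T (\<lambda>K. f (m # K)) (a # L)) I
     = alt_sum (\<lambda>j L. - (\<Sum>k\<in>UNIV. T k a * (\<Sum>m\<in>UNIV. T' m j * tens T (\<lambda>K. f (k # m # K)) L))) I"
  proof (rule alt_sum_cong)
    fix j L
    have *: "tens T (\<lambda>K. f (m # k # K)) L = - tens T (\<lambda>K. f (k # m # K)) L" for m k
      by (subst alternating_hd[OF f]) (rule tens_minus)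
    show "(\<Sum>m\<in>UNIV. T' m j * tens T (\<lambda>K. f (m # K)) (a # L))
      = - (\<Sum>k\<in>UNIV. T k a * (\<Sum>m\<in>UNIV. T' m j * tens T (\<lambda>K. f (k # m # K)) L))"
      by (simp add: sum_distrib_left, subst sum.swap, subst *) (simp add: sum_negf mult_ac)
  qed
  also have "\<dots> = - (\<Sum>k\<in>UNIV. T k a * alt_sum (\<lambda>j L. \<Sum>m\<in>UNIV. T' m j * tens T (\<lambda>K. f (k # m # K)) L) I)"
    by (subst alt_sum_minus, subst alt_sum_sum, subst alt_sum_mult) (rule refl)
  finally show ?thesis
    unfolding alt_sum.simps(2) by (simp only: diff_minus_eq_add)
qed

section \<open>Calculus of smooth functions\<close>

abbreviation pd :: "'n::finite \<Rightarrow> (real^'n \<Rightarrow> 'b::real_normed_vector) \<Rightarrow> real^'n \<Rightarrow> 'b" where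
  "pd i f x \<equiv> frechet_derivative f (at x) (axis i 1)"

lemma pd_eqI: "(f has_derivative D) (at x) \<Longrightarrow> pd i f x = D (axis i 1)"
  using frechet_derivative_at by metis

lemma frechet_derivative_cong_open:
  assumes "open S" "x \<in> S" "\<And>y. y \<in> S \<Longrightarrow> f y = g y"
  shows "frechet_derivative f (at x) = frechet_derivative g (at x)"
    and "f differentiable (at x) \<longleftrightarrow> g differentiable (at x)"
proof -
  have "(f has_derivative D) (at x) \<longleftrightarrow> (g has_derivative D) (at x)" for D
    using has_derivative_transform_within_open[OF _ assms(1,2), of f D UNIV g]
      has_derivative_transform_within_open[OF _ assms(1,2), of g D UNIV f] assms(3) by auto
  then show "frechet_derivative f (at x) = frechet_derivative g (at x)"
    "f differentiable (at x) \<longleftrightarrow> g differentiable (at x)"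
    unfolding frechet_derivative_def differentiable_def by simp_all
qed

lemma C_k_on_cong:
  assumes "open S" "\<And>x. x \<in> S \<Longrightarrow> f x = g x"
  shows "C_k_on k S f \<longleftrightarrow> C_k_on k S g"
  using assms(2)
proof (induction k arbitrary: f g)
  case 0
  then show ?case by (simp cong: continuous_on_cong)
next
  case (Suc k)
  have "C_k_on k S (pd i f) \<longleftrightarrow> C_k_on k S (pd i g)" for i
    by (rule Suc.IH) (simp add: frechet_derivative_cong_open(1)[OF assms(1), of _ f g] Suc.prems)
  moreover have "(\<forall>x\<in>S. f differentiable (at x)) \<longleftrightarrow> (\<forall>x\<in>S. g differentiable (at x))"
    using frechet_derivative_cong_open(2)[OF assms(1), of _ f g] Suc.prems by blast
  ultimately show ?case by simp
qed

lemma C_k_on_transform: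
  assumes "open S" "C_k_on k S g" "\<And>x. x \<in> S \<Longrightarrow> f x = g x"
  shows "C_k_on k S f"
  using C_k_on_cong[of S f g k] assms by simp

lemma C_k_on_SucD: "C_k_on (Suc k) S f \<Longrightarrow> C_k_on k S f"
proof (induction k arbitrary: f)
  case 0
  then show ?case
    by (auto intro!: continuous_at_imp_continuous_on differentiable_imp_continuous_within)
next
  case (Suc k)
  then have "C_k_on (Suc k) S (pd i f)" for i by simp
  then have "C_k_on k S (pd i f)" for i by (rule Suc.IH)
  then show ?case using Suc.prems by simp
qed

lemma C_k_on_subset: "C_k_on k S f \<Longrightarrow> T \<subseteq> S \<Longrightarrow> C_k_on k T f"
  by (induction k arbitrary: f) (auto intro: continuous_on_subset)

lemma C_k_on_local:
  assumes "\<And>x. x \<in> S \<Longrightarrow> \<exists>U. open U \<and> x \<in> U \<and> C_k_on k U f"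
  shows "C_k_on k S f"
  using assms
proof (induction k arbitrary: f)
  case 0
  show ?case
    unfolding C_k_on.simps
  proof (rule continuous_at_imp_continuous_on, rule ballI)
    fix x assume "x \<in> S"
    then obtain U where "open U" "x \<in> U" "continuous_on U f" using 0 by auto
    then show "continuous (at x) f" by (simp add: continuous_on_eq_continuous_at)
  qed
next
  case (Suc k)
  have "C_k_on k S (pd i f)" for i
    by (rule Suc.IH) (use Suc.prems in fastforce)
  moreover have "\<forall>x\<in>S. f differentiable (at x)"
    using Suc.prems by fastforce
  ultimately show ?case by simp
qed

lemma C_k_on_const: "C_k_on k S (\<lambda>x. c)"
proof (induction k arbitrary: c)
  case (Suc k)
  have "pd i (\<lambda>x. c) x = 0" for i x
    by (rule pd_eqI[of _ "\<lambda>x. 0"]) simp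
  then show ?case using Suc by simp
qed simp

lemma C_k_on_add:
  assumes "open S"
  shows "C_k_on k S f \<Longrightarrow> C_k_on k S g \<Longrightarrow> C_k_on k S (\<lambda>x. f x + g x)"
proof (induction k arbitrary: f g)
  case 0
  then show ?case by (simp add: continuous_on_add)
next
  case (Suc k)
  have pd: "pd i (\<lambda>x. f x + g x) x = pd i f x + pd i g x" if "x \<in> S" for i x
    by (rule pd_eqI, rule has_derivative_add) (use Suc.prems that in \<open>simp_all flip: frechet_derivative_works\<close>)
  have "C_k_on k S (\<lambda>x. pd i f x + pd i g x)" for i
    using Suc by simp
  then have "C_k_on k S (pd i (\<lambda>x. f x + g x))" for i
    by (rule C_k_on_transform[OF assms]) (rule pd)
  then show ?case using Suc.prems by auto
qed

lemma C_k_on_sum: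
  assumes "open S"
  shows "(\<And>a. a \<in> A \<Longrightarrow> C_k_on k S (f a)) \<Longrightarrow> C_k_on k S (\<lambda>x. \<Sum>a\<in>A. f a x)"
  by (induction A rule: infinite_finite_induct) (simp_all add: C_k_on_const C_k_on_add[OF assms])

lemma pd_bilinear:
  assumes "bounded_bilinear B" "f differentiable (at x)" "g differentiable (at x)"
  shows "pd i (\<lambda>x. B (f x) (g x)) x = B (f x) (pd i g x) + B (pd i f x) (g x)"
  by (rule pd_eqI, rule bounded_bilinear.FDERIV[OF assms(1)])
    (use assms in \<open>auto simp flip: frechet_derivative_works\<close>)

lemma C_k_on_bilinear:
  assumes "open S" "bounded_bilinear B"
  shows "C_k_on k S f \<Longrightarrow> C_k_on k S g \<Longrightarrow> C_k_on k S (\<lambda>x. B (f x) (g x))"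
proof (induction k arbitrary: f g)
  case 0
  then show ?case by (simp add: bounded_bilinear.continuous_on[OF assms(2)])
next
  case (Suc k)
  have pd: "pd i (\<lambda>x. B (f x) (g x)) x = B (f x) (pd i g x) + B (pd i f x) (g x)" if "x \<in> S" for i x
    using Suc.prems that by (intro pd_bilinear[OF assms(2)]) auto
  have C: "C_k_on k S f" "C_k_on k S g" "C_k_on k S (pd i f)" "C_k_on k S (pd i g)" for i
    using Suc.prems C_k_on_SucD by auto
  have "C_k_on k S (\<lambda>x. B (f x) (pd i g x) + B (pd i f x) (g x))" for i
    by (intro C_k_on_add[OF assms(1)] Suc.IH C)
  then have "C_k_on k S (pd i (\<lambda>x. B (f x) (g x)))" for i
    by (rule C_k_on_transform[OF assms(1)]) (rule pd)
  moreover have "(\<lambda>x. B (f x) (g x)) differentiable (at x)" if "x \<in> S" for x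
  proof -
    have "(f has_derivative frechet_derivative f (at x)) (at x)" "(g has_derivative frechet_derivative g (at x)) (at x)"
      using Suc.prems that by (simp_all flip: frechet_derivative_works)
    from bounded_bilinear.FDERIV[OF assms(2) this] show ?thesis
      by (rule differentiableI)
  qed
  ultimately show ?case by simp
qed

lemma C_k_on_linear:
  assumes "open S" "bounded_linear L"
  shows "C_k_on k S f \<Longrightarrow> C_k_on k S (\<lambda>x. L (f x))"
proof (induction k arbitrary: f)
  case 0
  then show ?case by (simp add: bounded_linear.continuous_on[OF assms(2)])
next
  case (Suc k)
  have D: "((\<lambda>x. L (f x)) has_derivative (\<lambda>v. L (frechet_derivative f (at x) v))) (at x)" if "x \<in> S" for x
    by (rule bounded_linear.has_derivative[OF assms(2)])
      (use Suc.prems that in \<open>auto simp flip: frechet_derivative_works\<close>)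
  have "C_k_on k S (\<lambda>x. L (pd i f x))" for i
    using Suc by simp
  then have "C_k_on k S (pd i (\<lambda>x. L (f x)))" for i
    by (rule C_k_on_transform[OF assms(1)]) (rule pd_eqI[OF D])
  then show ?case using D by (auto simp: differentiable_def)
qed

lemma pd_compose:
  fixes f :: "real^'m::finite \<Rightarrow> real^'n::finite"
  assumes "f differentiable (at x)" "g differentiable (at (f x))"
  shows "pd i (\<lambda>x. g (f x)) x = (\<Sum>k\<in>UNIV. (pd i f x $ k) *\<^sub>R pd k g (f x))"
proof -
  let ?D = "frechet_derivative g (at (f x))" and ?v = "pd i f x"
  have D: "(g has_derivative ?D) (at (f x))" "(f has_derivative frechet_derivative f (at x)) (at x)"
    using assms by (simp_all flip: frechet_derivative_works)
  have "pd i (\<lambda>x. g (f x)) x = ?D ?v"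
    using has_derivative_compose[OF D(2,1)] by (rule pd_eqI)
  also have "?v = (\<Sum>k\<in>UNIV. (?v $ k) *\<^sub>R axis k 1)"
    by (simp add: vec_eq_iff axis_def if_distrib[of "\<lambda>c. _ * c"] cong: if_cong)
  also have "?D \<dots> = (\<Sum>k\<in>UNIV. (?v $ k) *\<^sub>R ?D (axis k 1))"
    using has_derivative_linear[OF D(1)] by (simp add: linear_sum linear_scale)
  finally show ?thesis .
qed

lemma C_k_on_compose:
  fixes f :: "real^'m::finite \<Rightarrow> real^'n::finite"
  assumes "open S" "f ` S \<subseteq> T"
  shows "C_k_on k S f \<Longrightarrow> C_k_on k T g \<Longrightarrow> C_k_on k S (\<lambda>x. g (f x))"
proof (induction k arbitrary: g)
  case 0
  then show ?case using assms by (auto intro: continuous_on_compose2)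
next
  case (Suc k)
  have pd: "pd i (\<lambda>x. g (f x)) x = (\<Sum>k\<in>UNIV. (pd i f x $ k) *\<^sub>R pd k g (f x))" if "x \<in> S" for i x
    by (rule pd_compose) (use Suc.prems that assms in auto)
  have 1: "C_k_on k S (\<lambda>x. pd i f x $ j)" for i j
    using Suc.prems by (intro C_k_on_linear[OF assms(1) bounded_linear_vec_nth]) simp
  have 2: "C_k_on k S (\<lambda>x. pd j g (f x))" for j
    by (rule Suc.IH) (use Suc.prems C_k_on_SucD in auto)
  have "C_k_on k S (\<lambda>x. \<Sum>j\<in>UNIV. (pd i f x $ j) *\<^sub>R pd j g (f x))" for i
    by (intro C_k_on_sum[OF assms(1)] C_k_on_bilinear[OF assms(1) bounded_bilinear_scaleR] 1 2)
  then have "C_k_on k S (pd i (\<lambda>x. g (f x)))" for i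
    by (rule C_k_on_transform[OF assms(1)]) (rule pd)
  moreover have "(\<lambda>x. g (f x)) differentiable (at x)" if "x \<in> S" for x
    using Suc.prems that assms differentiable_chain_at[of f x g] by (auto simp: o_def)
  ultimately show ?case by simp
qed

lemma smooth_on_cong: "open S \<Longrightarrow> (\<And>x. x \<in> S \<Longrightarrow> f x = g x) \<Longrightarrow> smooth_on S f \<longleftrightarrow> smooth_on S g"
  by (simp add: smooth_on_def C_k_on_cong[of S f g])

lemma smooth_on_subset: "smooth_on S f \<Longrightarrow> T \<subseteq> S \<Longrightarrow> smooth_on T f"
  by (simp add: smooth_on_def C_k_on_subset[of _ S f T])

lemma smooth_on_local:
  "(\<And>x. x \<in> S \<Longrightarrow> \<exists>U. open U \<and> x \<in> U \<and> smooth_on U f) \<Longrightarrow> smooth_on S f"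
  unfolding smooth_on_def by (intro allI C_k_on_local) blast

lemma smooth_on_const: "smooth_on S (\<lambda>x. c)"
  by (simp add: smooth_on_def C_k_on_const)

lemma smooth_on_add: "open S \<Longrightarrow> smooth_on S f \<Longrightarrow> smooth_on S g \<Longrightarrow> smooth_on S (\<lambda>x. f x + g x)"
  by (simp add: smooth_on_def C_k_on_add)

lemma smooth_on_sum:
  "open S \<Longrightarrow> (\<And>a. a \<in> A \<Longrightarrow> smooth_on S (f a)) \<Longrightarrow> smooth_on S (\<lambda>x. \<Sum>a\<in>A. f a x)"
  by (simp add: smooth_on_def C_k_on_sum)

lemma smooth_on_bilinear:
  "open S \<Longrightarrow> bounded_bilinear B \<Longrightarrow> smooth_on S f \<Longrightarrow> smooth_on S g \<Longrightarrow> smooth_on S (\<lambda>x. B (f x) (g x))"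
  by (simp add: smooth_on_def C_k_on_bilinear)

lemma smooth_on_mult:
  fixes f :: "real^'n::finite \<Rightarrow> 'b::real_normed_algebra"
  shows "open S \<Longrightarrow> smooth_on S f \<Longrightarrow> smooth_on S g \<Longrightarrow> smooth_on S (\<lambda>x. f x * g x)"
  by (rule smooth_on_bilinear[OF _ bounded_bilinear_mult])

lemma smooth_on_linear: "open S \<Longrightarrow> bounded_linear L \<Longrightarrow> smooth_on S f \<Longrightarrow> smooth_on S (\<lambda>x. L (f x))"
  by (simp add: smooth_on_def C_k_on_linear)

lemma smooth_on_compose:
  fixes f :: "real^'m::finite \<Rightarrow> real^'n::finite"
  shows "open S \<Longrightarrow> f ` S \<subseteq> T \<Longrightarrow> smooth_on S f \<Longrightarrow> smooth_on T g \<Longrightarrow> smooth_on S (\<lambda>x. g (f x))"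
  by (simp add: smooth_on_def C_k_on_compose[of S f T])

lemma smooth_on_pd: "smooth_on S f \<Longrightarrow> smooth_on S (pd i f)"
  unfolding smooth_on_def by (metis C_k_on.simps(2))

lemma smooth_on_differentiable: "smooth_on S f \<Longrightarrow> x \<in> S \<Longrightarrow> f differentiable (at x)"
  unfolding smooth_on_def by (metis C_k_on.simps(2))

lemma smooth_on_continuous: "smooth_on S f \<Longrightarrow> continuous_on S f"
  unfolding smooth_on_def by (metis C_k_on.simps(1))

section \<open>Symmetry of second derivatives\<close>

text \<open>Two applications of the mean value theorem, first in direction \<open>i\<close> and then in direction \<open>j\<close>. The second
  difference on the left is symmetric in \<open>i\<close> and \<open>j\<close>, and this symmetry passes to the mixed derivatives
  as \<open>h\<close> tends to zero.\<close>

lemma second_difference: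
  fixes f :: "real^'n::finite \<Rightarrow> real"
  assumes "smooth_on (ball x r) f" "0 < h" "2 * h < r"
  shows "\<exists>\<xi>. dist x \<xi> \<le> 2 * h \<and>
    f (x + h *\<^sub>R axis i 1 + h *\<^sub>R axis j 1) - f (x + h *\<^sub>R axis i 1) - f (x + h *\<^sub>R axis j 1) + f x
      = h * h * pd j (pd i f) \<xi>"
proof -
  let ?e = "axis i 1 :: real^'n" and ?e' = "axis j 1 :: real^'n"
  have dist: "dist x (x + s *\<^sub>R ?e + t *\<^sub>R ?e') \<le> \<bar>s\<bar> + \<bar>t\<bar>" for s t
    using norm_triangle_ineq[of "s *\<^sub>R ?e" "t *\<^sub>R ?e'"] by (simp add: dist_norm add.assoc norm_minus_commute add.commute)
  have ball: "x + s *\<^sub>R ?e + t *\<^sub>R ?e' \<in> ball x r" if "0 \<le> s" "s \<le> h" "0 \<le> t" "t \<le> h" for s t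
    using dist[of s t] that assms by (simp add: order.strict_trans1)
  have d1: "((\<lambda>s. f (x + s *\<^sub>R ?e + t *\<^sub>R ?e')) has_real_derivative pd i f (x + s *\<^sub>R ?e + t *\<^sub>R ?e')) (at s)"
    if "0 \<le> s" "s \<le> h" "0 \<le> t" "t \<le> h" for s t
  proof -
    let ?D = "frechet_derivative f (at (x + s *\<^sub>R ?e + t *\<^sub>R ?e'))"
    have D: "(f has_derivative ?D) (at (x + s *\<^sub>R ?e + t *\<^sub>R ?e'))"
      using smooth_on_differentiable[OF assms(1) ball[OF that]] by (simp flip: frechet_derivative_works)
    have "((\<lambda>s. x + s *\<^sub>R ?e + t *\<^sub>R ?e') has_derivative (\<lambda>u. u *\<^sub>R ?e)) (at s)"
      by (auto intro!: derivative_eq_intros)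
    from has_derivative_compose[OF this D]
    have "((\<lambda>s. f (x + s *\<^sub>R ?e + t *\<^sub>R ?e')) has_derivative (\<lambda>u. ?D (u *\<^sub>R ?e))) (at s)" .
    moreover have "(\<lambda>u. ?D (u *\<^sub>R ?e)) = (*) (?D ?e)"
      using has_derivative_linear[OF D] by (auto simp: linear_scale)
    ultimately show ?thesis by (simp add: has_field_derivative_def)
  qed
  have d2: "((\<lambda>t. pd i f (x + s *\<^sub>R ?e + t *\<^sub>R ?e')) has_real_derivative pd j (pd i f) (x + s *\<^sub>R ?e + t *\<^sub>R ?e')) (at t)"
    if "0 \<le> s" "s \<le> h" "0 \<le> t" "t \<le> h" for s t
  proof -
    let ?D = "frechet_derivative (pd i f) (at (x + s *\<^sub>R ?e + t *\<^sub>R ?e'))"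
    have D: "(pd i f has_derivative ?D) (at (x + s *\<^sub>R ?e + t *\<^sub>R ?e'))"
      using smooth_on_differentiable[OF smooth_on_pd[OF assms(1)] ball[OF that]] by (simp flip: frechet_derivative_works)
    have "((\<lambda>t. x + s *\<^sub>R ?e + t *\<^sub>R ?e') has_derivative (\<lambda>u. u *\<^sub>R ?e')) (at t)"
      by (auto intro!: derivative_eq_intros)
    from has_derivative_compose[OF this D]
    have "((\<lambda>t. pd i f (x + s *\<^sub>R ?e + t *\<^sub>R ?e')) has_derivative (\<lambda>u. ?D (u *\<^sub>R ?e'))) (at t)" .
    moreover have "(\<lambda>u. ?D (u *\<^sub>R ?e')) = (*) (?D ?e')"
      using has_derivative_linear[OF D] by (auto simp: linear_scale)
    ultimately show ?thesis by (simp add: has_field_derivative_def)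
  qed
  define \<phi> where "\<phi> s = f (x + s *\<^sub>R ?e + h *\<^sub>R ?e') - f (x + s *\<^sub>R ?e + 0 *\<^sub>R ?e')" for s
  have "(\<phi> has_real_derivative pd i f (x + s *\<^sub>R ?e + h *\<^sub>R ?e') - pd i f (x + s *\<^sub>R ?e + 0 *\<^sub>R ?e')) (at s)"
    if "0 \<le> s" "s \<le> h" for s
    unfolding \<phi>_def using that assms(2) by (intro DERIV_diff d1) auto
  from MVT2[OF assms(2) this] obtain s where s: "0 < s" "s < h"
    "\<phi> h - \<phi> 0 = (h - 0) * (pd i f (x + s *\<^sub>R ?e + h *\<^sub>R ?e') - pd i f (x + s *\<^sub>R ?e + 0 *\<^sub>R ?e'))"
    by blast
  obtain t where t: "0 < t" "t < h"
    "pd i f (x + s *\<^sub>R ?e + h *\<^sub>R ?e') - pd i f (x + s *\<^sub>R ?e + 0 *\<^sub>R ?e')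
      = (h - 0) * pd j (pd i f) (x + s *\<^sub>R ?e + t *\<^sub>R ?e')"
    using MVT2[OF assms(2), of "\<lambda>t. pd i f (x + s *\<^sub>R ?e + t *\<^sub>R ?e')"
        "\<lambda>t. pd j (pd i f) (x + s *\<^sub>R ?e + t *\<^sub>R ?e')"] d2 s(1,2) by force
  have "dist x (x + s *\<^sub>R ?e + t *\<^sub>R ?e') \<le> 2 * h"
    using dist[of s t] s t by simp
  moreover have "\<phi> h - \<phi> 0 = h * h * pd j (pd i f) (x + s *\<^sub>R ?e + t *\<^sub>R ?e')"
    using s(3) unfolding t(3) by simp
  ultimately show ?thesis
    unfolding \<phi>_def by (intro exI[of _ "x + s *\<^sub>R ?e + t *\<^sub>R ?e'"]) (simp add: algebra_simps)
qed

lemma pd_commute_real: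
  fixes f :: "real^'n::finite \<Rightarrow> real"
  assumes "smooth_on S f" "open S" "x \<in> S"
  shows "pd i (pd j f) x = pd j (pd i f) x"
proof -
  obtain r where r: "r > 0" "ball x r \<subseteq> S" using assms openE by blast
  have sm: "smooth_on (ball x r) f" using assms(1) r(2) by (rule smooth_on_subset)
  define h where "h k = r / 3 * inverse (real (Suc k))" for k :: nat
  have h: "0 < h k" "2 * h k < r" for k
    using r(1) by (auto simp: h_def field_simps add_pos_nonneg)
  have h0: "h \<longlonglongrightarrow> 0"
    unfolding h_def using tendsto_mult_left[OF LIMSEQ_inverse_real_of_nat, of "r / 3"] by simp
  obtain a where a: "\<And>k. dist x (a k) \<le> 2 * h k" "\<And>k. f (x + h k *\<^sub>R axis i 1 + h k *\<^sub>R axis j 1)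
      - f (x + h k *\<^sub>R axis i 1) - f (x + h k *\<^sub>R axis j 1) + f x = h k * h k * pd j (pd i f) (a k)"
    using second_difference[OF sm h, where i = i and j = j] by metis
  obtain b where b: "\<And>k. dist x (b k) \<le> 2 * h k" "\<And>k. f (x + h k *\<^sub>R axis j 1 + h k *\<^sub>R axis i 1)
      - f (x + h k *\<^sub>R axis j 1) - f (x + h k *\<^sub>R axis i 1) + f x = h k * h k * pd i (pd j f) (b k)"
    using second_difference[OF sm h, where i = j and j = i] by metis
  have ab: "h k * h k * pd j (pd i f) (a k) = h k * h k * pd i (pd j f) (b k)" for k
    unfolding a(2)[symmetric] b(2)[symmetric] by (simp add: algebra_simps)
  have eq: "pd j (pd i f) (a k) = pd i (pd j f) (b k)" for k
    using ab[of k] h(1)[of k] by simp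
  have lim: "(\<lambda>k. pd i (pd j f) (c k)) \<longlonglongrightarrow> pd i (pd j f) x" if "\<And>k. dist x (c k) \<le> 2 * h k" for c i j
  proof -
    have "c \<longlonglongrightarrow> x"
    proof (rule iffD2[OF tendsto_dist_iff], rule tendsto_sandwich[OF _ _ tendsto_const])
      show "(\<lambda>k. 2 * h k) \<longlonglongrightarrow> 0"
        using tendsto_mult[OF tendsto_const h0, of 2] by (simp only: mult_zero_right)
    qed (use that in \<open>simp_all add: dist_commute\<close>)
    have "continuous (at x) (pd i (pd j f))"
      using smooth_on_continuous[OF smooth_on_pd[OF smooth_on_pd[OF assms(1)]]] assms(3)
      unfolding continuous_on_eq_continuous_at[OF assms(2)] by (rule bspec)
    then show ?thesis
      using \<open>c \<longlonglongrightarrow> x\<close> by (rule isCont_tendsto_compose)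
  qed
  show ?thesis
    by (rule LIMSEQ_unique[OF lim[OF b(1)]]) (use lim[OF a(1), where i = j and j = i] in \<open>simp only: eq\<close>)
qed

lemma pd_commute:
  fixes f :: "real^'n::finite \<Rightarrow> complex"
  assumes "smooth_on S f" "open S" "x \<in> S"
  shows "pd i (pd j f) x = pd j (pd i f) x"
proof -
  have lin: "pd i (\<lambda>x. L (g x)) y = L (pd i g y)"
    if "bounded_linear L" "smooth_on S g" "y \<in> S" for i y and L :: "complex \<Rightarrow> real" and g
    by (rule pd_eqI, rule bounded_linear.has_derivative[OF that(1)])
      (use smooth_on_differentiable[OF that(2,3)] in \<open>simp flip: frechet_derivative_works\<close>)
  have lin2: "pd i (pd j (\<lambda>x. L (f x))) x = L (pd i (pd j f) x)" if L: "bounded_linear L" for i j and L :: "complex \<Rightarrow> real"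
    using frechet_derivative_cong_open(1)[OF assms(2,3) lin[OF L assms(1)]]
      lin[OF L smooth_on_pd[OF assms(1)] assms(3)] by simp
  have "L (pd i (pd j f) x) = L (pd j (pd i f) x)" if L: "bounded_linear L" for L :: "complex \<Rightarrow> real"
    using pd_commute_real[OF smooth_on_linear[OF assms(2) L assms(1)] assms(2,3)] lin2[OF L] by metis
  from this[OF bounded_linear_Re] this[OF bounded_linear_Im] show ?thesis
    by (rule complex_eqI)
qed

section \<open>The exterior derivative of forms\<close>

lemma pd_add:
  "f differentiable (at x) \<Longrightarrow> g differentiable (at x) \<Longrightarrow> pd i (\<lambda>x. f x + g x) x = pd i f x + pd i g x"
  by (rule pd_eqI, rule has_derivative_add) (simp_all flip: frechet_derivative_works)

lemma pd_linear:
  assumes "bounded_linear L" "f differentiable (at x)"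
  shows "pd i (\<lambda>x. L (f x)) x = L (pd i f x)"
  by (rule pd_eqI, rule bounded_linear.has_derivative[OF assms(1)])
    (use assms(2) in \<open>simp flip: frechet_derivative_works\<close>)

lemma pd_sum:
  assumes "\<And>a. a \<in> S \<Longrightarrow> f a differentiable (at x)"
  shows "pd i (\<lambda>x. \<Sum>a\<in>S. f a x) x = (\<Sum>a\<in>S. pd i (f a) x)"
  by (rule pd_eqI, rule has_derivative_sum) (use assms in \<open>simp flip: frechet_derivative_works\<close>)

lemma pd_mult:
  fixes f g :: "real^'n::finite \<Rightarrow> complex"
  assumes "f differentiable (at x)" "g differentiable (at x)"
  shows "pd i (\<lambda>x. f x * g x) x = f x * pd i g x + pd i f x * g x"
  by (rule pd_bilinear[OF bounded_bilinear_mult assms])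

lemma pd_const: "pd i (\<lambda>x. c) x = 0"
  by (rule pd_eqI[of _ "\<lambda>x. 0"]) simp

lemma pd_cmult:
  fixes f :: "real^'n::finite \<Rightarrow> complex"
  assumes "f differentiable (at x)"
  shows "pd i (\<lambda>x. c * f x) x = c * pd i f x"
  by (rule pd_linear[OF bounded_linear_mult_right assms])

lemma pd_minus:
  fixes f :: "real^'n::finite \<Rightarrow> complex"
  assumes "f differentiable (at x)"
  shows "pd i (\<lambda>x. - f x) x = - pd i f x"
  using pd_cmult[OF assms, of "-1" i] by simp

lemma pd_cong_open:
  assumes "open S" "x \<in> S" "\<And>y. y \<in> S \<Longrightarrow> f y = g y"
  shows "pd i f x = pd i g x"
  using frechet_derivative_cong_open(1)[OF assms] by simp

lemma pd_alt_sum: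
  assumes "\<And>j L. (\<lambda>x. g x j L) differentiable (at x)"
  shows "pd i (\<lambda>x. alt_sum (g x) I) x = alt_sum (\<lambda>j L. pd i (\<lambda>x. g x j L) x) I"
proof -
  have "pd i (\<lambda>x. (-1) ^ l * g x (I ! l) (take l I @ drop (Suc l) I)) x
      = (-1) ^ l * pd i (\<lambda>x. g x (I ! l) (take l I @ drop (Suc l) I)) x" for l
    by (rule pd_cmult) (rule assms)
  moreover have "(\<lambda>x. (-1) ^ l * g x (I ! l) (take l I @ drop (Suc l) I)) differentiable (at x)" for l
    by (intro differentiable_mult differentiable_const assms)
  ultimately show ?thesis
    unfolding alt_sum_eq_sum by (subst pd_sum) simp_all
qed

lemma smooth_on_alt_sum:
  assumes "open S" "\<And>j L. smooth_on S (\<lambda>x. g x j L)"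
  shows "smooth_on S (\<lambda>x. alt_sum (g x) I)"
  unfolding alt_sum_eq_sum by (intro smooth_on_sum smooth_on_mult smooth_on_const assms)

text \<open>The Leibniz rule for pulled back tensors; the second summand collects the derivatives of \<open>T\<close>.\<close>

lemma pd_tens_alternating:
  fixes T :: "real^'n::finite \<Rightarrow> 'm::finite \<Rightarrow> 'l \<Rightarrow> complex"
  assumes "\<And>k a. (\<lambda>x. T x k a) differentiable (at x)" "\<And>K. (\<lambda>x. f x K) differentiable (at x)"
    and "\<And>x. alternating (f x)"
  shows "(\<lambda>x. tens (T x) (f x) L) differentiable (at x)"
    and "pd i (\<lambda>x. tens (T x) (f x) L) x = tens (T x) (\<lambda>K. pd i (\<lambda>x. f x K) x) L
      + alt_sum (\<lambda>j L. \<Sum>k\<in>UNIV. pd i (\<lambda>x. T x k j) x * tens (T x) (\<lambda>K. f x (k # K)) L) L"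
proof -
  have "(\<lambda>x. tens (T x) (f x) L) differentiable (at x) \<and>
    pd i (\<lambda>x. tens (T x) (f x) L) x = tens (T x) (\<lambda>K. pd i (\<lambda>x. f x K) x) L
      + alt_sum (\<lambda>j L. \<Sum>k\<in>UNIV. pd i (\<lambda>x. T x k j) x * tens (T x) (\<lambda>K. f x (k # K)) L) L"
    using assms(2,3)
  proof (induction L arbitrary: f)
    case (Cons a L)
    have alt: "\<And>x. alternating (\<lambda>K. f x (k # K))" for k
      by (rule alternating_Cons[OF Cons.prems(2)])
    note IH = Cons.IH[OF Cons.prems(1) alt]
    have d: "(\<lambda>x. T x k a * tens (T x) (\<lambda>K. f x (k # K)) L) differentiable (at x)" for k
      by (intro differentiable_mult assms(1) IH[THEN conjunct1])
    have "pd i (\<lambda>x. tens (T x) (f x) (a # L)) x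
        = (\<Sum>k\<in>UNIV. T x k a * pd i (\<lambda>x. tens (T x) (\<lambda>K. f x (k # K)) L) x
            + pd i (\<lambda>x. T x k a) x * tens (T x) (\<lambda>K. f x (k # K)) L)"
      unfolding tens.simps(2) pd_sum[OF d]
      by (intro sum.cong refl pd_mult assms(1) IH[THEN conjunct1])
    also have "\<dots> = (\<Sum>k\<in>UNIV. T x k a * tens (T x) (\<lambda>K. pd i (\<lambda>x. f x (k # K)) x) L)
        + ((\<Sum>k\<in>UNIV. pd i (\<lambda>x. T x k a) x * tens (T x) (\<lambda>K. f x (k # K)) L)
        + (\<Sum>k\<in>UNIV. T x k a * alt_sum (\<lambda>j L. \<Sum>m\<in>UNIV. pd i (\<lambda>x. T x m j) x
              * tens (T x) (\<lambda>K. f x (k # m # K)) L) L))"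
      unfolding IH[THEN conjunct2] by (simp only: sum.distrib distrib_left add_ac)
    finally have "pd i (\<lambda>x. tens (T x) (f x) (a # L)) x = \<dots>" .
    moreover have "(\<lambda>x. tens (T x) (f x) (a # L)) differentiable (at x)"
      unfolding tens.simps(2) by (intro differentiable_sum d finite ballI)
    ultimately show ?case
      unfolding tens_Leibniz_alternating[OF Cons.prems(2)] tens.simps(2) by blast
  qed simp
  then show "(\<lambda>x. tens (T x) (f x) L) differentiable (at x)"
    and "pd i (\<lambda>x. tens (T x) (f x) L) x = tens (T x) (\<lambda>K. pd i (\<lambda>x. f x K) x) L
      + alt_sum (\<lambda>j L. \<Sum>k\<in>UNIV. pd i (\<lambda>x. T x k j) x * tens (T x) (\<lambda>K. f x (k # K)) L) L"
    by blast+
qed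

text \<open>Naturality of the exterior derivative under a change of coordinates \<open>\<tau>\<close>. By the Leibniz rule there are two
  kinds of terms: the first derivatives of \<open>w\<close> transform by the chain rule, and the second
  derivatives of \<open>\<tau>\<close> are symmetric and cancel by \<open>alt_sum_alt_sum_symmetric\<close>.\<close>

lemma alt_sum_pd_pullback:
  fixes \<tau> :: "real^'n::finite \<Rightarrow> real^'n" and w :: "real^'n \<Rightarrow> 'n list \<Rightarrow> complex"
  assumes U: "open U" "x \<in> U" and \<tau>: "smooth_on U \<tau>" "\<tau> ` U \<subseteq> V"
    and w: "\<And>L. smooth_on V (\<lambda>y. w y L)" "\<And>y. alternating (w y)"
  defines "T \<equiv> \<lambda>x k a. complex_of_real (pd a \<tau> x $ k)"
  shows "alt_sum (\<lambda>i L. pd i (\<lambda>x. tens (T x) (w (\<tau> x)) L) x) I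
    = tens (T x) (alt_sum (\<lambda>k L. pd k (\<lambda>y. w y L) (\<tau> x))) I"
proof -
  have lin: "bounded_linear (\<lambda>v::real^'n. complex_of_real (v $ k))" for k
    by (rule bounded_linear_compose[OF bounded_linear_of_real bounded_linear_vec_nth])
  have T_pd: "T y k a = pd a (\<lambda>x. complex_of_real (\<tau> x $ k)) y" if "y \<in> U" for y k a
    unfolding T_def using pd_linear[OF lin smooth_on_differentiable[OF \<tau>(1) that]] by simp
  have T_smooth: "smooth_on U (\<lambda>x. T x k a)" for k a
    unfolding T_def by (rule smooth_on_linear[OF U(1) lin]) (rule smooth_on_pd[OF \<tau>(1)])
  have w_smooth: "smooth_on U (\<lambda>x. w (\<tau> x) K)" for K
    by (rule smooth_on_compose[OF U(1) \<tau>(2,1) w(1)])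
  have "pd i (\<lambda>x. T x k j) x = pd i (pd j (\<lambda>x. complex_of_real (\<tau> x $ k))) x" for i j k
    by (rule pd_cong_open[OF U T_pd])
  then have sym: "pd i (\<lambda>x. T x k j) x = pd j (\<lambda>x. T x k i) x" for i j k
    using pd_commute[OF smooth_on_linear[OF U(1) lin \<tau>(1)] U] by metis
  have chain: "pd i (\<lambda>x. w (\<tau> x) K) x = (\<Sum>k\<in>UNIV. T x k i * pd k (\<lambda>y. w y K) (\<tau> x))" for i K
  proof -
    have "\<tau> x \<in> V" using U(2) \<tau>(2) by blast
    from pd_compose[OF smooth_on_differentiable[OF \<tau>(1) U(2)] smooth_on_differentiable[OF w(1) this]]
    show ?thesis by (simp add: T_def scaleR_conv_of_real)
  qed
  have "alt_sum (\<lambda>i L. pd i (\<lambda>x. tens (T x) (w (\<tau> x)) L) x) I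
    = alt_sum (\<lambda>i L. tens (T x) (\<lambda>K. pd i (\<lambda>x. w (\<tau> x) K) x) L) I
      + alt_sum (\<lambda>i. alt_sum (\<lambda>j L. \<Sum>k\<in>UNIV. pd i (\<lambda>x. T x k j) x * tens (T x) (\<lambda>K. w (\<tau> x) (k # K)) L)) I"
    using smooth_on_differentiable[OF T_smooth U(2)] smooth_on_differentiable[OF w_smooth U(2)] w(2)
    by (subst pd_tens_alternating(2)) (simp_all add: alt_sum_add)
  also have "alt_sum (\<lambda>i. alt_sum (\<lambda>j L. \<Sum>k\<in>UNIV. pd i (\<lambda>x. T x k j) x * tens (T x) (\<lambda>K. w (\<tau> x) (k # K)) L)) I = 0"
    by (rule alt_sum_alt_sum_symmetric) (subst sym, rule refl)
  also have "alt_sum (\<lambda>i L. tens (T x) (\<lambda>K. pd i (\<lambda>x. w (\<tau> x) K) x) L) I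
    = alt_sum (\<lambda>i L. \<Sum>k\<in>UNIV. T x k i * tens (T x) (\<lambda>K. pd k (\<lambda>y. w y K) (\<tau> x)) L) I"
    unfolding chain tens_sum tens_mult ..
  also have "\<dots> = tens (T x) (alt_sum (\<lambda>k L. pd k (\<lambda>y. w y L) (\<tau> x))) I"
    by (rule tens_alt_sum)
  finally show ?thesis by simp
qed

lemma atlas_chart:
  assumes "oriented_atlas A" "c \<in> A"
  shows "open (fst c)" "open (snd c ` fst c)" "q \<in> fst c \<Longrightarrow> chart_inv c (snd c q) = q"
    "x \<in> snd c ` fst c \<Longrightarrow> chart_inv c x \<in> fst c" "x \<in> snd c ` fst c \<Longrightarrow> snd c (chart_inv c x) = x"
    "continuous_on (fst c) (snd c)" "continuous_on (snd c ` fst c) (chart_inv c)"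
  using assms unfolding oriented_atlas_def is_chart_def homeomorphism_def
  by (blast intro: inv_into_into f_inv_into_f)+

lemma open_chart_image:
  assumes "oriented_atlas A" "c \<in> A" "open U" "U \<subseteq> fst c"
  shows "open (snd c ` U)"
proof -
  have "snd c ` U = snd c ` fst c \<inter> chart_inv c -` U"
    using assms(4) atlas_chart(3,5)[OF assms(1,2)] by (force simp: image_iff)
  then show ?thesis
    using continuous_open_preimage[OF atlas_chart(7,2)[OF assms(1,2)] assms(3)] by simp
qed

lemma transition_jacobian_eq:
  "transition_jacobian c c' q $ k $ i = pd i (snd c' \<circ> chart_inv c) (snd c q) $ k"
  by (simp add: transition_jacobian_def jacobian_def matrix_def)

abbreviation jac :: "('a, 'n::finite) chart \<Rightarrow> ('a, 'n) chart \<Rightarrow> 'a \<Rightarrow> 'n \<Rightarrow> 'n \<Rightarrow> complex" where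
  "jac c c' q k i \<equiv> complex_of_real (transition_jacobian c c' q $ k $ i)"

lemma forms_iff:
  "\<omega> \<in> forms A k \<longleftrightarrow>
     (\<forall>c q I. \<omega> c q I \<noteq> 0 \<longrightarrow> c \<in> A \<and> q \<in> fst c \<and> int (length I) = k) \<and>
     (\<forall>c q. alternating (\<omega> c q)) \<and>
     (\<forall>c\<in>A. \<forall>I. smooth_on (snd c ` fst c) (\<lambda>x. \<omega> c (chart_inv c x) I)) \<and>
     (\<forall>c\<in>A. \<forall>c'\<in>A. \<forall>q \<in> fst c \<inter> fst c'. \<forall>I. \<omega> c q I = tens (jac c c' q) (\<omega> c' q) I)"
  unfolding forms_def alternating_iff_swap smooth_in_chart_def tens_eq_sum o_def by simp

lemma formsD:
  assumes "\<omega> \<in> forms A k"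
  shows "\<omega> c q I \<noteq> 0 \<Longrightarrow> c \<in> A" "\<omega> c q I \<noteq> 0 \<Longrightarrow> q \<in> fst c" "\<omega> c q I \<noteq> 0 \<Longrightarrow> int (length I) = k"
    "alternating (\<omega> c q)" "c \<in> A \<Longrightarrow> smooth_on (snd c ` fst c) (\<lambda>x. \<omega> c (chart_inv c x) I)"
    "c \<in> A \<Longrightarrow> c' \<in> A \<Longrightarrow> q \<in> fst c \<Longrightarrow> q \<in> fst c' \<Longrightarrow> \<omega> c q I = tens (jac c c' q) (\<omega> c' q) I"
  using assms unfolding forms_iff by blast+

lemma forms_0: "0 \<in> forms A k"
  by (simp add: forms_iff alternating_def smooth_on_const tens_0 zero_fun_def)

lemma forms_add:
  assumes "oriented_atlas A" "\<omega> \<in> forms A k" "\<eta> \<in> forms A k"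
  shows "\<omega> + \<eta> \<in> forms A k"
  unfolding forms_iff plus_fun_def
proof (intro conjI allI ballI impI)
  show "alternating (\<lambda>I. \<omega> c q I + \<eta> c q I)" for c q
    using formsD(4)[OF assms(2), of c q] formsD(4)[OF assms(3), of c q]
    unfolding alternating_def by (metis minus_add_distrib)
  show "smooth_on (snd c ` fst c) (\<lambda>x. \<omega> c (chart_inv c x) I + \<eta> c (chart_inv c x) I)" if "c \<in> A" for c I
    using that by (intro smooth_on_add atlas_chart(2)[OF assms(1)] formsD(5)[OF assms(2)] formsD(5)[OF assms(3)])
  show "\<omega> c q I + \<eta> c q I = tens (jac c c' q) (\<lambda>I. \<omega> c' q I + \<eta> c' q I) I"
    if "c \<in> A" "c' \<in> A" "q \<in> fst c \<inter> fst c'" for c c' q I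
    using formsD(6)[OF assms(2) that(1,2)] formsD(6)[OF assms(3) that(1,2)] that(3) by (simp add: tens_add)
qed (use formsD(1-3)[OF assms(2)] formsD(1-3)[OF assms(3)] in \<open>metis add.right_neutral\<close>)+

lemma forms_smul:
  assumes "oriented_atlas A" "\<omega> \<in> forms A k"
  shows "smul a \<omega> \<in> forms A k"
  unfolding forms_iff smul_def
proof (intro conjI allI ballI impI)
  show "alternating (\<lambda>I. a * \<omega> c q I)" for c q
    using formsD(4)[OF assms(2), of c q] unfolding alternating_def by (metis mult_minus_right)
  show "smooth_on (snd c ` fst c) (\<lambda>x. a * \<omega> c (chart_inv c x) I)" if "c \<in> A" for c I
    using that by (intro smooth_on_mult smooth_on_const atlas_chart(2)[OF assms(1)] formsD(5)[OF assms(2)])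
  show "a * \<omega> c q I = tens (jac c c' q) (\<lambda>I. a * \<omega> c' q I) I"
    if "c \<in> A" "c' \<in> A" "q \<in> fst c \<inter> fst c'" for c c' q I
    using formsD(6)[OF assms(2) that(1,2)] that(3) by (simp add: tens_mult)
qed (use formsD(1-3)[OF assms(2)] in \<open>metis mult_zero_right\<close>)+

lemma ext_deriv_eq_alt_sum:
  assumes "c \<in> A" "q \<in> fst c"
  shows "ext_deriv A \<omega> c q I = alt_sum (\<lambda>i L. pd i (\<lambda>x. \<omega> c (chart_inv c x) L) (snd c q)) I"
  using assms by (simp add: ext_deriv_def alt_sum_eq_sum coord_deriv_def o_def)

lemma ext_deriv_outside: "c \<notin> A \<or> q \<notin> fst c \<Longrightarrow> ext_deriv A \<omega> c q I = 0"
  by (auto simp: ext_deriv_def)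

lemma ext_deriv_forms:
  assumes A: "oriented_atlas A" and \<omega>: "\<omega> \<in> forms A k"
  shows "ext_deriv A \<omega> \<in> forms A (k + 1)"
  unfolding forms_iff
proof (intro conjI allI ballI impI)
  note chart = atlas_chart[OF A]
  have diff: "(\<lambda>x. \<omega> c (chart_inv c x) L) differentiable (at (snd c q))" if "c \<in> A" "q \<in> fst c" for c q L
    by (rule smooth_on_differentiable[OF formsD(5)[OF \<omega>]]) (use that in auto)
  show "c \<in> A" if "ext_deriv A \<omega> c q I \<noteq> 0" for c q I
    using that ext_deriv_outside by metis
  show "q \<in> fst c" if "ext_deriv A \<omega> c q I \<noteq> 0" for c q I
    using that ext_deriv_outside by metis
  show "int (length I) = k + 1" if nz: "ext_deriv A \<omega> c q I \<noteq> 0" for c q I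
  proof (rule ccontr)
    assume len: "int (length I) \<noteq> k + 1"
    have "\<omega> c x L = 0" if "Suc (length L) = length I" for x L
      using formsD(3)[OF \<omega>, of c x L] len that by auto
    then have "alt_sum (\<lambda>i L. pd i (\<lambda>x. \<omega> c (chart_inv c x) L) (snd c q)) I = alt_sum (\<lambda>i L. 0) I"
      by (intro alt_sum_cong) (simp add: pd_const)
    then show False
      using nz by (cases "c \<in> A \<and> q \<in> fst c") (simp_all add: ext_deriv_eq_alt_sum ext_deriv_outside alt_sum_0)
  qed
  show "alternating (ext_deriv A \<omega> c q)" for c q
  proof (cases "c \<in> A \<and> q \<in> fst c")
    case True
    have "alternating (\<lambda>L. pd i (\<lambda>x. \<omega> c (chart_inv c x) L) (snd c q))" for i
      unfolding alternating_def
    proof (intro allI)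
      fix xs a b ys
      have "(\<lambda>x. \<omega> c (chart_inv c x) (xs @ a # b # ys)) = (\<lambda>x. - \<omega> c (chart_inv c x) (xs @ b # a # ys))"
        by (rule ext) (rule alternatingD[OF formsD(4)[OF \<omega>]])
      then show "pd i (\<lambda>x. \<omega> c (chart_inv c x) (xs @ a # b # ys)) (snd c q)
          = - pd i (\<lambda>x. \<omega> c (chart_inv c x) (xs @ b # a # ys)) (snd c q)"
        using pd_minus[OF diff] True by metis
    qed
    moreover have "ext_deriv A \<omega> c q = alt_sum (\<lambda>i L. pd i (\<lambda>x. \<omega> c (chart_inv c x) L) (snd c q))"
      by (rule ext, rule ext_deriv_eq_alt_sum) (use True in auto)
    ultimately show ?thesis
      by (simp only: alternating_alt_sum)
  next
    case False
    then show ?thesis by (simp add: alternating_def ext_deriv_outside)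
  qed
  show "smooth_on (snd c ` fst c) (\<lambda>x. ext_deriv A \<omega> c (chart_inv c x) I)" if c: "c \<in> A" for c I
  proof -
    have "smooth_on (snd c ` fst c) (\<lambda>x. alt_sum (\<lambda>i L. pd i (\<lambda>x. \<omega> c (chart_inv c x) L) x) I)"
      by (intro smooth_on_alt_sum smooth_on_pd formsD(5)[OF \<omega>] chart(2) c)
    moreover have "ext_deriv A \<omega> c (chart_inv c x) I = alt_sum (\<lambda>i L. pd i (\<lambda>x. \<omega> c (chart_inv c x) L) x) I"
      if "x \<in> snd c ` fst c" for x
      using ext_deriv_eq_alt_sum[OF c chart(4)[OF c that]] chart(5)[OF c that] by simp
    ultimately show ?thesis
      using smooth_on_cong[OF chart(2)[OF c]] by (metis (no_types, lifting))
  qed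
  show "ext_deriv A \<omega> c q I = tens (jac c c' q) (ext_deriv A \<omega> c' q) I"
    if c: "c \<in> A" "c' \<in> A" and q: "q \<in> fst c \<inter> fst c'" for c c' q I
  proof -
    define \<tau> U where "\<tau> = snd c' \<circ> chart_inv c" and "U = snd c ` (fst c \<inter> fst c')"
    have U: "open U" "snd c q \<in> U"
      using open_chart_image[OF A c(1), of "fst c \<inter> fst c'"] chart(1)[OF c(1)] chart(1)[OF c(2)] q
      by (auto simp: U_def)
    have \<tau>: "smooth_on U \<tau>" "\<tau> ` U \<subseteq> snd c' ` fst c'"
      using A c chart(3)[OF c(1)] by (auto simp: oriented_atlas_def \<tau>_def U_def)
    have \<tau>q: "\<tau> (snd c q) = snd c' q"
      using q chart(3)[OF c(1)] by (simp add: \<tau>_def)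
    have jac: "jac c c' (chart_inv c x) = (\<lambda>k a. complex_of_real (pd a \<tau> x $ k))" if "x \<in> U" for x
      using that chart(3)[OF c(1)] by (auto simp: U_def transition_jacobian_eq \<tau>_def)
    have loc: "\<omega> c (chart_inv c x) L = tens (\<lambda>k a. complex_of_real (pd a \<tau> x $ k)) (\<omega> c' (chart_inv c' (\<tau> x))) L"
      if "x \<in> U" for x L
    proof -
      have "chart_inv c x \<in> fst c \<inter> fst c'" "chart_inv c' (\<tau> x) = chart_inv c x"
        using that chart(3)[OF c(1)] chart(3)[OF c(2)] by (auto simp: U_def \<tau>_def)
      then show ?thesis
        using formsD(6)[OF \<omega> c, of "chart_inv c x"] jac[OF that] by simp
    qed
    have "ext_deriv A \<omega> c q I = alt_sum (\<lambda>i L. pd i (\<lambda>x. \<omega> c (chart_inv c x) L) (snd c q)) I"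
      using ext_deriv_eq_alt_sum[OF c(1)] q by simp
    also have "\<dots> = alt_sum (\<lambda>i L. pd i (\<lambda>x. tens (\<lambda>k a. complex_of_real (pd a \<tau> x $ k)) (\<omega> c' (chart_inv c' (\<tau> x))) L) (snd c q)) I"
      by (intro alt_sum_cong pd_cong_open[OF U] loc)
    also have "\<dots> = tens (\<lambda>k a. complex_of_real (pd a \<tau> (snd c q) $ k))
        (alt_sum (\<lambda>k L. pd k (\<lambda>y. \<omega> c' (chart_inv c' y) L) (\<tau> (snd c q)))) I"
      by (rule alt_sum_pd_pullback[OF U \<tau>]) (use formsD(4,5)[OF \<omega>] c in auto)
    also have "\<dots> = tens (jac c c' q) (ext_deriv A \<omega> c' q) I"
    proof -
      have "chart_inv c (snd c q) = q" using q chart(3)[OF c(1)] by simp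
      then have "(\<lambda>k a. complex_of_real (pd a \<tau> (snd c q) $ k)) = jac c c' q"
        using jac[OF U(2)] by simp
      moreover have "alt_sum (\<lambda>k L. pd k (\<lambda>y. \<omega> c' (chart_inv c' y) L) (\<tau> (snd c q))) = ext_deriv A \<omega> c' q"
        unfolding \<tau>q using ext_deriv_eq_alt_sum[OF c(2)] q by (intro ext) simp
      ultimately show ?thesis by simp
    qed
    finally show ?thesis .
  qed
qed

lemma forms_differentiable:
  assumes "\<omega> \<in> forms A k" "c \<in> A" "q \<in> fst c"
  shows "(\<lambda>x. \<omega> c (chart_inv c x) L) differentiable (at (snd c q))"
  by (rule smooth_on_differentiable[OF formsD(5)[OF assms(1,2)]]) (use assms(3) in simp)

lemma ext_deriv_add:
  assumes "\<omega> \<in> forms A k" "\<eta> \<in> forms A k"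
  shows "ext_deriv A (\<omega> + \<eta>) = ext_deriv A \<omega> + ext_deriv A \<eta>"
proof (intro ext)
  fix c q I
  show "ext_deriv A (\<omega> + \<eta>) c q I = (ext_deriv A \<omega> + ext_deriv A \<eta>) c q I"
  proof (cases "c \<in> A \<and> q \<in> fst c")
    case True
    then have "pd i (\<lambda>x. \<omega> c (chart_inv c x) L + \<eta> c (chart_inv c x) L) (snd c q)
      = pd i (\<lambda>x. \<omega> c (chart_inv c x) L) (snd c q) + pd i (\<lambda>x. \<eta> c (chart_inv c x) L) (snd c q)" for i L
      by (intro pd_add forms_differentiable[OF assms(1)] forms_differentiable[OF assms(2)]) auto
    with True show ?thesis
      by (simp add: ext_deriv_eq_alt_sum alt_sum_add)
  qed (simp add: ext_deriv_outside)
qed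

lemma ext_deriv_smul:
  assumes "\<omega> \<in> forms A k"
  shows "ext_deriv A (smul a \<omega>) = smul a (ext_deriv A \<omega>)"
proof (intro ext)
  fix c q I
  show "ext_deriv A (smul a \<omega>) c q I = smul a (ext_deriv A \<omega>) c q I"
  proof (cases "c \<in> A \<and> q \<in> fst c")
    case True
    then have "pd i (\<lambda>x. a * \<omega> c (chart_inv c x) L) (snd c q) = a * pd i (\<lambda>x. \<omega> c (chart_inv c x) L) (snd c q)" for i L
      by (intro pd_cmult forms_differentiable[OF assms]) auto
    with True show ?thesis
      by (simp add: ext_deriv_eq_alt_sum alt_sum_mult smul_def)
  qed (simp add: ext_deriv_outside smul_def)
qed

lemma ext_deriv_ext_deriv:
  assumes A: "oriented_atlas A" and \<omega>: "\<omega> \<in> forms A k"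
  shows "ext_deriv A (ext_deriv A \<omega>) = 0"
proof (intro ext)
  note chart = atlas_chart[OF A]
  fix c q I
  show "ext_deriv A (ext_deriv A \<omega>) c q I = 0 c q I"
  proof (cases "c \<in> A \<and> q \<in> fst c")
    case True
    then have c: "c \<in> A" and x: "snd c q \<in> snd c ` fst c" and q: "q \<in> fst c" by auto
    note smooth = formsD(5)[OF \<omega> c]
    have "pd i (\<lambda>x. ext_deriv A \<omega> c (chart_inv c x) L) (snd c q)
        = alt_sum (\<lambda>j L'. pd i (pd j (\<lambda>x. \<omega> c (chart_inv c x) L')) (snd c q)) L" for i L
    proof -
      have "ext_deriv A \<omega> c (chart_inv c x) L = alt_sum (\<lambda>j L'. pd j (\<lambda>x. \<omega> c (chart_inv c x) L') x) L"
        if "x \<in> snd c ` fst c" for x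
        using ext_deriv_eq_alt_sum[OF c chart(4)[OF c that]] chart(5)[OF c that] by simp
      then have "pd i (\<lambda>x. ext_deriv A \<omega> c (chart_inv c x) L) (snd c q)
        = pd i (\<lambda>x. alt_sum (\<lambda>j L'. pd j (\<lambda>x. \<omega> c (chart_inv c x) L') x) L) (snd c q)"
        by (intro pd_cong_open[OF chart(2)[OF c] x])
      also have "\<dots> = alt_sum (\<lambda>j L'. pd i (pd j (\<lambda>x. \<omega> c (chart_inv c x) L')) (snd c q)) L"
        by (rule pd_alt_sum) (rule smooth_on_differentiable[OF smooth_on_pd[OF smooth] x])
      finally show ?thesis .
    qed
    then have "ext_deriv A (ext_deriv A \<omega>) c q I
        = alt_sum (\<lambda>i. alt_sum (\<lambda>j L'. pd i (pd j (\<lambda>x. \<omega> c (chart_inv c x) L')) (snd c q))) I"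
      unfolding ext_deriv_eq_alt_sum[OF c q] by simp
    also have "\<dots> = 0"
      by (rule alt_sum_alt_sum_symmetric) (rule pd_commute[OF smooth chart(2)[OF c] x])
    finally show ?thesis by simp
  qed (simp add: ext_deriv_outside)
qed

text \<open>The exterior derivative is a local operator: off the closed set \<open>K\<close> the components of \<open>\<omega>\<close> vanish in a
  neighbourhood.\<close>

lemma ext_deriv_support:
  assumes "oriented_atlas A" "closed K" "\<And>c q I. \<omega> c q I \<noteq> 0 \<Longrightarrow> q \<in> K" "ext_deriv A \<omega> c q I \<noteq> 0"
  shows "q \<in> K"
proof (rule ccontr)
  assume "q \<notin> K"
  have c: "c \<in> A" "q \<in> fst c" using assms(4) ext_deriv_outside by metis+
  have U: "open (snd c ` (fst c - K))" "snd c q \<in> snd c ` (fst c - K)"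
    using open_chart_image[OF assms(1) c(1), of "fst c - K"] atlas_chart(1)[OF assms(1) c(1)] assms(2) c \<open>q \<notin> K\<close>
    by (auto intro: open_Diff)
  have "\<omega> c (chart_inv c x) L = 0" if "x \<in> snd c ` (fst c - K)" for x L
    using that assms(3) atlas_chart(3)[OF assms(1) c(1)] by fastforce
  then have "pd i (\<lambda>x. \<omega> c (chart_inv c x) L) (snd c q) = pd i (\<lambda>x. 0) (snd c q)" for i L
    by (intro pd_cong_open[OF U])
  then have "ext_deriv A \<omega> c q I = 0"
    using ext_deriv_eq_alt_sum[OF c] by (simp add: pd_const alt_sum_0)
  then show False using assms(4) by contradiction
qed

section \<open>The inner product of tensors\<close>

text \<open>The Hermitian product that a Gram matrix \<open>g\<close> induces on the tensors with \<open>k\<close> slots, without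
  the factor \<open>1/k!\<close>.\<close>

fun tprod :: "('n::finite \<Rightarrow> 'n \<Rightarrow> complex) \<Rightarrow> nat \<Rightarrow> ('n list \<Rightarrow> complex) \<Rightarrow> ('n list \<Rightarrow> complex) \<Rightarrow> complex" where
  "tprod g 0 u v = u [] * cnj (v [])"
| "tprod g (Suc k) u v = (\<Sum>i\<in>UNIV. \<Sum>j\<in>UNIV. g i j * tprod g k (\<lambda>K. u (i # K)) (\<lambda>K. v (j # K)))"

lemma tprod_eq_sum:
  "tprod g k u v = (\<Sum>I | length I = k. \<Sum>K | length K = k. (\<Prod>l<k. g (I ! l) (K ! l)) * u I * cnj (v K))"
proof (induction k arbitrary: u v)
  case (Suc k)
  show ?case
    unfolding tprod.simps Suc.IH sum_lists_Suc prod.lessThan_Suc_shift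
    by (rule sum.cong[OF refl], subst sum.swap) (simp add: sum_distrib_left mult_ac)
qed simp

lemma tprod_add_right: "tprod g k u (\<lambda>K. v K + v' K) = tprod g k u v + tprod g k u v'"
  unfolding tprod_eq_sum by (simp add: sum.distrib algebra_simps)

lemma tprod_add_left: "tprod g k (\<lambda>K. u K + u' K) v = tprod g k u v + tprod g k u' v"
  unfolding tprod_eq_sum by (simp add: sum.distrib algebra_simps)

lemma tprod_cmult_right: "tprod g k u (\<lambda>K. c * v K) = cnj c * tprod g k u v"
  unfolding tprod_eq_sum by (simp add: sum_distrib_left algebra_simps)

lemma tprod_cmult_left: "tprod g k (\<lambda>K. c * u K) v = c * tprod g k u v"
  unfolding tprod_eq_sum by (simp add: sum_distrib_left algebra_simps)

lemma tprod_0_left: "tprod g k (\<lambda>K. 0) v = 0"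
  using tprod_cmult_left[of g k 0] by simp

lemma tprod_0_right: "tprod g k u (\<lambda>K. 0) = 0"
  using tprod_cmult_right[of g k u 0] by simp

lemma tprod_sum_left: "tprod g k (\<lambda>K. \<Sum>x\<in>S. u x K) v = (\<Sum>x\<in>S. tprod g k (u x) v)"
  by (induction S rule: infinite_finite_induct) (simp_all add: tprod_0_left tprod_add_left)

lemma tprod_sum_right: "tprod g k u (\<lambda>K. \<Sum>x\<in>S. v x K) = (\<Sum>x\<in>S. tprod g k u (v x))"
  by (induction S rule: infinite_finite_induct) (simp_all add: tprod_0_right tprod_add_right)

lemma tprod_tens:
  fixes T :: "'n::finite \<Rightarrow> 'n \<Rightarrow> real"
  shows "tprod g k (tens (\<lambda>i a. complex_of_real (T i a)) u) (tens (\<lambda>i a. complex_of_real (T i a)) v)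
    = tprod (\<lambda>i j. \<Sum>a\<in>UNIV. \<Sum>b\<in>UNIV. complex_of_real (T i a) * g a b * complex_of_real (T j b)) k u v"
proof (induction k arbitrary: u v)
  case (Suc k)
  let ?T = "\<lambda>i a. complex_of_real (T i a)"
  let ?p = "\<lambda>i j. tprod g k (tens ?T (\<lambda>K. u (i # K))) (tens ?T (\<lambda>K. v (j # K)))"
  have "tprod g (Suc k) (tens ?T u) (tens ?T v)
    = (\<Sum>a\<in>UNIV. \<Sum>b\<in>UNIV. \<Sum>i\<in>UNIV. \<Sum>j\<in>UNIV. (?T i a * g a b * ?T j b) * ?p i j)"
    by (simp add: tprod_sum_left tprod_sum_right tprod_cmult_left tprod_cmult_right sum_distrib_left mult_ac)
  also have "\<dots> = (\<Sum>a\<in>UNIV. \<Sum>i\<in>UNIV. \<Sum>b\<in>UNIV. \<Sum>j\<in>UNIV. (?T i a * g a b * ?T j b) * ?p i j)"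
    by (rule sum.cong[OF refl], rule sum.swap)
  also have "\<dots> = (\<Sum>i\<in>UNIV. \<Sum>a\<in>UNIV. \<Sum>b\<in>UNIV. \<Sum>j\<in>UNIV. (?T i a * g a b * ?T j b) * ?p i j)"
    by (rule sum.swap)
  also have "\<dots> = (\<Sum>i\<in>UNIV. \<Sum>a\<in>UNIV. \<Sum>j\<in>UNIV. \<Sum>b\<in>UNIV. (?T i a * g a b * ?T j b) * ?p i j)"
    by (rule sum.cong[OF refl], rule sum.cong[OF refl], rule sum.swap)
  also have "\<dots> = (\<Sum>i\<in>UNIV. \<Sum>j\<in>UNIV. \<Sum>a\<in>UNIV. \<Sum>b\<in>UNIV. (?T i a * g a b * ?T j b) * ?p i j)"
    by (rule sum.cong[OF refl], rule sum.swap)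
  finally show ?case
    by (simp add: Suc.IH sum_distrib_right)
qed simp

lemma tprod_orthonormal:
  "tprod (\<lambda>i j. if i = j then 1 else 0) k u v = (\<Sum>I | length I = k. u I * cnj (v I))"
proof (induction k arbitrary: u v)
  case (Suc k)
  then show ?case
    by (simp add: sum_lists_Suc if_distrib[of "\<lambda>c. c * _"] cong: if_cong)
qed simp

lemma finite_lists_length: "finite {I :: 'n::finite list. length I = k}"
  using finite_lists_length_eq[of "UNIV :: 'n set" k] by simp

lemma sum_mult_cnj_self:
  fixes u :: "'n::finite list \<Rightarrow> complex"
  shows "(\<Sum>I | length I = k. u I * cnj (u I)) = complex_of_real (\<Sum>I | length I = k. (cmod (u I))\<^sup>2)"
  by (simp only: of_real_sum complex_norm_square)

text \<open>Cholesky factorisation by induction on the index set: split off the square of one linear form so that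
  the remaining form (the Schur complement \<open>g'\<close>) does not involve the index \<open>i\<close>. It is stated for an index set
  and not for matrices because the induction leaves the type of indices.\<close>

lemma positive_definite_factorization:
  fixes g :: "'n \<Rightarrow> 'n \<Rightarrow> real"
  assumes "finite S" "\<And>i j. g i j = g j i"
    and "\<And>v. \<exists>i\<in>S. v i \<noteq> 0 \<Longrightarrow> (\<Sum>i\<in>S. \<Sum>j\<in>S. g i j * v i * v j) > 0"
  shows "\<exists>e. \<forall>j\<in>S. \<forall>k\<in>S. g j k = (\<Sum>r\<in>S. e r j * e r k)"
  using assms
proof (induction S arbitrary: g rule: finite_induct)
  case (insert i S)
  define a where "a = g i i"
  have sum_zero: "(\<Sum>j\<in>S. F j (if j = i then x else f j)) = (\<Sum>j\<in>S. F j (f j))" for F :: "_ \<Rightarrow> real \<Rightarrow> real" and x f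
    by (rule sum.cong) (use insert.hyps in auto)
  have a: "a > 0"
  proof -
    have "(\<Sum>j\<in>S. g k j * x * (if j = i then 1 else 0)) = 0" for k and x :: real
      by (rule sum.neutral) (use insert.hyps in auto)
    moreover have "(\<Sum>k\<in>S. \<Sum>j\<in>insert i S. g k j * (if k = i then 1 else 0) * (if j = i then 1 else 0)) = (0 :: real)"
      by (rule sum.neutral) (use insert.hyps in auto)
    ultimately have "(\<Sum>k\<in>insert i S. \<Sum>j\<in>insert i S. g k j * (if k = i then 1 else 0) * (if j = i then 1 else 0)) = g i i"
      using insert.hyps by simp
    then show ?thesis
      unfolding a_def using insert.prems(2)[of "\<lambda>j. if j = i then 1 else 0"] by simp
  qed
  define g' where "g' j k = g j k - g i j * g i k / a" for j k
  have "\<exists>e. \<forall>j\<in>S. \<forall>k\<in>S. g' j k = (\<Sum>r\<in>S. e r j * e r k)"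
  proof (rule insert.IH)
    show "g' j k = g' k j" for j k
      unfolding g'_def using insert.prems(1)[of j k] by simp
    fix v :: "'n \<Rightarrow> real" assume v: "\<exists>j\<in>S. v j \<noteq> 0"
    define b where "b = (\<Sum>j\<in>S. g i j * v j)"
    define Q where "Q = (\<Sum>j\<in>S. \<Sum>k\<in>S. g j k * v j * v k)"
    \<comment> \<open>the extension of \<open>v\<close> to the index \<open>i\<close> at which the form \<open>g\<close> is minimal, where it takes the value of \<open>g\'\<close> at \<open>v\<close>\<close>
    define w where "w j = (if j = i then - b / a else v j)" for j
    have w: "w j = v j" if "j \<in> S" for j using that insert.hyps by (auto simp: w_def)
    have wi: "w i = - b / a" by (simp add: w_def)
    have s1: "(\<Sum>k\<in>S. g i k * w i * w k) = w i * b"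
      unfolding b_def sum_distrib_left by (rule sum.cong) (simp_all add: w)
    have s2: "(\<Sum>j\<in>S. g j i * w j * w i) = w i * b"
      unfolding b_def sum_distrib_left by (rule sum.cong) (simp_all add: w insert.prems(1)[of i])
    have s3: "(\<Sum>j\<in>S. \<Sum>k\<in>S. g j k * w j * w k) = Q"
      unfolding Q_def by (intro sum.cong refl) (simp add: w)
    have "\<exists>j\<in>insert i S. w j \<noteq> 0" using v w by auto
    from insert.prems(2)[of w, OF this] have "0 < (\<Sum>j\<in>insert i S. \<Sum>k\<in>insert i S. g j k * w j * w k)" .
    also have "\<dots> = a * w i * w i + w i * b + (w i * b + Q)"
      using insert.hyps by (simp add: sum.distrib s1 s2 s3 a_def)
    also have "\<dots> = Q - b * b / a"
      using a by (simp add: wi field_simps)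
    also have "\<dots> = (\<Sum>j\<in>S. \<Sum>k\<in>S. g' j k * v j * v k)"
      unfolding g'_def b_def Q_def sum_product sum_divide_distrib sum_subtractf[symmetric]
      by (intro sum.cong refl) (simp add: algebra_simps)
    finally show "0 < (\<Sum>j\<in>S. \<Sum>k\<in>S. g' j k * v j * v k)" .
  qed
  then obtain e where e: "\<And>j k. j \<in> S \<Longrightarrow> k \<in> S \<Longrightarrow> g' j k = (\<Sum>r\<in>S. e r j * e r k)" by blast
  define e' where "e' r j = (if r = i then g i j / sqrt a else if j = i then 0 else e r j)" for r j
  have i: "e' i j * e' i k = g i j * g i k / a" for j k
    using a by (simp add: e'_def)
  have S: "(\<Sum>r\<in>S. e' r j * e' r k) = (if j = i \<or> k = i then 0 else (\<Sum>r\<in>S. e r j * e r k))" for j k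
    using insert.hyps by (auto simp: e'_def intro!: sum.neutral sum.cong)
  have "g j k = (\<Sum>r\<in>insert i S. e' r j * e' r k)" if "j \<in> insert i S" "k \<in> insert i S" for j k
  proof -
    have "(\<Sum>r\<in>insert i S. e' r j * e' r k) = g i j * g i k / a + (if j = i \<or> k = i then 0 else g' j k)"
      using insert.hyps that by (auto simp: i S e)
    also have "\<dots> = g j k"
      using a insert.prems(1)[of j i] insert.prems(1)[of k i] by (auto simp: g'_def a_def)
    finally show ?thesis by simp
  qed
  then show ?case by blast
qed simp

lemma positive_definite_matrix_factorization:
  fixes H :: "real^'n::finite^'n"
  assumes "transpose H = H" "\<And>v. v \<noteq> 0 \<Longrightarrow> v \<bullet> (H *v v) > 0"
  shows "\<exists>B :: real^'n^'n. H = transpose B ** B \<and> invertible B \<and> invertible H \<and> det H > 0"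
proof -
  have "\<exists>e :: 'n \<Rightarrow> 'n \<Rightarrow> real. \<forall>j\<in>UNIV. \<forall>k\<in>UNIV. H $ j $ k = (\<Sum>r\<in>UNIV. e r j * e r k)"
  proof (rule positive_definite_factorization)
    show "H $ i $ j = H $ j $ i" for i j
      using arg_cong[OF assms(1), of "\<lambda>M. M $ i $ j"] by (simp add: transpose_def)
    fix v :: "'n \<Rightarrow> real" assume "\<exists>i\<in>UNIV. v i \<noteq> 0"
    then have "(\<chi> i. v i) \<noteq> 0" by (auto simp: vec_eq_iff)
    from assms(2)[OF this] show "0 < (\<Sum>i\<in>UNIV. \<Sum>j\<in>UNIV. H $ i $ j * v i * v j)"
      by (simp add: inner_vec_def matrix_vector_mult_def sum_distrib_left mult_ac)
  qed simp
  then obtain e :: "'n \<Rightarrow> 'n \<Rightarrow> real" where e: "\<And>j k. H $ j $ k = (\<Sum>r\<in>UNIV. e r j * e r k)" by blast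
  define B :: "real^'n^'n" where "B = (\<chi> r j. e r j)"
  have H: "H = transpose B ** B"
    by (simp add: vec_eq_iff e B_def transpose_def matrix_matrix_mult_def)
  have "\<forall>v. B *v v = 0 \<longrightarrow> v = 0"
    using assms(2) unfolding H by (metis inner_zero_right less_irrefl matrix_vector_mul_assoc matrix_vector_mult_0_right)
  then have B: "invertible B"
    using matrix_left_invertible_ker invertible_left_inverse by blast
  then have "det B \<noteq> 0" by (simp add: invertible_det_nz)
  moreover have "det H = (det B)\<^sup>2"
    unfolding H by (simp add: det_mul det_transpose power2_eq_square)
  ultimately have "det H > 0" by simp
  then have "invertible H" by (simp add: invertible_det_nz)
  with H B \<open>det H > 0\<close> show ?thesis by blast
qed

lemma matrix_inv_inverse:
  assumes "invertible A"
  shows "A ** matrix_inv A = mat 1" "matrix_inv A ** A = mat 1"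
proof -
  have "\<exists>A'. A ** A' = mat 1 \<and> A' ** A = mat 1"
    using assms by (simp add: invertible_def)
  then have "A ** matrix_inv A = mat 1 \<and> matrix_inv A ** A = mat 1"
    unfolding matrix_inv_def by (rule someI_ex)
  then show "A ** matrix_inv A = mat 1" "matrix_inv A ** A = mat 1" by blast+
qed

lemma matrix_inv_eqI:
  fixes A :: "real^'n::finite^'n"
  assumes "A ** C = mat 1"
  shows "matrix_inv A = C"
proof -
  have "invertible A"
    using assms invertible_right_inverse by blast
  then have "matrix_inv A ** A ** C = C"
    by (simp add: matrix_inv_inverse(2))
  then show ?thesis
    unfolding matrix_mul_assoc[symmetric] assms by simp
qed

text \<open>A factorisation of the Gram matrix provides an orthonormal frame \<open>E\<close>, and in this frame the product of a tensor with
  itself is the sum of the squares of its components.\<close>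

lemma tprod_positive_definite:
  fixes H :: "real^'n::finite^'n" and u :: "'n list \<Rightarrow> complex" and k :: nat and I :: "'n list"
  assumes "transpose H = H" "\<And>v. v \<noteq> 0 \<Longrightarrow> v \<bullet> (H *v v) > 0"
  defines "N \<equiv> tprod (\<lambda>i j. complex_of_real (matrix_inv H $ i $ j)) k u u"
  shows "Im N = 0" "Re N \<ge> 0" "length I = k \<Longrightarrow> u I \<noteq> 0 \<Longrightarrow> Re N > 0"
proof -
  obtain B :: "real^'n^'n" where B: "H = transpose B ** B" "invertible B" "invertible H"
    using positive_definite_matrix_factorization[OF assms(1,2)] by auto
  define E where "E = matrix_inv B"
  have EB: "E ** B = mat 1" "B ** E = mat 1"
    unfolding E_def using matrix_inv_inverse[OF B(2)] by blast+
  have "matrix_inv H = E ** transpose E"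
  proof (rule matrix_inv_eqI)
    have "H ** (E ** transpose E) = transpose B ** (B ** E) ** transpose E"
      unfolding B(1) by (simp only: matrix_mul_assoc)
    also have "\<dots> = transpose (E ** B)"
      by (simp add: EB(2) matrix_transpose_mul)
    finally show "H ** (E ** transpose E) = mat 1"
      by (simp add: EB(1) transpose_mat)
  qed
  then have inv: "complex_of_real (matrix_inv H $ i $ j) = (\<Sum>a\<in>UNIV. \<Sum>b\<in>UNIV. complex_of_real (E $ i $ a)
      * (if a = b then 1 else 0) * complex_of_real (E $ j $ b))" for i j
    by (simp add: matrix_matrix_mult_def transpose_def if_distrib[of "\<lambda>c. _ * c * _"] cong: if_cong)
  let ?E = "\<lambda>i a. complex_of_real (E $ i $ a)"
  have "N = tprod (\<lambda>i j. if i = j then 1 else 0) k (tens ?E u) (tens ?E u)"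
    unfolding N_def inv by (rule tprod_tens[where T = "\<lambda>i a. E $ i $ a", symmetric])
  then have N: "N = complex_of_real (\<Sum>I | length I = k. (cmod (tens ?E u I))\<^sup>2)"
    unfolding tprod_orthonormal sum_mult_cnj_self .
  show "Im N = 0" "Re N \<ge> 0"
    unfolding N by (simp_all add: sum_nonneg)
  show "Re N > 0" if I: "length I = k" "u I \<noteq> 0"
  proof (rule ccontr)
    assume "\<not> Re N > 0"
    then have "(\<Sum>I | length I = k. (cmod (tens ?E u I))\<^sup>2) = 0"
      using \<open>Re N \<ge> 0\<close> unfolding N by simp
    then have z: "tens ?E u K = 0" if "length K = k" for K
      using that finite_lists_length by (subst (asm) sum_nonneg_eq_0_iff) auto
    have "tens (\<lambda>i a. complex_of_real (B $ i $ a)) (tens ?E u) I = u I"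
    proof -
      have "(\<Sum>j\<in>UNIV. ?E i j * complex_of_real (B $ j $ a)) = (if i = a then 1 else 0)" for i a
        using arg_cong[OF EB(1), of "\<lambda>M. complex_of_real (M $ i $ a)"]
        by (simp add: matrix_matrix_mult_def mat_def)
      then show ?thesis
        unfolding tens_compose by (simp add: tens_id)
    qed
    moreover have "tens (\<lambda>i a. complex_of_real (B $ i $ a)) (tens ?E u) I = tens (\<lambda>i a. complex_of_real (B $ i $ a)) (\<lambda>K. 0) I"
      by (rule tens_cong) (simp add: z I)
    ultimately show False
      using I(2) by (simp add: tens_0)
  qed
qed

section \<open>A smooth bump function\<close>

text \<open>The function \<open>exp (-1/t)\<close>, extended by zero, together with its multiples by powers of \<open>1/t\<close>. The
  linear span of this family is closed under differentiation, which makes all members smooth.\<close>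

definition flat_exp :: "nat \<Rightarrow> real \<Rightarrow> real" where
  "flat_exp k t = (if t > 0 then (1 / t) ^ k * exp (- (1 / t)) else 0)"

lemma flat_exp_tendsto_0: "(flat_exp k \<longlongrightarrow> 0) (at 0)"
proof -
  have "((\<lambda>t. (1 / t) ^ k / exp (1 / t)) \<longlongrightarrow> 0) (at_right (0 :: real))"
  proof -
    have "filterlim (\<lambda>t. 1 / t) at_top (at_right (0 :: real))"
      using filterlim_inverse_at_top_right by (simp add: inverse_eq_divide)
    from filterlim_compose[OF tendsto_power_div_exp_0 this] show ?thesis .
  qed
  moreover have "\<forall>\<^sub>F t in at_right 0. (1 / t) ^ k / exp (1 / t) = flat_exp k t"
    unfolding eventually_at_right_field flat_exp_def by (auto intro!: exI[of _ 1] simp: exp_minus divide_inverse)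
  ultimately have "(flat_exp k \<longlongrightarrow> 0) (at_right 0)"
    by (rule Lim_transform_eventually)
  moreover have "(flat_exp k \<longlongrightarrow> 0) (at_left 0)"
    by (rule Lim_transform_eventually[OF tendsto_const])
      (auto simp: eventually_at_left_field flat_exp_def intro!: exI[of _ "-1"])
  ultimately show ?thesis
    by (simp add: filterlim_at_split)
qed

lemma flat_exp_DERIV:
  "(flat_exp k has_real_derivative flat_exp (k + 2) t - of_nat k * flat_exp (k + 1) t) (at t)"
proof (cases t "0 :: real" rule: linorder_cases)
  case less
  have "((\<lambda>t. 0) has_real_derivative 0) (at t)" by simp
  then have "(flat_exp k has_real_derivative 0) (at t)"
    by (rule has_field_derivative_transform_within_open[of _ _ _ "{..<0}"]) (use less in \<open>auto simp: flat_exp_def\<close>)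
  then show ?thesis using less by (simp add: flat_exp_def)
next
  case equal
  have "((\<lambda>h. (flat_exp k (0 + h) - flat_exp k 0) / h) \<longlongrightarrow> 0) (at 0)"
  proof (rule Lim_transform_eventually[OF flat_exp_tendsto_0[of "Suc k"]])
    show "\<forall>\<^sub>F h in at 0. flat_exp (Suc k) h = (flat_exp k (0 + h) - flat_exp k 0) / h"
      by (rule always_eventually) (simp add: flat_exp_def)
  qed
  then have "(flat_exp k has_real_derivative 0) (at 0)"
    by (simp add: DERIV_def)
  then show ?thesis using equal by (simp add: flat_exp_def)
next
  case greater
  have "((\<lambda>t. (1 / t) ^ k * exp (- (1 / t))) has_real_derivative
      (1 / t) ^ (k + 2) * exp (- (1 / t)) - of_nat k * ((1 / t) ^ (k + 1) * exp (- (1 / t)))) (at t)"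
  proof -
    have inv: "((\<lambda>t. 1 / t) has_real_derivative - ((1 / t)\<^sup>2)) (at t)"
      using greater by (auto intro!: derivative_eq_intros simp: power2_eq_square)
    have "((\<lambda>t. exp (- (1 / t))) has_real_derivative exp (- (1 / t)) * (1 / t)\<^sup>2) (at t)"
      using DERIV_fun_exp[OF DERIV_minus[OF inv]] by simp
    from DERIV_mult[OF DERIV_power[OF inv, of k] this]
    have "((\<lambda>t. (1 / t) ^ k * exp (- (1 / t))) has_real_derivative
      of_nat k * (- ((1 / t)\<^sup>2) * (1 / t) ^ (k - Suc 0)) * exp (- (1 / t))
        + exp (- (1 / t)) * (1 / t)\<^sup>2 * (1 / t) ^ k) (at t)" .
    moreover have "of_nat k * (- (s\<^sup>2) * s ^ (k - Suc 0)) * e + e * s\<^sup>2 * s ^ k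
        = s ^ (k + 2) * e - of_nat k * (s ^ (k + 1) * e)" for s e :: real
      by (cases k) (simp_all add: power2_eq_square algebra_simps)
    ultimately show ?thesis by metis
  qed
  then have "(flat_exp k has_real_derivative
      (1 / t) ^ (k + 2) * exp (- (1 / t)) - of_nat k * ((1 / t) ^ (k + 1) * exp (- (1 / t)))) (at t)"
    by (rule has_field_derivative_transform_within_open[of _ _ _ "{0<..}"]) (use greater in \<open>auto simp: flat_exp_def\<close>)
  then show ?thesis using greater by (simp add: flat_exp_def)
qed

definition bump :: "real^'n::finite \<Rightarrow> real \<Rightarrow> real^'n \<Rightarrow> real" where
  "bump x0 r x = flat_exp 0 (r\<^sup>2 - (x - x0) \<bullet> (x - x0))"

lemma C_k_on_flat_exp_radial:
  "C_k_on l UNIV (\<lambda>x::real^'n::finite. flat_exp k (s - (x - x0) \<bullet> (x - x0)))"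
proof (induction l arbitrary: k)
  case 0
  have "continuous_on UNIV (flat_exp k)"
    using flat_exp_DERIV by (blast intro: continuous_at_imp_continuous_on DERIV_isCont)
  then show ?case
    by (auto intro!: continuous_intros continuous_on_compose2[of UNIV "flat_exp k"])
next
  case (Suc l)
  define \<rho> where "\<rho> x = s - (x - x0) \<bullet> (x - x0)" for x :: "real^'n"
  define F where "F x = flat_exp (k + 2) (\<rho> x) - of_nat k * flat_exp (k + 1) (\<rho> x)" for x
  have D: "((\<lambda>x. flat_exp k (\<rho> x)) has_derivative (\<lambda>v. F x * (- (2 * ((x - x0) \<bullet> v))))) (at x)" for x
  proof -
    have "(\<rho> has_derivative (\<lambda>v. - (2 * ((x - x0) \<bullet> v)))) (at x)"
      unfolding \<rho>_def by (auto intro!: derivative_eq_intros simp: inner_commute)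
    from has_derivative_compose[OF this flat_exp_DERIV[unfolded has_field_derivative_def]]
    show ?thesis unfolding F_def .
  qed
  have lin: "bounded_linear (\<lambda>x::real^'n. -2 * x $ i)" for i
    by (rule bounded_linear_compose[OF bounded_linear_mult_right bounded_linear_vec_nth])
  have id: "C_k_on l UNIV (\<lambda>x::real^'n. x - x0)"
  proof (cases l)
    case (Suc l')
    have "pd i (\<lambda>x. x - x0) x = axis i 1" for i and x :: "real^'n"
      by (rule pd_eqI[of _ "\<lambda>v. v"]) (auto intro!: derivative_eq_intros)
    then show ?thesis unfolding Suc by (simp add: C_k_on_const)
  qed (auto intro!: continuous_intros)
  have F: "C_k_on l UNIV F"
  proof -
    have "C_k_on l UNIV (\<lambda>x. flat_exp (k + 2) (\<rho> x) + (- of_nat k) * flat_exp (k + 1) (\<rho> x))"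
      unfolding \<rho>_def by (intro C_k_on_add C_k_on_bilinear[OF open_UNIV bounded_bilinear_mult] C_k_on_const open_UNIV Suc.IH)
    then show ?thesis unfolding F_def by simp
  qed
  have "C_k_on l UNIV (\<lambda>x. F x * (- 2 * (x - x0) $ i))" for i
    by (intro C_k_on_bilinear[OF open_UNIV bounded_bilinear_mult] F C_k_on_linear[OF open_UNIV lin] id)
  moreover have "pd i (\<lambda>x. flat_exp k (\<rho> x)) x = F x * (- 2 * (x - x0) $ i)" for i x
    by (subst pd_eqI[OF D]) (simp add: inner_axis)
  ultimately have "C_k_on l UNIV (pd i (\<lambda>x. flat_exp k (\<rho> x)))" for i
    by simp
  moreover have "(\<lambda>x. flat_exp k (\<rho> x)) differentiable (at x)" for x
    using D by (rule differentiableI)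
  ultimately show ?case unfolding \<rho>_def by simp
qed

lemma smooth_on_bump: "smooth_on UNIV (bump x0 r)"
  unfolding smooth_on_def bump_def using C_k_on_flat_exp_radial by blast

lemma bump_nonneg: "bump x0 r x \<ge> 0"
  by (simp add: bump_def flat_exp_def)

lemma bump_center: "r > 0 \<Longrightarrow> bump x0 r x0 > 0"
  by (simp add: bump_def flat_exp_def)

lemma bump_support: "r > 0 \<Longrightarrow> bump x0 r x \<noteq> 0 \<Longrightarrow> x \<in> ball x0 r"
  by (auto simp: bump_def flat_exp_def dist_norm norm_minus_commute power2_norm_eq_inner[symmetric]
      intro: power2_less_imp_less split: if_splits)

section \<open>Integration of the inner product of forms\<close>

abbreviation gram_inv :: "('a, 'n::finite) metric \<Rightarrow> ('a, 'n) chart \<Rightarrow> 'a \<Rightarrow> 'n \<Rightarrow> 'n \<Rightarrow> complex" where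
  "gram_inv h c q i j \<equiv> complex_of_real (matrix_inv (h c q) $ i $ j)"

lemma metricD:
  assumes "riemannian_metric A h" "c \<in> A"
  shows "q \<in> fst c \<Longrightarrow> transpose (h c q) = h c q"
    and "q \<in> fst c \<Longrightarrow> v \<noteq> 0 \<Longrightarrow> v \<bullet> (h c q *v v) > 0"
    and "smooth_on (snd c ` fst c) (\<lambda>x. h c (chart_inv c x) $ i $ j)"
    and "c' \<in> A \<Longrightarrow> q \<in> fst c \<Longrightarrow> q \<in> fst c' \<Longrightarrow>
      h c q = transpose (transition_jacobian c c' q) ** h c' q ** transition_jacobian c c' q"
  using assms unfolding riemannian_metric_def smooth_in_chart_def o_def by blast+

lemma metric_det:
  assumes "riemannian_metric A h" "c \<in> A" "q \<in> fst c"
  shows "invertible (h c q)" "det (h c q) > 0"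
  using positive_definite_matrix_factorization[OF metricD(1,2)[OF assms(1,2,3)]] by auto

text \<open>The inverse Gram matrix transforms as a contravariant tensor. This makes the inner product of forms
  independent of the chart.\<close>

lemma gram_inv_transition:
  assumes A: "oriented_atlas A" and h: "riemannian_metric A h"
    and c: "c \<in> A" "c' \<in> A" and q: "q \<in> fst c" "q \<in> fst c'"
  shows "matrix_inv (h c' q) = transition_jacobian c c' q ** matrix_inv (h c q) ** transpose (transition_jacobian c c' q)"
proof (rule matrix_inv_eqI)
  let ?J = "transition_jacobian c c' q" and ?H = "h c q" and ?H' = "h c' q"
  have "det ?J > 0" using A c q by (auto simp: oriented_atlas_def)
  then have J: "invertible ?J" by (simp add: invertible_det_nz)
  then have Jt: "invertible (transpose ?J)" by (simp add: invertible_det_nz)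
  have "transpose ?J ** (?H' ** (?J ** matrix_inv ?H ** transpose ?J))
      = (transpose ?J ** ?H' ** ?J) ** matrix_inv ?H ** transpose ?J"
    by (simp only: matrix_mul_assoc)
  also have "\<dots> = transpose ?J"
    unfolding metricD(4)[OF h c q, symmetric] matrix_inv_inverse(1)[OF metric_det(1)[OF h c(1) q(1)]] by simp
  finally have "matrix_inv (transpose ?J) ** (transpose ?J ** (?H' ** (?J ** matrix_inv ?H ** transpose ?J)))
      = matrix_inv (transpose ?J) ** transpose ?J" by simp
  then show "?H' ** (?J ** matrix_inv ?H ** transpose ?J) = mat 1"
    unfolding matrix_mul_assoc matrix_inv_inverse(2)[OF Jt] by simp
qed

text \<open>The definition selects some chart at every point, without any regularity in the point. Continuity, and hence
  measurability, becomes visible only after passing to one fixed chart.\<close>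

lemma form_inner_chart:
  assumes A: "oriented_atlas A" and h: "riemannian_metric A h"
    and \<eta>: "\<eta> \<in> forms A k" and \<omega>: "\<omega> \<in> forms A k" and c: "c \<in> A" "q \<in> fst c"
  shows "form_inner A h l \<eta> \<omega> q = tprod (gram_inv h c q) l (\<eta> c q) (\<omega> c q) / fact l"
proof -
  define c' where "c' = (SOME c. c \<in> A \<and> q \<in> fst c)"
  have c': "c' \<in> A" "q \<in> fst c'"
    using someI[of "\<lambda>c. c \<in> A \<and> q \<in> fst c" c] c unfolding c'_def by auto
  have g: "gram_inv h c q i j = (\<Sum>a\<in>UNIV. \<Sum>b\<in>UNIV. jac c' c q i a * gram_inv h c' q a b * jac c' c q j b)" for i j
  proof -
    have "matrix_inv (h c q) $ i $ j = (\<Sum>b\<in>UNIV. \<Sum>a\<in>UNIV. transition_jacobian c' c q $ i $ a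
        * matrix_inv (h c' q) $ a $ b * transition_jacobian c' c q $ j $ b)"
      unfolding gram_inv_transition[OF A h c'(1) c(1) c'(2) c(2)]
      by (simp add: matrix_matrix_mult_def transpose_def sum_distrib_right)
    then show ?thesis
      by (subst sum.swap) simp
  qed
  have \<eta>': "\<eta> c' q = tens (jac c' c q) (\<eta> c q)" and \<omega>': "\<omega> c' q = tens (jac c' c q) (\<omega> c q)"
    using formsD(6)[OF \<eta> c'(1) c(1) c'(2) c(2)] formsD(6)[OF \<omega> c'(1) c(1) c'(2) c(2)] by auto
  have "form_inner A h l \<eta> \<omega> q = tprod (gram_inv h c' q) l (\<eta> c' q) (\<omega> c' q) / fact l"
    unfolding form_inner_def Let_def c'_def[symmetric] tprod_eq_sum ..
  also have "tprod (gram_inv h c' q) l (\<eta> c' q) (\<omega> c' q) = tprod (gram_inv h c q) l (\<eta> c q) (\<omega> c q)"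
    unfolding \<eta>' \<omega>' g by (rule tprod_tens)
  finally show ?thesis .
qed

lemma atlas_cover:
  assumes "oriented_atlas A"
  obtains c where "c \<in> A" "q \<in> fst c"
proof -
  have "q \<in> (\<Union>c\<in>A. fst c)" using assms by (simp add: oriented_atlas_def)
  then show thesis using that by blast
qed

text \<open>By Cramer's rule the entries of the inverse are quotients of polynomials in the entries of \<open>M\<close>.\<close>

lemma continuous_on_matrix_inv:
  fixes M :: "'a::topological_space \<Rightarrow> real^'n::finite^'n"
  assumes "\<And>i j. continuous_on S (\<lambda>q. M q $ i $ j)" "\<And>q. q \<in> S \<Longrightarrow> invertible (M q)"
  shows "continuous_on S (\<lambda>q. matrix_inv (M q) $ i $ j)"
proof -
  define C where "C q = (\<chi> a b. if b = i then axis j 1 $ a else M q $ a $ b)" for q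
  have det: "det (M q) \<noteq> 0" if "q \<in> S" for q
    using assms(2)[OF that] by (simp add: invertible_det_nz)
  have eq: "matrix_inv (M q) $ i $ j = det (C q) / det (M q)" if "q \<in> S" for q
  proof -
    have "M q *v (matrix_inv (M q) *v axis j 1) = axis j 1"
      by (simp add: matrix_vector_mul_assoc matrix_inv_inverse(1)[OF assms(2)[OF that]])
    then have "(matrix_inv (M q) *v axis j 1) $ i = det (C q) / det (M q)"
      unfolding cramer[OF det[OF that]] C_def by simp
    then show ?thesis
      by (simp add: matrix_vector_mul_component inner_axis)
  qed
  have C: "continuous_on S (\<lambda>q. C q $ a $ b)" for a b
    by (cases "b = i") (simp_all add: C_def assms(1))
  have "continuous_on S (\<lambda>q. det (C q) / det (M q))"
    unfolding det_def by (intro continuous_intros C assms(1)) (use det in \<open>simp add: det_def\<close>)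
  then show ?thesis
    using eq by (simp cong: continuous_on_cong)
qed

lemma continuous_on_chart_pullback:
  assumes A: "oriented_atlas A" "c \<in> A" and f: "smooth_on (snd c ` fst c) (\<lambda>x. f (chart_inv c x))"
  shows "continuous_on (fst c) f"
proof -
  have "continuous_on (fst c) (\<lambda>q. f (chart_inv c (snd c q)))"
    by (rule continuous_on_compose2[OF smooth_on_continuous[OF f] atlas_chart(6)[OF A]]) simp
  then show ?thesis
    using atlas_chart(3)[OF A] by (simp cong: continuous_on_cong)
qed

lemma continuous_form_inner:
  assumes A: "oriented_atlas A" and h: "riemannian_metric A h"
    and \<eta>: "\<eta> \<in> forms A k" and \<omega>: "\<omega> \<in> forms A k"
  shows "continuous_on UNIV (form_inner A h l \<eta> \<omega>)"
proof -
  have "continuous_on (fst c) (form_inner A h l \<eta> \<omega>)" if c: "c \<in> A" for c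
  proof -
    have "continuous_on (fst c) (\<lambda>q. matrix_inv (h c q) $ i $ j)" for i j
      by (rule continuous_on_matrix_inv)
        (auto intro: continuous_on_chart_pullback[OF A c] metricD(3)[OF h c] metric_det(1)[OF h c])
    then have g: "continuous_on (fst c) (\<lambda>q. \<Prod>m<l. gram_inv h c q (I ! m) (K ! m))" for I K
      by (intro continuous_on_prod continuous_on_of_real)
    have "continuous_on (fst c) (\<lambda>q. \<eta> c q I)" "continuous_on (fst c) (\<lambda>q. \<omega> c q I)" for I
      by (rule continuous_on_chart_pullback[OF A c], rule formsD(5)[OF \<eta> c],
          rule continuous_on_chart_pullback[OF A c], rule formsD(5)[OF \<omega> c])
    then have "continuous_on (fst c) (\<lambda>q. tprod (gram_inv h c q) l (\<eta> c q) (\<omega> c q) / fact l)"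
      unfolding tprod_eq_sum
      by (intro continuous_on_sum continuous_on_mult g continuous_on_cnj continuous_on_divide continuous_on_const)
        simp_all
    then show ?thesis
      using form_inner_chart[OF A h \<eta> \<omega> c] by (simp cong: continuous_on_cong)
  qed
  then have "continuous_on (\<Union>c\<in>A. fst c) (form_inner A h l \<eta> \<omega>)"
    using atlas_chart(1)[OF A] by (intro continuous_on_open_UN) auto
  then show ?thesis
    using A by (simp add: oriented_atlas_def)
qed

lemma chart_cball:
  assumes A: "oriented_atlas A" "c \<in> A" and q: "q \<in> fst c"
  shows "\<exists>r>0. cball (snd c q) r \<subseteq> snd c ` fst c \<and>
    compact (chart_inv c ` cball (snd c q) r) \<and> chart_inv c ` cball (snd c q) r \<subseteq> fst c \<and>
    snd c ` (chart_inv c ` cball (snd c q) r) = cball (snd c q) r"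
proof -
  obtain r where r: "r > 0" "cball (snd c q) r \<subseteq> snd c ` fst c"
    using atlas_chart(2)[OF A] q open_contains_cball by blast
  show ?thesis
  proof (intro exI conjI)
    show "r > 0" "cball (snd c q) r \<subseteq> snd c ` fst c" by (fact r)+
    show "compact (chart_inv c ` cball (snd c q) r)"
      by (intro compact_continuous_image compact_cball continuous_on_subset[OF atlas_chart(7)[OF A] r(2)])
    show "chart_inv c ` cball (snd c q) r \<subseteq> fst c"
      using atlas_chart(4)[OF A] r(2) by blast
    show "snd c ` (chart_inv c ` cball (snd c q) r) = cball (snd c q) r"
      using atlas_chart(5)[OF A] r(2) by (force simp: image_image)
  qed
qed

lemma continuous_on_det_chart:
  assumes A: "oriented_atlas A" and h: "riemannian_metric A h" and c: "c \<in> A"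
  shows "continuous_on (snd c ` fst c) (\<lambda>x. sqrt (det (h c (chart_inv c x))))"
  unfolding det_def by (intro continuous_intros smooth_on_continuous[OF metricD(3)[OF h c]])

text \<open>In coordinates the density is continuous, hence bounded on a closed ball.\<close>

lemma locally_finite_volume:
  fixes A :: "('a::{t2_space, second_countable_topology}, 'n::finite) chart set"
  assumes A: "oriented_atlas A" and h: "riemannian_metric A h" and vol: "riemannian_measure A h vol"
  shows "\<exists>U. open U \<and> q \<in> U \<and> emeasure vol U < \<infinity>"
proof -
  obtain c where c: "c \<in> A" "q \<in> fst c" by (rule atlas_cover[OF A])
  obtain r where r: "r > 0" "cball (snd c q) r \<subseteq> snd c ` fst c"
    "compact (chart_inv c ` cball (snd c q) r)" "chart_inv c ` cball (snd c q) r \<subseteq> fst c"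
    "snd c ` (chart_inv c ` cball (snd c q) r) = cball (snd c q) r"
    using chart_cball[OF A c] by blast
  define B where "B = cball (snd c q) r"
  define K where "K = chart_inv c ` B"
  define f where "f x = sqrt (det (h c (chart_inv c x)))" for x
  have K: "K \<in> sets borel"
    unfolding K_def B_def using r(3) by (intro borel_closed compact_imp_closed)
  have "compact (f ` B)"
    unfolding f_def B_def
    by (intro compact_continuous_image compact_cball continuous_on_subset[OF continuous_on_det_chart[OF A h c(1)] r(2)])
  then obtain M where M: "\<And>x. x \<in> B \<Longrightarrow> f x \<le> M"
    using compact_imp_bounded bounded_real by (metis abs_le_D1 imageI)
  have "emeasure vol K = (\<integral>\<^sup>+x\<in>B. ennreal (f x) \<partial>lborel)"
    using vol c(1) K r(4,5) unfolding riemannian_measure_def K_def B_def f_def by simp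
  also have "\<dots> \<le> (\<integral>\<^sup>+x. ennreal M * indicator B x \<partial>lborel)"
    using M by (intro nn_integral_mono) (auto simp: indicator_def intro: ennreal_leI)
  also have "\<dots> = ennreal M * emeasure lborel B"
    by (rule nn_integral_cmult_indicator) (simp add: B_def)
  also have "\<dots> < \<infinity>"
    using emeasure_lborel_cball_finite[of "snd c q" r] by (simp add: B_def ennreal_mult_less_top)
  finally have fin: "emeasure vol K < \<infinity>" .
  define U where "U = fst c \<inter> snd c -` ball (snd c q) r"
  have "open U"
    unfolding U_def by (rule continuous_open_preimage[OF atlas_chart(6,1)[OF A c(1)] open_ball])
  moreover have "q \<in> U" using c r(1) by (simp add: U_def)
  moreover have "U \<subseteq> K"
  proof
    fix y assume "y \<in> U"
    then have "chart_inv c (snd c y) = y" "snd c y \<in> B"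
      using atlas_chart(3)[OF A c(1)] by (auto simp: U_def B_def)
    then show "y \<in> K" unfolding K_def by (metis imageI)
  qed
  then have "emeasure vol U \<le> emeasure vol K"
    using vol K by (intro emeasure_mono) (auto simp: riemannian_measure_def)
  ultimately show ?thesis using fin by (intro exI[of _ U]) auto
qed

lemma compact_finite_volume:
  fixes A :: "('a::{t2_space, second_countable_topology}, 'n::finite) chart set"
  assumes A: "oriented_atlas A" and h: "riemannian_metric A h" and vol: "riemannian_measure A h vol"
    and K: "compact K"
  shows "emeasure vol K < \<infinity>"
proof -
  obtain U where U: "\<And>q. open (U q)" "\<And>q. q \<in> U q" "\<And>q. emeasure vol (U q) < \<infinity>"
    using locally_finite_volume[OF A h vol] by metis
  have "K \<subseteq> (\<Union>q\<in>K. U q)" using U(2) by blast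
  then obtain C where C: "finite C" "K \<subseteq> (\<Union>q\<in>C. U q)"
    using compactE_image[OF K, of K U] U(1) by metis
  have sets: "sets vol = sets borel" using vol by (simp add: riemannian_measure_def)
  have "emeasure vol K \<le> emeasure vol (\<Union>q\<in>C. U q)"
    using C U(1) by (intro emeasure_mono) (auto simp: sets)
  also have "\<dots> \<le> (\<Sum>q\<in>C. emeasure vol (U q))"
    using C U(1) by (intro emeasure_subadditive_finite) (auto simp: sets)
  also have "\<dots> < \<infinity>"
    using U(3) C(1) by simp
  finally show ?thesis .
qed

text \<open>In coordinates the density is positive, and nonempty open sets are not Lebesgue null sets.\<close>

lemma open_positive_volume:
  fixes A :: "('a::{t2_space, second_countable_topology}, 'n::finite) chart set"
  assumes A: "oriented_atlas A" and h: "riemannian_metric A h" and vol: "riemannian_measure A h vol"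
    and c: "c \<in> A" and W: "open W" "W \<subseteq> fst c" "W \<noteq> {}"
  shows "emeasure vol W \<noteq> 0"
proof
  define V where "V = snd c ` W"
  define f where "f x = ennreal (sqrt (det (h c (chart_inv c x)))) * indicator V x" for x
  assume "emeasure vol W = 0"
  then have "(\<integral>\<^sup>+x. f x \<partial>lborel) = 0"
    using vol c W unfolding riemannian_measure_def f_def V_def by simp
  moreover have V: "open V"
    unfolding V_def by (rule open_chart_image[OF A c W(1,2)])
  have "f = (\<lambda>x. ennreal (indicator V x *\<^sub>R sqrt (det (h c (chart_inv c x)))))"
    unfolding f_def by (auto simp: fun_eq_iff indicator_def)
  moreover have "(\<lambda>x. indicator V x *\<^sub>R sqrt (det (h c (chart_inv c x)))) \<in> borel_measurable borel"
    by (rule borel_measurable_continuous_on_indicator)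
      (use V W in \<open>auto intro: continuous_on_subset[OF continuous_on_det_chart[OF A h c]] simp: V_def\<close>)
  ultimately have "AE x in lborel. f x = 0"
    by (subst (asm) nn_integral_0_iff_AE) auto
  moreover have "f x \<noteq> 0" if "x \<in> V" for x
  proof -
    have "chart_inv c x \<in> fst c" using that W(2) atlas_chart(4)[OF A c] by (auto simp: V_def)
    from metric_det(2)[OF h c this] show ?thesis
      using that by (simp add: f_def ennreal_eq_0_iff not_le)
  qed
  ultimately have "AE x in lborel. x \<notin> V" by (auto elim: eventually_mono)
  then have "V \<in> null_sets lborel"
    using V by (simp add: AE_iff_null_sets)
  then have "negligible V"
    by (simp add: negligible_iff_null_sets null_sets_completionI)
  moreover have "V \<noteq> {}" using W(3) by (simp add: V_def)
  ultimately show False using open_not_negligible V by blast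
qed

lemma form_inner_0:
  assumes "\<And>c I. \<eta> c q I = 0"
  shows "form_inner A h l \<eta> \<omega> q = 0"
  using assms by (simp add: form_inner_def Let_def)

lemma integrable_form_inner:
  fixes A :: "('a::{t2_space, second_countable_topology}, 'n::finite) chart set"
  assumes A: "oriented_atlas A" and h: "riemannian_metric A h" and vol: "riemannian_measure A h vol"
    and \<eta>: "\<eta> \<in> forms A k" "compactly_supported \<eta>" and \<omega>: "\<omega> \<in> forms A k"
  shows "integrable vol (form_inner A h l \<eta> \<omega>)"
proof -
  define K where "K = closure {q. \<exists>c I. \<eta> c q I \<noteq> 0}"
  have K: "compact K" using \<eta>(2) by (simp add: compactly_supported_def K_def)
  have sets: "sets vol = sets borel" using vol by (simp add: riemannian_measure_def)
  have cont: "continuous_on UNIV (form_inner A h l \<eta> \<omega>)"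
    by (rule continuous_form_inner[OF A h \<eta>(1) \<omega>])
  have "compact (form_inner A h l \<eta> \<omega> ` K)"
    by (rule compact_continuous_image[OF continuous_on_subset[OF cont subset_UNIV] K])
  then obtain M where M: "\<And>q. q \<in> K \<Longrightarrow> norm (form_inner A h l \<eta> \<omega> q) \<le> M"
    using compact_imp_bounded bounded_iff by (metis imageI)
  have zero: "form_inner A h l \<eta> \<omega> q = 0" if "q \<notin> K" for q
    by (rule form_inner_0) (use that closure_subset[of "{q. \<exists>c I. \<eta> c q I \<noteq> 0}"] in \<open>unfold K_def, blast\<close>)
  show ?thesis
  proof (rule integrableI_bounded_set[where A = K and B = M])
    show "K \<in> sets vol" using K by (simp add: sets borel_closed compact_imp_closed)
    show "form_inner A h l \<eta> \<omega> \<in> borel_measurable vol"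
      using borel_measurable_continuous_onI[OF cont] measurable_cong_sets[OF sets refl] by blast
  qed (use compact_finite_volume[OF A h vol K] M zero in \<open>auto intro!: AE_I2\<close>)
qed

lemma form_inner_add_right:
  assumes "oriented_atlas A" "riemannian_metric A h" "\<eta> \<in> forms A k" "\<omega> \<in> forms A k" "\<omega>' \<in> forms A k"
  shows "form_inner A h l \<eta> (\<omega> + \<omega>') q = form_inner A h l \<eta> \<omega> q + form_inner A h l \<eta> \<omega>' q"
proof -
  obtain c where c: "c \<in> A" "q \<in> fst c" by (rule atlas_cover[OF assms(1)])
  show ?thesis
    unfolding form_inner_chart[OF assms(1-4) c] form_inner_chart[OF assms(1-3,5) c]
      form_inner_chart[OF assms(1-3) forms_add[OF assms(1,4,5)] c]
    by (simp add: plus_fun_def tprod_add_right add_divide_distrib)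
qed

lemma form_inner_smul_right:
  assumes "oriented_atlas A" "riemannian_metric A h" "\<eta> \<in> forms A k" "\<omega> \<in> forms A k"
  shows "form_inner A h l \<eta> (smul a \<omega>) q = cnj a * form_inner A h l \<eta> \<omega> q"
proof -
  obtain c where c: "c \<in> A" "q \<in> fst c" by (rule atlas_cover[OF assms(1)])
  show ?thesis
    unfolding form_inner_chart[OF assms(1-4) c] form_inner_chart[OF assms(1-3) forms_smul[OF assms(1,4)] c]
    by (simp add: smul_def tprod_cmult_right)
qed

lemma L2_inner_add_right:
  fixes A :: "('a::{t2_space, second_countable_topology}, 'n::finite) chart set"
  assumes "oriented_atlas A" "riemannian_metric A h" "riemannian_measure A h vol"
    "\<eta> \<in> forms A k" "compactly_supported \<eta>" "\<omega> \<in> forms A k" "\<omega>' \<in> forms A k"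
  shows "L2_inner A h vol l \<eta> (\<omega> + \<omega>') = L2_inner A h vol l \<eta> \<omega> + L2_inner A h vol l \<eta> \<omega>'"
  unfolding L2_inner_def form_inner_add_right[OF assms(1,2,4,6,7)]
  by (rule Bochner_Integration.integral_add)
    (rule integrable_form_inner[OF assms(1-6)], rule integrable_form_inner[OF assms(1-5,7)])

lemma L2_inner_smul_right:
  fixes A :: "('a::{t2_space, second_countable_topology}, 'n::finite) chart set"
  assumes "oriented_atlas A" "riemannian_metric A h" "\<eta> \<in> forms A k" "\<omega> \<in> forms A k"
  shows "L2_inner A h vol l \<eta> (smul a \<omega>) = cnj a * L2_inner A h vol l \<eta> \<omega>"
  unfolding L2_inner_def form_inner_smul_right[OF assms] by (rule integral_mult_right_zero)

text \<open>The bump function of the coordinate domain, extended by zero. The extension is smooth in every chart, because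
  its support is compact, hence closed in the Hausdorff space.\<close>

lemma chart_bump:
  fixes A :: "('a::{t2_space, second_countable_topology}, 'n::finite) chart set"
  assumes A: "oriented_atlas A" "c \<in> A" and q: "q \<in> fst c"
  shows "\<exists>(b :: 'a \<Rightarrow> real) K. (\<forall>y. b y \<ge> 0) \<and> b q > 0 \<and> compact K \<and> (\<forall>y. b y \<noteq> 0 \<longrightarrow> y \<in> K) \<and>
    (\<forall>c'\<in>A. smooth_on (snd c' ` fst c') (\<lambda>x. b (chart_inv c' x)))"
proof -
  obtain r where r: "r > 0" "cball (snd c q) r \<subseteq> snd c ` fst c"
    "compact (chart_inv c ` cball (snd c q) r)" "chart_inv c ` cball (snd c q) r \<subseteq> fst c"
    using chart_cball[OF A q] by blast
  define K where "K = chart_inv c ` cball (snd c q) r"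
  define b where "b y = (if y \<in> fst c then bump (snd c q) r (snd c y) else 0)" for y
  have K: "y \<in> K" if "b y \<noteq> 0" for y
  proof -
    have "y \<in> fst c" "snd c y \<in> ball (snd c q) r"
      using that bump_support[OF r(1)] by (auto simp: b_def split: if_splits)
    moreover have "y = chart_inv c (snd c y)" using atlas_chart(3)[OF A] \<open>y \<in> fst c\<close> by simp
    ultimately show ?thesis unfolding K_def by (metis ball_subset_cball imageI subsetD)
  qed
  have "smooth_on (snd c' ` fst c') (\<lambda>x. b (chart_inv c' x))" if c': "c' \<in> A" for c'
  proof (rule smooth_on_local)
    note chart' = atlas_chart[OF A(1) c']
    fix x assume x: "x \<in> snd c' ` fst c'"
    show "\<exists>U. open U \<and> x \<in> U \<and> smooth_on U (\<lambda>x. b (chart_inv c' x))"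
    proof (cases "chart_inv c' x \<in> fst c")
      case True
      define U where "U = snd c' ` (fst c' \<inter> fst c)"
      have U: "open U"
        unfolding U_def by (rule open_chart_image[OF A(1) c']) (auto intro: open_Int chart'(1) atlas_chart(1)[OF A])
      have "x = snd c' (chart_inv c' x)" "chart_inv c' x \<in> fst c'" using chart'(4,5) x by auto
      then have "x \<in> U" unfolding U_def using True by blast
      have "smooth_on U (snd c \<circ> chart_inv c')"
        using A c' by (auto simp: oriented_atlas_def U_def)
      from smooth_on_compose[OF U subset_UNIV this smooth_on_bump]
      have "smooth_on U (\<lambda>x. bump (snd c q) r ((snd c \<circ> chart_inv c') x))" .
      moreover have "b (chart_inv c' x) = bump (snd c q) r ((snd c \<circ> chart_inv c') x)" if "x \<in> U" for x
        using that chart'(3) by (auto simp: U_def b_def)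
      ultimately have "smooth_on U (\<lambda>x. b (chart_inv c' x))"
        using smooth_on_cong[OF U, of "\<lambda>x. b (chart_inv c' x)"] by simp
      with U \<open>x \<in> U\<close> show ?thesis by blast
    next
      case False
      define U where "U = snd c' ` (fst c' - K)"
      have "closed K" using r(3) by (simp add: K_def compact_imp_closed)
      then have U: "open U"
        unfolding U_def by (intro open_chart_image[OF A(1) c'] open_Diff chart'(1)) auto
      have "x = snd c' (chart_inv c' x)" "chart_inv c' x \<in> fst c'" using chart'(4,5) x by auto
      moreover have "chart_inv c' x \<notin> K" using False r(4) by (auto simp: K_def)
      ultimately have "x \<in> U" unfolding U_def by blast
      have "b (chart_inv c' x) = 0" if "x \<in> U" for x
      proof -
        have "chart_inv c' x \<notin> K" using that chart'(3) by (auto simp: U_def)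
        then show ?thesis using K by blast
      qed
      then have "smooth_on U (\<lambda>x. b (chart_inv c' x))"
        using smooth_on_cong[OF U, of "\<lambda>x. b (chart_inv c' x)" "\<lambda>x. 0"] smooth_on_const by simp
      with U \<open>x \<in> U\<close> show ?thesis by blast
    qed
  qed
  moreover have "b y \<ge> 0" for y by (simp add: b_def bump_nonneg)
  moreover have "b q > 0" using q r(1) by (simp add: b_def bump_center)
  moreover have "compact K" using r(3) by (simp add: K_def)
  ultimately show ?thesis using K by (intro exI[of _ b] exI[of _ K]) simp
qed

lemma forms_function_mult:
  assumes A: "oriented_atlas A" and \<omega>: "\<omega> \<in> forms A k"
    and b: "\<And>c. c \<in> A \<Longrightarrow> smooth_on (snd c ` fst c) (\<lambda>x. b (chart_inv c x))"
  shows "(\<lambda>c q I. complex_of_real (b q) * \<omega> c q I) \<in> forms A k"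
  unfolding forms_iff
proof (intro conjI allI ballI impI)
  show "alternating (\<lambda>I. complex_of_real (b q) * \<omega> c q I)" for c q
    using formsD(4)[OF \<omega>, of c q] unfolding alternating_def by (metis mult_minus_right)
  show "smooth_on (snd c ` fst c) (\<lambda>x. complex_of_real (b (chart_inv c x)) * \<omega> c (chart_inv c x) I)" if "c \<in> A" for c I
    using that by (intro smooth_on_mult atlas_chart(2)[OF A] formsD(5)[OF \<omega>]
        smooth_on_linear[OF _ bounded_linear_of_real b])
  show "complex_of_real (b q) * \<omega> c q I = tens (jac c c' q) (\<lambda>I. complex_of_real (b q) * \<omega> c' q I) I"
    if "c \<in> A" "c' \<in> A" "q \<in> fst c \<inter> fst c'" for c c' q I
    using formsD(6)[OF \<omega> that(1,2)] that(3) by (simp add: tens_mult)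
qed (use formsD(1-3)[OF \<omega>] in \<open>metis mult_zero_right\<close>)+

section \<open>The codifferential is linear and has square zero\<close>

lemma compactly_supportedI:
  fixes \<omega> :: "('a::t2_space, 'n) form"
  assumes "compact K" "\<And>c q I. \<omega> c q I \<noteq> 0 \<Longrightarrow> q \<in> K"
  shows "compactly_supported \<omega>"
proof -
  have "{q. \<exists>c I. \<omega> c q I \<noteq> 0} \<subseteq> K" using assms(2) by blast
  then have "closure {q. \<exists>c I. \<omega> c q I \<noteq> 0} \<subseteq> K"
    by (rule closure_minimal) (rule compact_imp_closed[OF assms(1)])
  then have "K \<inter> closure {q. \<exists>c I. \<omega> c q I \<noteq> 0} = closure {q. \<exists>c I. \<omega> c q I \<noteq> 0}" by blast
  then show ?thesis
    using compact_Int_closed[OF assms(1) closed_closure, of "{q. \<exists>c I. \<omega> c q I \<noteq> 0}"]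
    by (simp add: compactly_supported_def)
qed

text \<open>Test with the product of \<open>\<alpha>\<close> and a bump function \<open>b\<close> around a point at which \<open>\<alpha>\<close> does not vanish. The integrand
  \<open>b |\<alpha>|\<^sup>2\<close> is continuous, nonnegative and positive on a nonempty open set.\<close>

lemma L2_inner_nondegenerate:
  fixes A :: "('a::{t2_space, second_countable_topology}, 'n::finite) chart set"
  assumes A: "oriented_atlas A" and h: "riemannian_metric A h" and vol: "riemannian_measure A h vol"
    and \<alpha>: "\<alpha> \<in> forms A k"
    and orth: "\<And>\<eta>. \<eta> \<in> forms A k \<Longrightarrow> compactly_supported \<eta> \<Longrightarrow> L2_inner A h vol k \<eta> \<alpha> = 0"
  shows "\<alpha> = 0"
proof (rule ccontr)
  assume "\<alpha> \<noteq> 0"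
  then obtain c q I where nz: "\<alpha> c q I \<noteq> 0" by (auto simp: fun_eq_iff)
  have c: "c \<in> A" "q \<in> fst c" and len: "length I = nat k"
    using formsD(1-3)[OF \<alpha> nz] by auto
  obtain b :: "'a \<Rightarrow> real" and K where b: "\<forall>y. b y \<ge> 0" "b q > 0" "compact K" "\<forall>y. b y \<noteq> 0 \<longrightarrow> y \<in> K"
    "\<forall>c'\<in>A. smooth_on (snd c' ` fst c') (\<lambda>x. b (chart_inv c' x))"
    using chart_bump[OF A c] by blast
  define \<eta> where "\<eta> = (\<lambda>c q I. complex_of_real (b q) * \<alpha> c q I)"
  have \<eta>: "\<eta> \<in> forms A k" unfolding \<eta>_def by (rule forms_function_mult[OF A \<alpha> b(5)[rule_format]])
  have supp: "compactly_supported \<eta>"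
    by (rule compactly_supportedI[OF b(3)]) (use b(4) in \<open>auto simp: \<eta>_def\<close>)
  define N where "N y = Re (form_inner A h (nat k) \<alpha> \<alpha> y)" for y
  have N: "form_inner A h (nat k) \<alpha> \<alpha> y = complex_of_real (N y)" "N y \<ge> 0" for y
  proof -
    obtain c where c: "c \<in> A" "y \<in> fst c" by (rule atlas_cover[OF A])
    note pos = tprod_positive_definite[OF metricD(1,2)[OF h c(1) c(2)], where u = "\<alpha> c y"]
    let ?T = "tprod (gram_inv h c y) (nat k) (\<alpha> c y) (\<alpha> c y)"
    have "?T = complex_of_real (Re ?T)"
      using pos(1)[of "nat k"] by (simp add: complex_eq_iff)
    then have eq: "form_inner A h (nat k) \<alpha> \<alpha> y = complex_of_real (Re ?T / fact (nat k))"
      unfolding form_inner_chart[OF A h \<alpha> \<alpha> c] by (metis of_real_divide of_real_fact)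
    then have "N y = Re ?T / fact (nat k)"
      unfolding N_def by (simp only: Re_complex_of_real)
    then show "form_inner A h (nat k) \<alpha> \<alpha> y = complex_of_real (N y)" "N y \<ge> 0"
      using pos(2)[of "nat k"] eq by simp_all
  qed
  have Nq: "N q > 0"
  proof -
    let ?T = "tprod (gram_inv h c q) (nat k) (\<alpha> c q) (\<alpha> c q)"
    have "N q = Re ?T / fact (nat k)"
      unfolding N_def form_inner_chart[OF A h \<alpha> \<alpha> c] by (metis Re_divide_of_nat of_nat_fact)
    then show ?thesis
      using tprod_positive_definite(3)[where u = "\<alpha> c q" and I = I and k = "nat k",
          OF metricD(1,2)[OF h c(1) c(2)] len nz] by simp
  qed
  have inner: "form_inner A h (nat k) \<eta> \<alpha> y = complex_of_real (b y * N y)" for y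
  proof -
    obtain c where c: "c \<in> A" "y \<in> fst c" by (rule atlas_cover[OF A])
    have "form_inner A h (nat k) \<eta> \<alpha> y = complex_of_real (b y) * form_inner A h (nat k) \<alpha> \<alpha> y"
      unfolding form_inner_chart[OF A h \<alpha> \<alpha> c] form_inner_chart[OF A h \<eta> \<alpha> c]
      by (simp add: \<eta>_def tprod_cmult_left)
    then show ?thesis by (simp add: N(1))
  qed
  have cont: "continuous_on UNIV (\<lambda>y. b y * N y)"
    using continuous_on_Re[OF continuous_form_inner[OF A h \<eta> \<alpha>, of "nat k"]] unfolding inner by simp
  have int: "integrable vol (\<lambda>y. b y * N y)"
    using integrable_Re[OF integrable_form_inner[OF A h vol \<eta> supp \<alpha>, of "nat k"]] unfolding inner by simp
  have "complex_of_real (\<integral>y. b y * N y \<partial>vol) = 0"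
    using orth[OF \<eta> supp] unfolding L2_inner_def inner integral_complex_of_real .
  then have "(\<integral>y. b y * N y \<partial>vol) = 0" by simp
  then have AE: "AE y in vol. b y * N y = 0"
    using integral_nonneg_eq_0_iff_AE[OF int] b(1) N(2) by simp
  define W where "W = {y. b y * N y > 0} \<inter> fst c"
  have "q \<in> W" using b(2) Nq c(2) by (simp add: W_def)
  have W: "open W"
    unfolding W_def by (intro open_Int open_Collect_less continuous_on_const cont atlas_chart(1)[OF A c(1)])
  have W': "W \<subseteq> fst c" "W \<noteq> {}"
    using \<open>q \<in> W\<close> by (auto simp only: W_def)
  have "AE y in vol. y \<notin> W" using AE by eventually_elim (auto simp: W_def)
  moreover have "W \<in> sets vol" using W vol by (simp add: riemannian_measure_def)
  ultimately have "emeasure vol W = 0"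
    by (simp add: AE_iff_null_sets null_setsD1)
  then show False using open_positive_volume[OF A h vol c(1) W W'] by contradiction
qed

lemma ext_deriv_compactly_supported:
  fixes A :: "('a::{t2_space, second_countable_topology}, 'n::finite) chart set"
  assumes A: "oriented_atlas A" and \<eta>: "compactly_supported \<eta>"
  shows "compactly_supported (ext_deriv A \<eta>)"
proof -
  let ?K = "closure {q. \<exists>c I. \<eta> c q I \<noteq> 0}"
  have "q \<in> ?K" if "\<eta> c q I \<noteq> 0" for c q I
    by (rule subsetD[OF closure_subset]) (use that in blast)
  then show ?thesis
    using ext_deriv_support[OF A closed_closure, where \<omega> = \<eta>] \<eta>
    by (intro compactly_supportedI[of ?K]) (auto simp: compactly_supported_def)
qed

context
  fixes A :: "('a::{t2_space, second_countable_topology}, 'n::finite) chart set" and h vol \<delta>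
  assumes A: "oriented_atlas A" and h: "riemannian_metric A h" and vol: "riemannian_measure A h vol"
    and \<delta>: "is_codifferential A h vol \<delta>"
begin

lemma codifferential_forms: "\<omega> \<in> forms A (k + 1) \<Longrightarrow> \<delta> \<omega> \<in> forms A k"
  using \<delta> by (simp add: is_codifferential_def)

lemma codifferential_adjoint:
  "\<omega> \<in> forms A (k + 1) \<Longrightarrow> \<eta> \<in> forms A k \<Longrightarrow> compactly_supported \<eta> \<Longrightarrow>
    L2_inner A h vol (k + 1) (ext_deriv A \<eta>) \<omega> = L2_inner A h vol k \<eta> (\<delta> \<omega>)"
  using \<delta> by (simp add: is_codifferential_def)

text \<open>The values of \<open>\<delta>\<close> are determined by adjointness. The linearity of \<open>\<delta>\<close> and \<open>\<delta> \<delta> = 0\<close> follow, since the expected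
  values satisfy the same adjunction.\<close>

lemma codifferential_eqI:
  assumes \<omega>: "\<omega> \<in> forms A (k + 1)" and \<theta>: "\<theta> \<in> forms A k"
    and adj: "\<And>\<eta>. \<eta> \<in> forms A k \<Longrightarrow> compactly_supported \<eta> \<Longrightarrow>
      L2_inner A h vol (k + 1) (ext_deriv A \<eta>) \<omega> = L2_inner A h vol k \<eta> \<theta>"
  shows "\<delta> \<omega> = \<theta>"
proof -
  have m\<theta>: "smul (-1) \<theta> \<in> forms A k" by (rule forms_smul[OF A \<theta>])
  have "\<delta> \<omega> + smul (-1) \<theta> = 0"
  proof (rule L2_inner_nondegenerate[OF A h vol])
    show "\<delta> \<omega> + smul (-1) \<theta> \<in> forms A k"
      by (intro forms_add[OF A] codifferential_forms \<omega> m\<theta>)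
    fix \<eta> assume \<eta>: "\<eta> \<in> forms A k" "compactly_supported \<eta>"
    show "L2_inner A h vol k \<eta> (\<delta> \<omega> + smul (-1) \<theta>) = 0"
      unfolding L2_inner_add_right[OF A h vol \<eta> codifferential_forms[OF \<omega>] m\<theta>]
        L2_inner_smul_right[OF A h \<eta>(1) \<theta>] adj[OF \<eta>, symmetric] codifferential_adjoint[OF \<omega> \<eta>] by simp
  qed
  then show ?thesis
    by (auto simp: fun_eq_iff smul_def)
qed

lemma codifferential_add:
  assumes "\<omega> \<in> forms A (k + 1)" "\<omega>' \<in> forms A (k + 1)"
  shows "\<delta> (\<omega> + \<omega>') = \<delta> \<omega> + \<delta> \<omega>'"
proof (rule codifferential_eqI)
  fix \<eta> assume \<eta>: "\<eta> \<in> forms A k" "compactly_supported \<eta>"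
  show "L2_inner A h vol (k + 1) (ext_deriv A \<eta>) (\<omega> + \<omega>') = L2_inner A h vol k \<eta> (\<delta> \<omega> + \<delta> \<omega>')"
    unfolding L2_inner_add_right[OF A h vol ext_deriv_forms[OF A \<eta>(1)] ext_deriv_compactly_supported[OF A \<eta>(2)] assms]
      L2_inner_add_right[OF A h vol \<eta> codifferential_forms[OF assms(1)] codifferential_forms[OF assms(2)]]
      codifferential_adjoint[OF assms(1) \<eta>] codifferential_adjoint[OF assms(2) \<eta>] ..
qed (intro forms_add[OF A] codifferential_forms assms)+

lemma codifferential_smul:
  assumes "\<omega> \<in> forms A (k + 1)"
  shows "\<delta> (smul a \<omega>) = smul a (\<delta> \<omega>)"
proof (rule codifferential_eqI)
  fix \<eta> assume \<eta>: "\<eta> \<in> forms A k" "compactly_supported \<eta>"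
  show "L2_inner A h vol (k + 1) (ext_deriv A \<eta>) (smul a \<omega>) = L2_inner A h vol k \<eta> (smul a (\<delta> \<omega>))"
    unfolding L2_inner_smul_right[OF A h ext_deriv_forms[OF A \<eta>(1)] assms]
      L2_inner_smul_right[OF A h \<eta>(1) codifferential_forms[OF assms]] codifferential_adjoint[OF assms \<eta>] ..
qed (intro forms_smul[OF A] codifferential_forms assms)+

lemma codifferential_codifferential:
  assumes "\<omega> \<in> forms A (k + 1 + 1)"
  shows "\<delta> (\<delta> \<omega>) = 0"
proof (rule codifferential_eqI)
  fix \<eta> assume \<eta>: "\<eta> \<in> forms A k" "compactly_supported \<eta>"
  have zero: "L2_inner A h vol l \<theta> 0 = 0" "L2_inner A h vol l 0 \<theta> = 0" for l and \<theta> :: "('a, 'n) form"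
    by (simp_all add: L2_inner_def form_inner_def Let_def)
  have "L2_inner A h vol (k + 1) (ext_deriv A \<eta>) (\<delta> \<omega>)
      = L2_inner A h vol (k + 1 + 1) (ext_deriv A (ext_deriv A \<eta>)) \<omega>"
    by (rule codifferential_adjoint[OF assms ext_deriv_forms[OF A \<eta>(1)] ext_deriv_compactly_supported[OF A \<eta>(2)], symmetric])
  then show "L2_inner A h vol (k + 1) (ext_deriv A \<eta>) (\<delta> \<omega>) = L2_inner A h vol k \<eta> 0"
    by (simp add: ext_deriv_ext_deriv[OF A \<eta>(1)] zero)
qed (intro forms_0 codifferential_forms assms)+

end

section \<open>Recurrences of the polynomials\<close>

text \<open>The polynomials \<open>R\<^sub>k(y; 0)\<close>, as functions. They are the Newton basis for the nodes \<open>l (l + 1)\<close>.\<close>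

definition newton_basis :: "nat \<Rightarrow> complex \<Rightarrow> complex" where
  "newton_basis k y = (\<Prod>l<k. y - of_nat l * (of_nat l + 1))"

lemma newton_basis_0: "newton_basis 0 y = 1"
  by (simp add: newton_basis_def)

lemma newton_basis_Suc: "newton_basis (Suc k) y = newton_basis k y * (y - of_nat k * (of_nat k + 1))"
  by (simp add: newton_basis_def)

lemma poly_R_poly_0: "poly (R_poly k 0) y = newton_basis k y"
proof (induction k)
  case (Suc k)
  then show ?case
    by (simp add: R_poly_def newton_basis_Suc algebra_simps)
qed (simp add: R_poly_def newton_basis_def)

text \<open>The product with the first \<open>i\<close> factors taken at \<open>y\<close> and the others at \<open>x\<close> interpolates between the two
  products as \<open>i\<close> runs from \<open>0\<close> to \<open>k\<close>.\<close>

lemma prod_diff_telescope: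
  fixes x y :: "'a::comm_ring_1"
  shows "(\<Prod>l<k. x - e l) - (\<Prod>l<k. y - e l)
    = (\<Sum>i<k. (\<Prod>l<i. y - e l) * (x - y) * (\<Prod>l=Suc i..<k. x - e l))"
proof (induction k)
  case (Suc k)
  have "(\<Sum>i<Suc k. (\<Prod>l<i. y - e l) * (x - y) * (\<Prod>l=Suc i..<Suc k. x - e l))
     = (\<Sum>i<k. (\<Prod>l<i. y - e l) * (x - y) * (\<Prod>l=Suc i..<k. x - e l)) * (x - e k)
       + (\<Prod>l<k. y - e l) * (x - y)"
    by (simp add: sum_distrib_left mult_ac)
  also have "\<dots> = (\<Prod>l<Suc k. x - e l) - (\<Prod>l<Suc k. y - e l)"
    unfolding Suc.IH[symmetric] by (simp add: algebra_simps)
  finally show ?case by simp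
qed simp

text \<open>The factors of the Pochhammer symbol, paired from outside inwards, are \<open>(b - l) (b + l + 1) = b (b + 1) - l (l + 1)\<close>. So
  the coefficients of \<open>R1_poly\<close> are themselves values of the Newton basis.\<close>

lemma pochhammer_symmetric_product:
  "pochhammer (b - of_nat i + 1) (2 * i) = (\<Prod>l<i. b * (b + 1) - of_nat l * (of_nat l + 1 :: complex))"
proof (induction i)
  case (Suc i)
  have "pochhammer (b - of_nat (Suc i) + 1) (2 * Suc i) = (b - of_nat i) * pochhammer (b - of_nat i + 1) (2 * i) * (b + of_nat i + 1)"
    using pochhammer_rec[of "b - of_nat i" "Suc (2 * i)"] pochhammer_Suc[of "b - of_nat i + 1" "2 * i"]
    by (simp add: algebra_simps)
  then show ?case
    unfolding Suc.IH by (simp add: algebra_simps)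
qed simp

text \<open>The summands of \<open>R1_poly\<close> are those of the telescoping sum for the Newton basis at \<open>y\<close> and at
  \<open>\<beta>/2 (\<beta>/2 + 1)\<close>.\<close>

lemma poly_R1_poly:
  "poly (R1_poly \<beta> k) y = newton_basis k y - newton_basis k (\<beta>/2 * (\<beta>/2 + 1))"
proof -
  define Y where "Y = \<beta>/2 * (\<beta>/2 + 1)"
  define e where "e l = of_nat l * (of_nat l + 1 :: complex)" for l
  have R: "poly (R_poly j (of_nat k)) y = (\<Prod>l=k-j..<k. y - e l)" if "j \<le> k" for j
  proof -
    have "poly (R_poly j (of_nat k)) y = (\<Prod>l=1..j. y - e (k - l))"
      using that by (auto simp: R_poly_def poly_prod e_def of_nat_diff intro!: prod.cong)
    also have "\<dots> = (\<Prod>l=k-j..<k. y - e l)"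
      by (rule prod.reindex_bij_witness[where i = "\<lambda>l. k - l" and j = "\<lambda>l. k - l"]) (use that in auto)
    finally show ?thesis .
  qed
  have "poly (R1_poly \<beta> k) y = (\<Sum>j=1..k. pochhammer (\<beta>/2 - of_nat (k - j) + 1) (2 * (k - j))
      * ((y - Y) * poly (R_poly (j - 1) (of_nat k)) y))"
    by (auto simp: R1_poly_def poly_sum Y_def of_nat_diff algebra_simps intro!: sum.cong)
  also have "\<dots> = (\<Sum>j=1..k. (\<Prod>l<k-j. Y - e l) * (y - Y) * (\<Prod>l=Suc (k-j)..<k. y - e l))"
  proof (rule sum.cong[OF refl])
    fix j assume j: "j \<in> {1..k}"
    then have "k - (j - 1) = Suc (k - j)" "j - 1 \<le> k" by auto
    then have "poly (R_poly (j - 1) (of_nat k)) y = (\<Prod>l=Suc (k-j)..<k. y - e l)"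
      using R[of "j - 1"] by (simp only:)
    moreover have "pochhammer (\<beta>/2 - of_nat (k - j) + 1) (2 * (k - j)) = (\<Prod>l<k-j. Y - e l)"
      unfolding Y_def e_def by (rule pochhammer_symmetric_product)
    ultimately show "pochhammer (\<beta>/2 - of_nat (k - j) + 1) (2 * (k - j)) * ((y - Y) * poly (R_poly (j - 1) (of_nat k)) y)
      = (\<Prod>l<k-j. Y - e l) * (y - Y) * (\<Prod>l=Suc (k-j)..<k. y - e l)"
      by (simp only: mult_ac)
  qed
  also have "\<dots> = (\<Sum>i<k. (\<Prod>l<i. Y - e l) * (y - Y) * (\<Prod>l=Suc i..<k. y - e l))"
    by (rule sum.reindex_bij_witness[where i = "\<lambda>i. k - i" and j = "\<lambda>j. k - j"]) auto
  also have "\<dots> = newton_basis k y - newton_basis k Y"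
    unfolding prod_diff_telescope[symmetric] by (simp add: newton_basis_def e_def)
  finally show ?thesis by (simp add: Y_def)
qed

definition dual_hahn_coeff :: "complex \<Rightarrow> complex \<Rightarrow> nat \<Rightarrow> nat \<Rightarrow> complex" where
  "dual_hahn_coeff u w n k = of_nat (n choose k) * pochhammer (u + of_nat k + 1) (n - k) * pochhammer (w + of_nat k + 1) (n - k)"

text \<open>With \<open>y = z (z + 1)\<close> these are, up to normalisation, the continuous dual Hahn polynomials with
  parameters \<open>1/2\<close>, \<open>u + 1/2\<close> and \<open>w + 1/2\<close>. The polynomials \<open>s\<^sup>-\<close> and \<open>s\<^sup>+\<close> are the cases
  \<open>u = \<lambda> - \<beta>/2\<close> and \<open>w = \<beta>/2 + 1\<close> or \<open>w = \<beta>/2 - 1\<close>.\<close>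

definition dual_hahn :: "complex \<Rightarrow> complex \<Rightarrow> nat \<Rightarrow> complex \<Rightarrow> complex" where
  "dual_hahn u w n y = (\<Sum>k\<le>n. dual_hahn_coeff u w n k * newton_basis k y)"

lemma pochhammer_top:
  "k \<le> n \<Longrightarrow> pochhammer (a + of_nat k + 1 :: complex) (Suc n - k) = (a + of_nat n + 1) * pochhammer (a + of_nat k + 1) (n - k)"
  using pochhammer_Suc[of "a + of_nat k + 1" "n - k"] by (simp add: Suc_diff_le of_nat_diff mult_ac)

lemma pochhammer_bottom:
  assumes "0 < k" "k \<le> n"
  shows "pochhammer (a + of_nat (k - 1) + 1 :: complex) (n - (k - 1)) = (a + of_nat k) * pochhammer (a + of_nat k + 1) (n - k)"
proof -
  have "n - (k - 1) = Suc (n - k)" using assms by auto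
  then show ?thesis
    using pochhammer_rec[of "a + of_nat k" "n - k"] assms by (simp add: of_nat_diff)
qed

lemma dual_hahn_extend:
  "n \<le> N \<Longrightarrow> dual_hahn u w n y = (\<Sum>k\<le>N. dual_hahn_coeff u w n k * newton_basis k y)"
  unfolding dual_hahn_def by (rule sum.mono_neutral_left) (auto simp: dual_hahn_coeff_def)

lemma of_nat_binomial_pred:
  assumes "k \<le> n"
  shows "of_nat n * of_nat ((n - 1) choose k) = (of_nat (n - k) * of_nat (n choose k) :: complex)"
proof (cases n)
  case (Suc n')
  then have "n * ((n - 1) choose k) = (n - k) * (n choose k)"
    using binomial_absorb_comp[of n k] by simp
  then show ?thesis
    by (metis of_nat_mult)
qed simp

lemma pochhammer_pred:
  assumes "k < n"
  shows "(a + of_nat n) * pochhammer (a + of_nat k + 1 :: complex) (n - 1 - k) = pochhammer (a + of_nat k + 1) (n - k)"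
  using pochhammer_top[of k "n - 1" a] assms by (cases n) (simp_all add: add_ac)

lemma dual_hahn_coeff_pred:
  assumes "k \<le> n"
  shows "of_nat n * (u + of_nat n) * dual_hahn_coeff u w (n - 1) k
    = of_nat (n - k) * of_nat (n choose k) * pochhammer (u + of_nat k + 1) (n - k) * pochhammer (w + of_nat k + 1) (n - 1 - k)"
proof (cases "k = n")
  case True
  then show ?thesis by (cases n) (auto simp: dual_hahn_coeff_def)
next
  case False
  with assms have k: "k < n" by simp
  have "of_nat n * (u + of_nat n) * dual_hahn_coeff u w (n - 1) k
    = (of_nat n * of_nat ((n - 1) choose k)) * ((u + of_nat n) * pochhammer (u + of_nat k + 1) (n - 1 - k))
      * pochhammer (w + of_nat k + 1) (n - 1 - k)"
    by (simp add: dual_hahn_coeff_def mult_ac)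
  then show ?thesis
    unfolding of_nat_binomial_pred[OF assms] pochhammer_pred[OF k] by simp
qed

text \<open>The functions \<open>hahn_A\<close> and \<open>hahn_B\<close> are the coefficients of the three-term recurrence below.\<close>

definition hahn_A :: "complex \<Rightarrow> complex \<Rightarrow> complex \<Rightarrow> complex" where
  "hahn_A u w N = N * (u + N) * (w + N) - (N - 1) * (u + N - 1) * (w + N - 1) - N * (N - 1)"

definition hahn_B :: "complex \<Rightarrow> complex \<Rightarrow> complex \<Rightarrow> complex" where
  "hahn_B u w N = - (N - 1) * (u + N - 1) * (w + N - 1) * (u + w + N - 1)"

text \<open>Comparison of coefficients in the Newton basis, on which multiplication by \<open>y\<close> acts by raising \<open>k\<close> by one and
  adding \<open>k (k + 1)\<close> times the same element. For \<open>n = 0\<close> the last term is zero, because \<open>hahn_B\<close> vanishes.\<close>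

lemma dual_hahn_recurrence:
  "dual_hahn u w (Suc n) y = (y + hahn_A u w (of_nat (Suc n))) * dual_hahn u w n y
    + hahn_B u w (of_nat (Suc n)) * dual_hahn u w (n - 1) y"
proof -
  define A B where "A m = hahn_A u w (of_nat m)" and "B m = hahn_B u w (of_nat m)" for m
  define T where "T n k = dual_hahn_coeff u w n k" for n k
  define Z where "Z k = (if k = 0 then 0 else T n (k - 1))" for k
  have T_last: "T n k = 0" if "n < k" for n k using that by (simp add: T_def dual_hahn_coeff_def)
  have coeff: "T (Suc n) k = (A (Suc n) + of_nat k * (of_nat k + 1)) * T n k + Z k + B (Suc n) * T (n - 1) k"
    if "k \<le> Suc n" for k
  proof (cases "k = Suc n")
    case True
    then show ?thesis
      by (simp add: Z_def T_last) (simp add: T_def dual_hahn_coeff_def)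
  next
    case False
    with that have k: "k \<le> n" by simp
    define X where "X = (of_nat (n choose k) :: complex)"
    define X' where "X' = (if k = 0 then 0 else of_nat (n choose (k - 1)) :: complex)"
    define p where "p = pochhammer (u + of_nat k + 1) (n - k) * pochhammer (w + of_nat k + 1) (n - k)"
    have T0: "T n k = X * p" by (simp add: T_def dual_hahn_coeff_def X_def p_def)
    have "of_nat (Suc n choose k) = X + X'"
      by (cases k) (simp_all add: X_def X'_def)
    then have T1: "T (Suc n) k = (X + X') * (u + of_nat n + 1) * (w + of_nat n + 1) * p"
      unfolding T_def dual_hahn_coeff_def pochhammer_top[OF k] p_def by simp
    have Zk: "Z k = X' * (u + of_nat k) * (w + of_nat k) * p"
      using k pochhammer_bottom[of k n] by (auto simp: Z_def X'_def T_def dual_hahn_coeff_def p_def)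
    have Bk: "B (Suc n) * T (n - 1) k = - (u + w + of_nat n) * of_nat (n - k) * X * p"
    proof (cases "k = n")
      case True
      then show ?thesis by (cases n) (simp_all add: T_last B_def hahn_B_def)
    next
      case False
      then obtain n' where n: "n = Suc n'" "k \<le> n'" using k by (cases n) auto
      have "B (Suc n) * T (n - 1) k = - (u + w + of_nat n) * (w + of_nat n) * (of_nat n * (u + of_nat n) * T (n - 1) k)"
        by (simp add: B_def hahn_B_def algebra_simps)
      also have "\<dots> = - (u + w + of_nat n) * of_nat (n - k) * X * (pochhammer (u + of_nat k + 1) (n - k)
          * ((w + of_nat n) * pochhammer (w + of_nat k + 1) (n - 1 - k)))"
        unfolding T_def dual_hahn_coeff_pred[OF k] X_def by (simp only: mult_ac)
      also have "(w + of_nat n) * pochhammer (w + of_nat k + 1) (n - 1 - k) = pochhammer (w + of_nat k + 1) (n - k)"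
        using pochhammer_top[OF n(2), of w] n(1) by (simp add: add_ac)
      finally show ?thesis by (simp add: p_def mult_ac)
    qed
    have XX': "of_nat k * X = (of_nat n - of_nat k + 1) * X'"
    proof (cases k)
      case (Suc k')
      have "Suc k' * (n choose Suc k') = (n - k') * (n choose k')"
        by (simp only: binomial_absorption binomial_absorb_comp)
      then have "(of_nat (Suc k') * of_nat (n choose Suc k') :: complex) = of_nat (n - k') * of_nat (n choose k')"
        by (metis of_nat_mult)
      then show ?thesis using k Suc by (simp add: X_def X'_def of_nat_diff)
    qed (simp add: X'_def)
    have nk: "of_nat (n - k) = (of_nat n - of_nat k :: complex)" using k by (simp add: of_nat_diff)
    define N K :: complex where "N = of_nat n" and "K = of_nat k"
    \<comment> \<open>The difference of \<open>(u + N + 1) (w + N + 1)\<close> and \<open>(u + K) (w + K)\<close> has the factor \<open>N - K + 1\<close>, which turns \<open>X\'\<close> into \<open>K X\<close>.\<close>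
    have "(X + X') * (u + N + 1) * (w + N + 1)
      = X * (u + N + 1) * (w + N + 1) + X' * (u + K) * (w + K) + ((N - K + 1) * X') * (u + w + N + 1 + K)"
      by algebra
    also have "\<dots> = X * (u + N + 1) * (w + N + 1) + X' * (u + K) * (w + K) + K * X * (u + w + N + 1 + K)"
      using XX' by (simp add: N_def K_def)
    also have "\<dots> = (((N + 1) * (u + N + 1) * (w + N + 1) - N * (u + N) * (w + N) - (N + 1) * N) + K * (K + 1)) * X
        + X' * (u + K) * (w + K) - (u + w + N) * (N - K) * X"
      by algebra
    finally have "(X + X') * (u + N + 1) * (w + N + 1) * p
      = ((((N + 1) * (u + N + 1) * (w + N + 1) - N * (u + N) * (w + N) - (N + 1) * N) + K * (K + 1)) * X
        + X' * (u + K) * (w + K) - (u + w + N) * (N - K) * X) * p"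
      by simp
    then show ?thesis
      unfolding T0 T1 Zk Bk nk A_def hahn_A_def N_def K_def by (simp add: algebra_simps)
  qed
  have ext: "dual_hahn u w n y = (\<Sum>k\<le>Suc n. T n k * newton_basis k y)"
    "dual_hahn u w (n - 1) y = (\<Sum>k\<le>Suc n. T (n - 1) k * newton_basis k y)"
    unfolding T_def by (rule dual_hahn_extend, simp)+
  have y: "y * dual_hahn u w n y = (\<Sum>k\<le>Suc n. (Z k + of_nat k * (of_nat k + 1) * T n k) * newton_basis k y)"
  proof -
    have "y * dual_hahn u w n y = (\<Sum>k\<le>n. T n k * newton_basis (Suc k) y) + (\<Sum>k\<le>n. of_nat k * (of_nat k + 1) * T n k * newton_basis k y)"
      unfolding dual_hahn_def sum_distrib_left sum.distrib[symmetric]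
      by (rule sum.cong) (simp_all add: T_def newton_basis_Suc algebra_simps)
    also have "(\<Sum>k\<le>n. T n k * newton_basis (Suc k) y) = (\<Sum>k\<le>Suc n. Z k * newton_basis k y)"
      unfolding sum.atMost_Suc_shift by (simp add: Z_def)
    also have "(\<Sum>k\<le>n. of_nat k * (of_nat k + 1) * T n k * newton_basis k y)
        = (\<Sum>k\<le>Suc n. of_nat k * (of_nat k + 1) * T n k * newton_basis k y)"
      by (simp add: T_last)
    finally show ?thesis by (simp only: sum.distrib distrib_right)
  qed
  have "dual_hahn u w (Suc n) y = (\<Sum>k\<le>Suc n. T (Suc n) k * newton_basis k y)"
    by (simp add: dual_hahn_def T_def)
  also have "\<dots> = (\<Sum>k\<le>Suc n. (Z k + of_nat k * (of_nat k + 1) * T n k) * newton_basis k y)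
      + A (Suc n) * (\<Sum>k\<le>Suc n. T n k * newton_basis k y) + B (Suc n) * (\<Sum>k\<le>Suc n. T (n - 1) k * newton_basis k y)"
    unfolding sum_distrib_left sum.distrib[symmetric]
    by (rule sum.cong[OF refl]) (simp add: coeff algebra_simps)
  also have "\<dots> = y * dual_hahn u w n y + A (Suc n) * dual_hahn u w n y + B (Suc n) * dual_hahn u w (n - 1) y"
    by (simp only: y ext[symmetric])
  finally show ?thesis unfolding A_def B_def by (simp only: distrib_right)
qed

lemma pochhammer_reflect:
  assumes "k \<le> m"
  shows "pochhammer (- (a + of_nat m) :: complex) (m - k) = (-1) ^ (m - k) * pochhammer (a + of_nat k + 1) (m - k)"
  using pochhammer_minus[of "a + of_nat m" "m - k"] assms by (simp add: of_nat_diff)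

lemma pochhammer_reflect_mult:
  assumes "k \<le> m"
  shows "pochhammer (- (a + of_nat m) :: complex) (m - k) * pochhammer (- (c + of_nat m)) (m - k)
    = pochhammer (a + of_nat k + 1) (m - k) * pochhammer (c + of_nat k + 1) (m - k)"
proof -
  have "(-1) ^ (m - k) * (-1) ^ (m - k) = (1 :: complex)"
    by (simp flip: power_mult_distrib)
  moreover have "r * p * (r * q) = p * q" if "r * r = 1" for p q r :: complex
    using that by algebra
  ultimately show ?thesis
    unfolding pochhammer_reflect[OF assms] by blast
qed

lemma poly_s_minus: "poly (s_minus \<beta> lam m) y = dual_hahn (lam - \<beta>/2) (\<beta>/2 + 1) m y"
proof -
  have "pochhammer (\<beta>/2 - lam - of_nat m) (m - k) * pochhammer (- \<beta>/2 - of_nat m - 1) (m - k)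
    = pochhammer (lam - \<beta>/2 + of_nat k + 1) (m - k) * pochhammer (\<beta>/2 + 1 + of_nat k + 1) (m - k)" if "k \<le> m" for k
  proof -
    have "\<beta>/2 - lam - of_nat m = - (lam - \<beta>/2 + of_nat m)" "- \<beta>/2 - of_nat m - 1 = - (\<beta>/2 + 1 + of_nat m)"
      by simp_all
    then show ?thesis
      by (simp only: pochhammer_reflect_mult[OF that])
  qed
  then show ?thesis
    by (auto simp: s_minus_def poly_sum dual_hahn_def dual_hahn_coeff_def poly_R_poly_0 mult.assoc intro!: sum.cong)
qed

lemma poly_s_plus: "poly (s_plus \<beta> lam m) y = dual_hahn (lam - \<beta>/2) (\<beta>/2 - 1) m y"
proof -
  have "pochhammer (\<beta>/2 - lam - of_nat m) (m - k) * pochhammer (- \<beta>/2 - of_nat m + 1) (m - k)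
    = pochhammer (lam - \<beta>/2 + of_nat k + 1) (m - k) * pochhammer (\<beta>/2 - 1 + of_nat k + 1) (m - k)" if "k \<le> m" for k
  proof -
    have "\<beta>/2 - lam - of_nat m = - (lam - \<beta>/2 + of_nat m)" "- \<beta>/2 - of_nat m + 1 = - (\<beta>/2 - 1 + of_nat m)"
      by simp_all
    then show ?thesis
      by (simp only: pochhammer_reflect_mult[OF that])
  qed
  then show ?thesis
    by (auto simp: s_plus_def poly_sum dual_hahn_def dual_hahn_coeff_def poly_R_poly_0 mult.assoc intro!: sum.cong)
qed

text \<open>The polynomial \<open>s\<^sup>(\<^sup>1\<^sup>)\<close> with \<open>R\<^sub>k\<close> in place of \<open>R\<^sup>(\<^sup>1\<^sup>)\<^sub>k\<close>; the two differ by the value at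
  \<open>\<beta>/2 (\<beta>/2 + 1)\<close>.\<close>

definition sigma_one :: "complex \<Rightarrow> complex \<Rightarrow> nat \<Rightarrow> complex \<Rightarrow> complex" where
  "sigma_one \<beta> lam m y = (\<Sum>k\<le>m. of_nat (m choose k) * s_one_coeff \<beta> lam m k * newton_basis k y)"

lemma poly_s_one: "poly (s_one \<beta> lam m) y = sigma_one \<beta> lam m y - sigma_one \<beta> lam m (\<beta>/2 * (\<beta>/2 + 1))"
  unfolding s_one_def sigma_one_def poly_sum sum_subtractf[symmetric]
  by (rule sum.cong) (simp_all add: poly_R1_poly algebra_simps)

text \<open>Here the \<open>d \<delta>\<close>-part of \<open>\<omega>\<^sup>+\<close> is expressed through \<open>\<omega>\<^sup>-\<close>. Comparing the coefficients of the Newton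
  basis, all Pochhammer symbols reduce to the one of lowest order, and a polynomial identity in \<open>k\<close> remains.\<close>

lemma sigma_one_eq_dual_hahn:
  fixes \<beta> lam :: complex
  defines "b \<equiv> \<beta>/2" and "s \<equiv> dual_hahn (lam - \<beta>/2) (\<beta>/2 + 1)"
  shows "sigma_one \<beta> lam m y = (lam - 2 * b + 2 * of_nat m) * s m y
    - 2 * (lam + 2 * of_nat m) * of_nat m * (lam - b + of_nat m) * s (m - 1) y
    + (lam + 2 * b + 2 * of_nat m) * of_nat m * (of_nat m - 1) * (lam - b + of_nat m) * (lam - b + of_nat m - 1) * s (m - 2) y"
proof -
  define u where "u = lam - b"
  define T where "T n k = dual_hahn_coeff u (b + 1) n k" for n k
  have ext: "s n y = (\<Sum>k\<le>m. T n k * newton_basis k y)" if "n \<le> m" for n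
    unfolding s_def T_def u_def b_def using dual_hahn_extend[OF that] by simp
  have "of_nat (m choose k) * s_one_coeff \<beta> lam m k = (lam - 2 * b + 2 * of_nat m) * T m k
    - 2 * (lam + 2 * of_nat m) * (of_nat m * (u + of_nat m) * T (m - 1) k)
    + (lam + 2 * b + 2 * of_nat m) * (of_nat m * (of_nat m - 1) * (u + of_nat m) * (u + of_nat m - 1) * T (m - 2) k)"
    if k: "k \<le> m" for k
  proof -
    define pu where "pu = of_nat (m choose k) * pochhammer (u + of_nat k + 1) (m - k)"
    have T0: "T m k = pu * pochhammer (b + of_nat k + 2) (m - k)"
      by (simp add: T_def dual_hahn_coeff_def pu_def add_ac)
    have T1: "of_nat m * (u + of_nat m) * T (m - 1) k = of_nat (m - k) * pu * pochhammer (b + of_nat k + 2) (m - 1 - k)"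
      unfolding T_def dual_hahn_coeff_pred[OF k] by (simp add: pu_def add_ac)
    have T2: "of_nat m * (of_nat m - 1) * (u + of_nat m) * (u + of_nat m - 1) * T (m - 2) k
        = of_nat (m - k) * of_nat (m - 1 - k) * pu * pochhammer (b + of_nat k + 2) (m - 2 - k)"
    proof (cases "k = m")
      case True
      then show ?thesis by (cases m) (auto simp: T_def dual_hahn_coeff_def)
    next
      case False
      with k have k': "k < m" "k \<le> m - 1" by auto
      then have m: "(of_nat (m - 1) :: complex) = of_nat m - 1" by (simp add: of_nat_diff)
      have 1: "of_nat (m - 1) * (u + of_nat (m - 1)) * T (m - 2) k = of_nat (m - 1 - k) * of_nat ((m - 1) choose k)
         * pochhammer (u + of_nat k + 1) (m - 1 - k) * pochhammer (b + 1 + of_nat k + 1) (m - 2 - k)"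
        using dual_hahn_coeff_pred[OF k'(2), of u "b + 1"] by (simp add: T_def numeral_2_eq_2)
      have "of_nat m * (of_nat m - 1) * (u + of_nat m) * (u + of_nat m - 1) * T (m - 2) k
         = of_nat m * (u + of_nat m) * (of_nat (m - 1) * (u + of_nat (m - 1)) * T (m - 2) k)"
        unfolding m by (simp add: algebra_simps)
      also have "\<dots> = (of_nat m * of_nat ((m - 1) choose k)) * ((u + of_nat m) * pochhammer (u + of_nat k + 1) (m - 1 - k))
          * of_nat (m - 1 - k) * pochhammer (b + 1 + of_nat k + 1) (m - 2 - k)"
        unfolding 1 by (simp only: mult_ac)
      finally show ?thesis
        unfolding of_nat_binomial_pred[OF k] pochhammer_pred[OF k'(1)] by (simp add: pu_def mult_ac add_ac)
    qed
    have "of_nat (m choose k) * s_one_coeff \<beta> lam m k = pu * ((lam - 2 * b + 2 * of_nat m) * pochhammer (b + of_nat k + 2) (m - k)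
      - 2 * (lam + 2 * of_nat m) * of_nat (m - k) * pochhammer (b + of_nat k + 2) (m - 1 - k)
      + (lam + 2 * b + 2 * of_nat m) * of_nat (m - k) * of_nat (m - 1 - k) * pochhammer (b + of_nat k + 2) (m - 2 - k))"
    proof -
      consider "k = m" | "m = Suc k" | e where "m = Suc (Suc (k + e))"
        using k by (metis add_Suc_right le_neq_implies_less less_iff_Suc_add add.right_neutral not0_implies_Suc)
      then show ?thesis
      proof cases
        case 1
        then show ?thesis by (simp add: pu_def s_one_coeff_def b_def)
      next
        case 2
        then have c: "of_nat (m choose k) * s_one_coeff \<beta> lam m k
          = pu * (of_nat k * (lam + 2 * b + 2 * of_nat m) + b * (lam - 2 * b - 2 * of_nat m))"
          by (simp add: pu_def s_one_coeff_def b_def u_def)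
        have d: "m - k = 1" "m - 1 - k = 0" "m - 2 - k = 0" using 2 by auto
        have r: "of_nat m = of_nat k + (1 :: complex)" using 2 by simp
        show ?thesis
          unfolding c d r pochhammer_0 pochhammer_1 of_nat_0 of_nat_1 by algebra
      next
        case 3
        define q where "q = pochhammer (b + of_nat k + 2) e"
        have q1: "pochhammer (b + of_nat k + 2) (Suc e) = (b + of_nat k + 2 + of_nat e) * q"
          by (simp add: q_def pochhammer_Suc mult_ac)
        have q2: "pochhammer (b + of_nat k + 2) (Suc (Suc e)) = (b + of_nat k + 3 + of_nat e) * ((b + of_nat k + 2 + of_nat e) * q)"
          unfolding q1[symmetric] pochhammer_Suc[of _ "Suc e"] by (simp add: algebra_simps)
        have q3: "pochhammer (b + of_nat k + 1) (Suc e) = (b + of_nat k + 1) * q"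
          using pochhammer_rec[of "b + of_nat k + 1" e] by (simp add: q_def add_ac)
        have c: "of_nat (m choose k) * s_one_coeff \<beta> lam m k
          = pu * (((b + of_nat k + 1) * q) * (of_nat k * (lam + 2 * b + 2 * of_nat m) + b * (lam - 2 * b - 2 * of_nat m)))"
        proof -
          have "s_one_coeff \<beta> lam m k = pochhammer (u + of_nat k + 1) (m - k) * pochhammer (b + of_nat k + 1) (m - k - 1)
            * (of_nat k * (lam + 2 * b + 2 * of_nat m) + b * (lam - 2 * b - 2 * of_nat m))"
            using 3 by (simp add: s_one_coeff_def u_def b_def)
          moreover have "m - k - 1 = Suc e" using 3 by auto
          ultimately show ?thesis unfolding q3[symmetric] pu_def by (simp only: mult_ac)
        qed
        have d: "m - k = Suc (Suc e)" "m - 1 - k = Suc e" "m - 2 - k = e" using 3 by auto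
        have r: "of_nat m = of_nat k + of_nat e + (2 :: complex)" using 3 by simp
        have r': "of_nat (Suc (Suc e)) = of_nat e + (2 :: complex)" "of_nat (Suc e) = of_nat e + (1 :: complex)" by simp_all
        show ?thesis
          unfolding c d q2 q1 q_def[symmetric] r r' by algebra
      qed
    qed
    then show ?thesis
      unfolding T0 T1 T2 by (simp add: algebra_simps)
  qed
  then have "sigma_one \<beta> lam m y = (\<Sum>k\<le>m. ((lam - 2 * b + 2 * of_nat m) * T m k
    - 2 * (lam + 2 * of_nat m) * (of_nat m * (u + of_nat m) * T (m - 1) k)
    + (lam + 2 * b + 2 * of_nat m) * (of_nat m * (of_nat m - 1) * (u + of_nat m) * (u + of_nat m - 1) * T (m - 2) k))
      * newton_basis k y)"
    unfolding sigma_one_def by (intro sum.cong refl) simp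
  also have "\<dots> = (lam - 2 * b + 2 * of_nat m) * s m y
    - 2 * (lam + 2 * of_nat m) * of_nat m * (u + of_nat m) * s (m - 1) y
    + (lam + 2 * b + 2 * of_nat m) * of_nat m * (of_nat m - 1) * (u + of_nat m) * (u + of_nat m - 1) * s (m - 2) y"
    unfolding ext[of m, OF order_refl] ext[of "m - 1", OF diff_le_self] ext[of "m - 2", OF diff_le_self]
      sum_distrib_left sum.distrib[symmetric] sum_subtractf[symmetric]
    by (rule sum.cong) (simp_all add: algebra_simps)
  finally show ?thesis by (simp add: u_def)
qed


lemma recurrence_coeffs_even:
  fixes \<beta> lam :: complex and n :: nat
  defines "b \<equiv> \<beta>/2" and "N \<equiv> of_nat n"
  shows "a_coeff \<beta> lam (2 * int n) = 4 * N * (lam - b + N)"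
    and "a_coeff \<beta> lam (2 * int n - 2) = 4 * (N - 1) * (lam - b + N - 1)"
    and "a_coeff \<beta> lam (2 * int n - 4) = 4 * (N - 2) * (lam - b + N - 2)"
    and "b_coeff \<beta> lam (2 * int n + 2) = 4 * (N * (lam + 2 * N) + lam * (b + N))"
    and "c_coeff \<beta> lam (2 * int n + 2) = - 4 * (lam + N - 1) * (b + N - 1)"
    and "A_coeff \<beta> lam (2 * int n + 2) = - (4 * N * (b - lam - N) + 2 * (2 * b - lam - 2 * N))"
    and "B_coeff \<beta> lam (2 * int n + 2) = - 3 * (4 * (N - 1) * (b - lam - N + 1) + 2 * (2 * b - lam - 2 * N + 2))
      + 4 * (b + 1) * (lam + 2 * N + 2)"
    and "C_coeff \<beta> lam (2 * int n + 2) = 3 * (4 * (N - 2) * (b - lam - N + 2) + 2 * (2 * b - lam - 2 * N + 4))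
      - 8 * (b + 1) * (lam + 2 * N - 1)"
    and "D_coeff \<beta> lam (2 * int n + 2) = - (4 * (N - 3) * (b - lam - N + 3) + 2 * (2 * b - lam - 2 * N + 6))
      + 4 * (b + 1) * (lam + 2 * N - 4)"
  unfolding a_coeff_def b_coeff_def c_coeff_def A_coeff_def B_coeff_def C_coeff_def D_coeff_def Let_def b_def N_def
  by (simp_all add: field_simps)

text \<open>The three-term recurrence at the indices \<open>n + 1\<close>, \<open>n\<close> and \<open>n - 1\<close>. The factors \<open>N\<close> and \<open>N (N - 1)\<close> make the last two
  relations true also for \<open>n = 0\<close> and \<open>n = 1\<close>, where an index would be negative.\<close>

lemma dual_hahn_relations:
  fixes n :: nat and u w y :: complex
  assumes s_def: "\<And>k. s k = dual_hahn u w k y"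
  defines "N \<equiv> of_nat n"
  shows "s (Suc n) = (y + hahn_A u w (N + 1)) * s n + hahn_B u w (N + 1) * s (n - 1)"
    and "N * (s n - (y + hahn_A u w N) * s (n - 1) - hahn_B u w N * s (n - 2)) = 0"
    and "N * (N - 1) * (s (n - 1) - (y + hahn_A u w (N - 1)) * s (n - 2) - hahn_B u w (N - 1) * s (n - 3)) = 0"
proof -
  show "s (Suc n) = (y + hahn_A u w (N + 1)) * s n + hahn_B u w (N + 1) * s (n - 1)"
    unfolding s_def N_def using dual_hahn_recurrence[of u w n y] by (simp add: add_ac)
  show "N * (s n - (y + hahn_A u w N) * s (n - 1) - hahn_B u w N * s (n - 2)) = 0"
  proof (cases n)
    case (Suc k)
    then show ?thesis
      unfolding s_def N_def using dual_hahn_recurrence[of u w k y] by (simp add: numeral_2_eq_2)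
  qed (simp add: N_def)
  show "N * (N - 1) * (s (n - 1) - (y + hahn_A u w (N - 1)) * s (n - 2) - hahn_B u w (N - 1) * s (n - 3)) = 0"
  proof -
    consider "n = 0" | "n = 1" | k where "n = Suc (Suc k)"
      by (metis One_nat_def not0_implies_Suc)
    then show ?thesis
    proof cases
      case 3
      have "N - 1 = of_nat (Suc k)" using 3 by (simp add: N_def)
      moreover have "n - 1 = Suc k" "n - 2 = k" "n - 3 = k - 1" using 3 by auto
      ultimately show ?thesis
        unfolding s_def using dual_hahn_recurrence[of u w k y] by (simp only:) simp
    qed (simp_all add: N_def)
  qed
qed

context
  fixes \<beta> lam b u :: complex
  defines "b \<equiv> \<beta>/2" and "u \<equiv> lam - \<beta>/2"
begin

lemma sigma_one_relations:
  fixes n :: nat and y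
  assumes s_def: "\<And>k. s k = dual_hahn u (b + 1) k y" and \<sigma>_def: "\<And>k. \<sigma> k = sigma_one \<beta> lam k y"
  defines "N \<equiv> of_nat n"
  shows "\<sigma> (Suc n) = (lam - 2 * b + 2 * (N + 1)) * s (Suc n) - 2 * (lam + 2 * (N + 1)) * (N + 1) * (u + N + 1) * s n
      + (lam + 2 * b + 2 * (N + 1)) * (N + 1) * N * (u + N + 1) * (u + N) * s (n - 1)"
    and "\<sigma> n = (lam - 2 * b + 2 * N) * s n - 2 * (lam + 2 * N) * N * (u + N) * s (n - 1)
      + (lam + 2 * b + 2 * N) * N * (N - 1) * (u + N) * (u + N - 1) * s (n - 2)"
    and "N * \<sigma> (n - 1) = N * ((lam - 2 * b + 2 * (N - 1)) * s (n - 1) - 2 * (lam + 2 * (N - 1)) * (N - 1) * (u + N - 1) * s (n - 2)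
      + (lam + 2 * b + 2 * (N - 1)) * (N - 1) * (N - 2) * (u + N - 1) * (u + N - 2) * s (n - 3))"
proof -
  have main: "\<sigma> k = (lam - 2 * b + 2 * of_nat k) * s k - 2 * (lam + 2 * of_nat k) * of_nat k * (u + of_nat k) * s (k - 1)
      + (lam + 2 * b + 2 * of_nat k) * of_nat k * (of_nat k - 1) * (u + of_nat k) * (u + of_nat k - 1) * s (k - 2)" for k
    unfolding s_def \<sigma>_def b_def u_def by (rule sigma_one_eq_dual_hahn)
  show "\<sigma> n = (lam - 2 * b + 2 * N) * s n - 2 * (lam + 2 * N) * N * (u + N) * s (n - 1)
      + (lam + 2 * b + 2 * N) * N * (N - 1) * (u + N) * (u + N - 1) * s (n - 2)"
    unfolding N_def by (rule main)
  have "of_nat (Suc n) = N + 1" "Suc n - 1 = n" "Suc n - 2 = n - 1" by (simp_all add: N_def)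
  from main[of "Suc n", unfolded this]
  show "\<sigma> (Suc n) = (lam - 2 * b + 2 * (N + 1)) * s (Suc n) - 2 * (lam + 2 * (N + 1)) * (N + 1) * (u + N + 1) * s n
      + (lam + 2 * b + 2 * (N + 1)) * (N + 1) * N * (u + N + 1) * (u + N) * s (n - 1)"
    by (simp add: add.assoc)
  show "N * \<sigma> (n - 1) = N * ((lam - 2 * b + 2 * (N - 1)) * s (n - 1) - 2 * (lam + 2 * (N - 1)) * (N - 1) * (u + N - 1) * s (n - 2)
      + (lam + 2 * b + 2 * (N - 1)) * (N - 1) * (N - 2) * (u + N - 1) * (u + N - 2) * s (n - 3))"
  proof (cases n)
    case (Suc k)
    then have "of_nat (n - 1) = N - 1" "n - 1 - 1 = n - 2" "n - 1 - 2 = n - 3" by (simp_all add: N_def)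
    note eq = main[of "n - 1", unfolded this]
    show ?thesis
      unfolding eq by algebra
  qed (simp add: N_def)
qed

text \<open>The recurrence (R+) for \<open>v = 0\<close> and \<open>u = x\<close>, multiplied by the common denominator.\<close>

lemma dual_hahn_plus_recurrence:
  fixes n :: nat and x
  defines "s \<equiv> \<lambda>k. dual_hahn u (b - 1) k (x + b * (b - 1))"
  shows "s (Suc n) = (b_coeff \<beta> lam (2 * int n + 2) / 4 + x) * s n
    + a_coeff \<beta> lam (2 * int n) * c_coeff \<beta> lam (2 * int n + 2) / 16 * s (n - 1)"
proof -
  define N :: complex where "N = of_nat n"
  have lam: "lam = u + b" by (simp add: u_def b_def)
  have "s (Suc n) = (x + b * (b - 1) + hahn_A u (b - 1) (N + 1)) * s n + hahn_B u (b - 1) (N + 1) * s (n - 1)"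
    unfolding N_def by (rule dual_hahn_relations(1)) (simp add: s_def)
  also have "x + b * (b - 1) + hahn_A u (b - 1) (N + 1) = (N * (lam + 2 * N) + lam * (b + N)) + x"
    unfolding lam hahn_A_def hahn_B_def by algebra
  also have "hahn_B u (b - 1) (N + 1) = - N * (u + N) * (lam + N - 1) * (b + N - 1)"
    unfolding lam hahn_A_def hahn_B_def by algebra
  finally have *: "s (Suc n) = (N * (lam + 2 * N) + lam * (b + N) + x) * s n
    - N * (u + N) * (lam + N - 1) * (b + N - 1) * s (n - 1)" by simp
  have "b_coeff \<beta> lam (2 * int n + 2) / 4 = N * (lam + 2 * N) + lam * (b + N)"
    unfolding recurrence_coeffs_even N_def b_def by simp
  moreover have "a_coeff \<beta> lam (2 * int n) * c_coeff \<beta> lam (2 * int n + 2) / 16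
      = - (N * (u + N) * (lam + N - 1) * (b + N - 1))"
  proof -
    have a: "a_coeff \<beta> lam (2 * int n) = 4 * N * (u + N)"
      unfolding recurrence_coeffs_even N_def u_def by simp
    have c: "c_coeff \<beta> lam (2 * int n + 2) = - 4 * (lam + N - 1) * (b + N - 1)"
      unfolding recurrence_coeffs_even N_def b_def by simp
    have eq: "4 * N * (u + N) * (- 4 * (lam + N - 1) * (b + N - 1)) = 16 * (- (N * (u + N) * (lam + N - 1) * (b + N - 1)))"
      by algebra
    show ?thesis
      unfolding a c eq by simp
  qed
  ultimately show ?thesis
    unfolding * by simp
qed

text \<open>The recurrence (R+) for \<open>u = 0\<close> and \<open>v = x\<close>, multiplied by the common denominator.\<close>

lemma sigma_one_recurrence:
  fixes n :: nat and x
  defines "\<sigma> \<equiv> \<lambda>k. sigma_one \<beta> lam k (x + b * (b + 1))"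
    and "s \<equiv> \<lambda>k. dual_hahn u (b + 1) k (x + b * (b + 1))"
  shows "\<sigma> (Suc n) = (b_coeff \<beta> lam (2 * int n + 2) / 4 + x) * \<sigma> n
    + a_coeff \<beta> lam (2 * int n) * c_coeff \<beta> lam (2 * int n + 2) / 16 * \<sigma> (n - 1)
    + 2 * x * s n - a_coeff \<beta> lam (2 * int n) * a_coeff \<beta> lam (2 * int n - 2) / 8 * x * s (n - 2)"
proof -
  define N :: complex where "N = of_nat n"
  have lam: "lam = u + b" by (simp add: u_def b_def)
  let ?y = "x + b * (b + 1)"
  have s: "s k = dual_hahn u (b + 1) k ?y" and \<sigma>: "\<sigma> k = sigma_one \<beta> lam k ?y" for k
    by (simp_all add: s_def \<sigma>_def)
  note rel = dual_hahn_relations[where n = n, OF s, folded N_def]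
  note sig = sigma_one_relations[where n = n, OF s \<sigma>, folded N_def]
  define g where "g = - (u + N) * (lam + N - 1) * (b + N - 1)"
  define S1 S0 Sm Sn Sk where S: "S1 = s (Suc n)" "S0 = s n" "Sm = s (n - 1)" "Sn = s (n - 2)" "Sk = s (n - 3)"
  define E1 where "E1 = S1 - (?y + hahn_A u (b + 1) (N + 1)) * S0 - hahn_B u (b + 1) (N + 1) * Sm"
  define E0 where "E0 = S0 - (?y + hahn_A u (b + 1) N) * Sm - hahn_B u (b + 1) N * Sn"
  define Em where "Em = Sm - (?y + hahn_A u (b + 1) (N - 1)) * Sn - hahn_B u (b + 1) (N - 1) * Sk"
  have E: "E1 = 0" "N * E0 = 0" "N * (N - 1) * Em = 0"
    unfolding E1_def E0_def Em_def S using rel by simp_all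
  \<comment> \<open>The multipliers are found by comparing first the coefficients of \<open>S1\<close> and then the powers of \<open>x\<close>.\<close>
  have "\<sigma> (Suc n) - ((N * (lam + 2 * N) + lam * (b + N)) + x) * \<sigma> n - g * (N * \<sigma> (n - 1)) - 2 * x * S0
      + 2 * N * (u + N) * (N - 1) * (u + N - 1) * x * Sn
    = (lam - 2 * b + 2 * (N + 1)) * E1 - 2 * (lam + 2 * N) * (u + N) * (N * E0)
      + (u + N) * (u + N - 1) * (lam + 2 * b + 2 * N - 2) * (N * (N - 1) * Em)"
    unfolding sig S[symmetric] E1_def E0_def Em_def g_def hahn_A_def hahn_B_def lam by algebra
  then have "\<sigma> (Suc n) = ((N * (lam + 2 * N) + lam * (b + N)) + x) * \<sigma> n + g * (N * \<sigma> (n - 1)) + 2 * x * S0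
      - 2 * N * (u + N) * (N - 1) * (u + N - 1) * x * Sn"
    unfolding E by (simp add: algebra_simps)
  then have *: "\<sigma> (Suc n) = (N * (lam + 2 * N) + lam * (b + N) + x) * \<sigma> n + g * N * \<sigma> (n - 1) + 2 * x * s n
      - 2 * (N * (u + N) * (N - 1) * (u + N - 1)) * x * s (n - 2)"
    unfolding S by simp
  have "b_coeff \<beta> lam (2 * int n + 2) / 4 = N * (lam + 2 * N) + lam * (b + N)"
    unfolding recurrence_coeffs_even N_def b_def by simp
  moreover have "a_coeff \<beta> lam (2 * int n) * c_coeff \<beta> lam (2 * int n + 2) / 16 = g * N"
  proof -
    have a: "a_coeff \<beta> lam (2 * int n) = 4 * N * (u + N)"
      unfolding recurrence_coeffs_even N_def u_def by simp
    have c: "c_coeff \<beta> lam (2 * int n + 2) = - 4 * (lam + N - 1) * (b + N - 1)"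
      unfolding recurrence_coeffs_even N_def b_def by simp
    have eq: "4 * N * (u + N) * (- 4 * (lam + N - 1) * (b + N - 1)) = 16 * (g * N)"
      unfolding g_def by algebra
    show ?thesis
      unfolding a c eq by simp
  qed
  moreover have "a_coeff \<beta> lam (2 * int n) * a_coeff \<beta> lam (2 * int n - 2) / 8 = 2 * (N * (u + N) * (N - 1) * (u + N - 1))"
  proof -
    have a: "a_coeff \<beta> lam (2 * int n) = 4 * N * (u + N)"
      unfolding recurrence_coeffs_even N_def u_def by simp
    have a': "a_coeff \<beta> lam (2 * int n - 2) = 4 * (N - 1) * (u + N - 1)"
      unfolding recurrence_coeffs_even N_def u_def by simp
    have eq: "4 * N * (u + N) * (4 * (N - 1) * (u + N - 1)) = 16 * (N * (u + N) * (N - 1) * (u + N - 1))"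
      by algebra
    show ?thesis
      unfolding a a' eq by simp
  qed
  ultimately show ?thesis
    unfolding * by simp
qed

text \<open>The recurrence (R-), multiplied by the common denominator.\<close>

lemma sigma_one_minus_relation:
  fixes n :: nat and x
  defines "\<sigma> \<equiv> \<lambda>k. sigma_one \<beta> lam k (x + b * (b + 1))"
    and "s \<equiv> \<lambda>k. dual_hahn u (b + 1) k (x + b * (b + 1))"
  shows "A_coeff \<beta> lam (2 * int n + 2) * s n
    = (B_coeff \<beta> lam (2 * int n + 2) / 4 + x) * a_coeff \<beta> lam (2 * int n) * s (n - 1)
    + (C_coeff \<beta> lam (2 * int n + 2) / 16 - x / 4) * a_coeff \<beta> lam (2 * int n) * a_coeff \<beta> lam (2 * int n - 2) * s (n - 2)
    + D_coeff \<beta> lam (2 * int n + 2) / 64 * a_coeff \<beta> lam (2 * int n) * a_coeff \<beta> lam (2 * int n - 2)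
        * a_coeff \<beta> lam (2 * int n - 4) * s (n - 3)
    + 2 * \<sigma> n + a_coeff \<beta> lam (2 * int n) / 2 * \<sigma> (n - 1)"
proof -
  define N :: complex where "N = of_nat n"
  have lam: "lam = u + b" by (simp add: u_def b_def)
  let ?y = "x + b * (b + 1)"
  have s: "s k = dual_hahn u (b + 1) k ?y" and \<sigma>: "\<sigma> k = sigma_one \<beta> lam k ?y" for k
    by (simp_all add: s_def \<sigma>_def)
  note rel = dual_hahn_relations[where n = n, OF s, folded N_def]
  note sig = sigma_one_relations[where n = n, OF s \<sigma>, folded N_def]
  define S0 Sm Sn Sk where S: "S0 = s n" "Sm = s (n - 1)" "Sn = s (n - 2)" "Sk = s (n - 3)"
  define E0 where "E0 = S0 - (?y + hahn_A u (b + 1) N) * Sm - hahn_B u (b + 1) N * Sn"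
  define Em where "Em = Sm - (?y + hahn_A u (b + 1) (N - 1)) * Sn - hahn_B u (b + 1) (N - 1) * Sk"
  have E: "N * E0 = 0" "N * (N - 1) * Em = 0"
    unfolding E0_def Em_def S using rel by simp_all
  define r1 r2 r3 where "r1 = N * (u + N)" and "r2 = (N - 1) * (u + N - 1)" and "r3 = (N - 2) * (u + N - 2)"
  define A B C D where "A = A_coeff \<beta> lam (2 * int n + 2)" and "B = B_coeff \<beta> lam (2 * int n + 2)"
    and "C = C_coeff \<beta> lam (2 * int n + 2)" and "D = D_coeff \<beta> lam (2 * int n + 2)"
  note coeffs = recurrence_coeffs_even(6-9)[where \<beta> = \<beta> and lam = lam and n = n,
      folded A_def B_def C_def D_def N_def b_def]
  \<comment> \<open>The multipliers are found by comparing the terms that contain \<open>x\<close>.\<close>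
  have "A * S0 - (B + 4 * x) * r1 * Sm - (C - 4 * x) * (r1 * r2) * Sn - D * (r1 * r2 * r3) * Sk
      - 2 * \<sigma> n - 2 * (u + N) * (N * \<sigma> (n - 1))
    = 4 * (u + N) * (N * E0) - 4 * (u + N) * (u + N - 1) * (N * (N - 1) * Em)"
    unfolding sig S[symmetric] coeffs r1_def r2_def r3_def E0_def Em_def hahn_A_def hahn_B_def lam by algebra
  then have "A * S0 - (B + 4 * x) * r1 * Sm - (C - 4 * x) * (r1 * r2) * Sn - D * (r1 * r2 * r3) * Sk
      - 2 * \<sigma> n - 2 * r1 * \<sigma> (n - 1) = 0"
    unfolding E r1_def by (simp add: mult_ac)
  then have *: "A * s n = (B + 4 * x) * r1 * s (n - 1) + (C - 4 * x) * (r1 * r2) * s (n - 2) + D * (r1 * r2 * r3) * s (n - 3)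
      + 2 * \<sigma> n + 2 * r1 * \<sigma> (n - 1)"
    unfolding S by (simp add: algebra_simps)
  have a: "a_coeff \<beta> lam (2 * int n) = 4 * r1" "a_coeff \<beta> lam (2 * int n - 2) = 4 * r2"
    "a_coeff \<beta> lam (2 * int n - 4) = 4 * r3"
    unfolding recurrence_coeffs_even N_def u_def r1_def r2_def r3_def by simp_all
  show ?thesis
    unfolding a A_def[symmetric] B_def[symmetric] C_def[symmetric] D_def[symmetric] *
    by (simp add: field_simps)
qed

text \<open>The cases \<open>u = 0\<close> and \<open>v = 0\<close> of (R+) coincide for \<open>x = 0\<close>, so both sides satisfy the same recurrence with
  the same initial value.\<close>

lemma dual_hahn_plus_eq_sigma_one:
  "(lam - \<beta>) * dual_hahn u (b - 1) n (b * (b - 1)) = sigma_one \<beta> lam n (b * (b + 1))"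
proof (induction n rule: less_induct)
  case (less n)
  show ?case
  proof (cases n)
    case 0
    then show ?thesis
      by (simp add: dual_hahn_def dual_hahn_coeff_def sigma_one_def s_one_coeff_def newton_basis_0)
  next
    case (Suc k)
    have "sigma_one \<beta> lam k (b * (b + 1)) = (lam - \<beta>) * dual_hahn u (b - 1) k (b * (b - 1))"
      "sigma_one \<beta> lam (k - 1) (b * (b + 1)) = (lam - \<beta>) * dual_hahn u (b - 1) (k - 1) (b * (b - 1))"
      using less.IH[of k] less.IH[of "k - 1"] Suc by simp_all
    note IH = this
    have "dual_hahn u (b - 1) (Suc k) (b * (b - 1)) = b_coeff \<beta> lam (2 * int k + 2) / 4 * dual_hahn u (b - 1) k (b * (b - 1))
      + a_coeff \<beta> lam (2 * int k) * c_coeff \<beta> lam (2 * int k + 2) / 16 * dual_hahn u (b - 1) (k - 1) (b * (b - 1))"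
      using dual_hahn_plus_recurrence[of k 0] by (simp only: add_0_left add_0_right)
    moreover have "sigma_one \<beta> lam (Suc k) (b * (b + 1)) = b_coeff \<beta> lam (2 * int k + 2) / 4 * sigma_one \<beta> lam k (b * (b + 1))
      + a_coeff \<beta> lam (2 * int k) * c_coeff \<beta> lam (2 * int k + 2) / 16 * sigma_one \<beta> lam (k - 1) (b * (b + 1))"
      using sigma_one_recurrence[of k 0] by (simp only: add_0_left add_0_right mult_zero_right mult_zero_left diff_zero)
    moreover have "l * (p * d + q * d') = p * (l * d) + q * (l * d')" for l p q d d' :: complex
      by algebra
    ultimately show ?thesis
      unfolding Suc by (simp only: IH)
  qed
qed

end

section \<open>Evaluation of homogenised polynomials at operators\<close>

lemma smul_apply: "smul a \<omega> c q I = a * \<omega> c q I"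
  by (simp add: smul_def)

lemma form_eqI: "(\<And>c q I. \<omega> c q I = \<eta> c q I) \<Longrightarrow> \<omega> = (\<eta> :: ('a, 'n) form)"
  by (intro ext)

lemma sum_form_apply: "(\<Sum>i\<in>S. f i) c q I = (\<Sum>i\<in>S. f i c q I :: complex)"
  by (induction S rule: infinite_finite_induct) simp_all

text \<open>Linearity is demanded on forms only, since \<open>\<delta>\<close> is arbitrary elsewhere.\<close>

definition form_operator ::
    "('a::topological_space, 'n::finite) chart set \<Rightarrow> int \<Rightarrow> int \<Rightarrow> (('a, 'n) form \<Rightarrow> ('a, 'n) form) \<Rightarrow> bool" where
  "form_operator A k l E \<longleftrightarrow> (\<forall>\<omega>\<in>forms A k. E \<omega> \<in> forms A l \<and> (\<forall>a. E (smul a \<omega>) = smul a (E \<omega>)) \<and>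
     (\<forall>\<eta>\<in>forms A k. E (\<omega> + \<eta>) = E \<omega> + E \<eta>))"

lemma form_operatorD:
  assumes "form_operator A k l E" "\<omega> \<in> forms A k"
  shows "E \<omega> \<in> forms A l" "E (smul a \<omega>) = smul a (E \<omega>)" "\<eta> \<in> forms A k \<Longrightarrow> E (\<omega> + \<eta>) = E \<omega> + E \<eta>"
  using assms unfolding form_operator_def by blast+

lemma form_operator_compose:
  assumes "form_operator A k l E" "form_operator A l m F"
  shows "form_operator A k m (F \<circ> E)"
  using assms unfolding form_operator_def by simp

lemma form_operator_0:
  assumes "form_operator A k l E"
  shows "E 0 = 0"
proof -
  have "E (smul 0 0) = smul 0 (E 0)"
    by (rule form_operatorD(2)[OF assms forms_0])
  then show ?thesis by (simp add: smul_def zero_fun_def)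
qed

lemma funpow_forms:
  assumes "form_operator A k k E" "\<omega> \<in> forms A k"
  shows "(E ^^ i) \<omega> \<in> forms A k"
  by (induction i) (simp_all add: assms(2) form_operatorD(1)[OF assms(1)])

lemma forms_sum:
  assumes "oriented_atlas A" "\<And>i. i \<in> S \<Longrightarrow> f i \<in> forms A k"
  shows "(\<Sum>i\<in>S. f i) \<in> forms A k"
  using assms(2) by (induction S rule: infinite_finite_induct) (simp_all add: forms_0 forms_add[OF assms(1)])

lemma form_operator_sum:
  assumes "oriented_atlas A" "form_operator A k l E" "\<And>i. i \<in> S \<Longrightarrow> f i \<in> forms A k"
  shows "E (\<Sum>i\<in>S. smul (a i) (f i)) = (\<Sum>i\<in>S. smul (a i) (E (f i)))"
  using assms(3)
proof (induction S rule: infinite_finite_induct)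
  case (insert i S)
  have "(\<Sum>i\<in>S. smul (a i) (f i)) \<in> forms A k"
    by (rule forms_sum[OF assms(1)]) (simp add: forms_smul[OF assms(1)] insert.prems)
  moreover have f: "f i \<in> forms A k" by (rule insert.prems) simp
  ultimately have "E (smul (a i) (f i) + (\<Sum>i\<in>S. smul (a i) (f i)))
      = smul (a i) (E (f i)) + E (\<Sum>i\<in>S. smul (a i) (f i))"
    by (simp only: form_operatorD(2,3)[OF assms(2)] forms_smul[OF assms(1)])
  moreover have "E (\<Sum>i\<in>S. smul (a i) (f i)) = (\<Sum>i\<in>S. smul (a i) (E (f i)))"
    by (rule insert.IH, rule insert.prems) simp
  ultimately show ?case
    by (simp only: sum.insert[OF insert.hyps])
qed (simp_all add: form_operator_0[OF assms(2)])

text \<open>The homogenisation \<open>\<epsilon>\<^sup>N p (x/\<epsilon>)\<close> of \<open>p\<close>, with the powers of \<open>\<epsilon>\<close> multiplied out, evaluated at the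
  operator \<open>E\<close>. For fixed \<open>N\<close> it is linear in \<open>p\<close>, and this transfers polynomial identities to operators for all \<open>\<epsilon>\<close>.\<close>

definition hom_eval :: "complex \<Rightarrow> nat \<Rightarrow> complex poly \<Rightarrow> (('a, 'n) form \<Rightarrow> ('a, 'n) form) \<Rightarrow> ('a, 'n) form \<Rightarrow> ('a, 'n) form" where
  "hom_eval \<epsilon> N p E \<omega> = (\<Sum>i\<le>N. smul (\<epsilon> ^ (N - i) * coeff p i) ((E ^^ i) \<omega>))"

lemma scaled_eval_eq_hom_eval: "scaled_eval \<epsilon> N s c E \<omega> = hom_eval \<epsilon> N (pcompose s [:c, 1:]) E \<omega>"
  by (simp add: scaled_eval_def hom_eval_def)

lemma hom_eval_add: "hom_eval \<epsilon> N (p + q) E \<omega> = hom_eval \<epsilon> N p E \<omega> + hom_eval \<epsilon> N q E \<omega>"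
  by (rule form_eqI) (simp add: hom_eval_def sum_form_apply smul_apply sum.distrib algebra_simps)

lemma hom_eval_diff: "hom_eval \<epsilon> N (p - q) E \<omega> = hom_eval \<epsilon> N p E \<omega> - hom_eval \<epsilon> N q E \<omega>"
  by (rule form_eqI) (simp add: hom_eval_def sum_form_apply smul_apply sum_subtractf algebra_simps)

lemma hom_eval_smult: "hom_eval \<epsilon> N (smult a p) E \<omega> = smul a (hom_eval \<epsilon> N p E \<omega>)"
  by (rule form_eqI) (simp add: hom_eval_def sum_form_apply smul_apply sum_distrib_left algebra_simps)

lemma hom_eval_const: "hom_eval \<epsilon> N [:a:] E \<omega> = smul (\<epsilon> ^ N * a) \<omega>"
  by (rule form_eqI) (simp add: hom_eval_def sum_form_apply smul_apply sum.atMost_shift)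

lemma hom_eval_Suc:
  assumes "degree p \<le> N"
  shows "hom_eval \<epsilon> (Suc N) p E \<omega> = smul \<epsilon> (hom_eval \<epsilon> N p E \<omega>)"
proof (rule form_eqI)
  fix c q I
  have "coeff p (Suc N) = 0" using assms by (simp add: coeff_eq_0)
  then show "hom_eval \<epsilon> (Suc N) p E \<omega> c q I = smul \<epsilon> (hom_eval \<epsilon> N p E \<omega>) c q I"
    by (simp add: hom_eval_def sum_form_apply smul_apply sum_distrib_left Suc_diff_le mult_ac)
qed

text \<open>Raising the formal degree by \<open>j\<close> produces the factor \<open>\<epsilon>\<^sup>j\<close>. The relation between the degrees is required
  only for \<open>a \<noteq> 0\<close>: in the recurrences at small indices the coefficient \<open>a\<close> vanishes where the natural number
  subtraction \<open>n - j\<close> is truncated.\<close>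

lemma hom_eval_shift:
  assumes "degree p \<le> N" "a \<noteq> 0 \<Longrightarrow> M = N + j"
  shows "hom_eval \<epsilon> M (smult a p) E \<omega> = smul (a * \<epsilon> ^ j) (hom_eval \<epsilon> N p E \<omega>)"
proof (cases "a = 0")
  case True
  then show ?thesis by (intro form_eqI) (simp add: hom_eval_def sum_form_apply smul_apply)
next
  case False
  have "hom_eval \<epsilon> (N + j) p E \<omega> = smul (\<epsilon> ^ j) (hom_eval \<epsilon> N p E \<omega>)"
  proof (induction j)
    case 0
    show ?case by (rule form_eqI) (simp add: smul_apply)
  next
    case (Suc j)
    have "degree p \<le> N + j" using assms(1) by simp
    from hom_eval_Suc[OF this, of \<epsilon> E \<omega>] Suc show ?case
      by (intro form_eqI) (simp add: smul_apply mult_ac)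
  qed
  then show ?thesis
    using assms(2)[OF False] by (intro form_eqI) (simp add: hom_eval_smult smul_apply)
qed

context
  fixes A :: "('a::topological_space, 'n::finite) chart set" and k l :: int and E \<omega>
  assumes A: "oriented_atlas A" and E: "form_operator A k k E" and \<omega>: "\<omega> \<in> forms A k"
begin

lemma hom_eval_forms: "hom_eval \<epsilon> N p E \<omega> \<in> forms A k"
  unfolding hom_eval_def by (intro forms_sum[OF A] forms_smul[OF A] funpow_forms[OF E \<omega>])

lemma hom_eval_pCons: "hom_eval \<epsilon> (Suc N) (pCons 0 p) E \<omega> = E (hom_eval \<epsilon> N p E \<omega>)"
  unfolding hom_eval_def form_operator_sum[OF A E funpow_forms[OF E \<omega>]]
  by (rule form_eqI, subst sum.atMost_Suc_shift) (simp add: smul_apply sum_form_apply)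

lemma hom_eval_shift_pCons:
  assumes "degree p \<le> N" "a \<noteq> 0 \<Longrightarrow> M = Suc N + j"
  shows "hom_eval \<epsilon> M (smult a (pCons 0 p)) E \<omega> = smul (a * \<epsilon> ^ j) (E (hom_eval \<epsilon> N p E \<omega>))"
proof -
  have "degree (pCons 0 p) \<le> Suc N" using assms(1) by (simp add: degree_pCons_eq_if)
  then show ?thesis
    unfolding hom_eval_pCons[symmetric] by (rule hom_eval_shift) (rule assms(2))
qed

text \<open>Used for \<open>\<delta> v = u \<delta>\<close>.\<close>

lemma hom_eval_intertwine:
  assumes "form_operator A k l F" "\<And>\<theta>. \<theta> \<in> forms A k \<Longrightarrow> F (E \<theta>) = G (F \<theta>)"
  shows "F (hom_eval \<epsilon> N p E \<omega>) = hom_eval \<epsilon> N p G (F \<omega>)"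
proof -
  have "F ((E ^^ i) \<omega>) = (G ^^ i) (F \<omega>)" for i
    by (induction i) (simp_all add: assms(2) funpow_forms[OF E \<omega>])
  then show ?thesis
    unfolding hom_eval_def form_operator_sum[OF A assms(1) funpow_forms[OF E \<omega>]] by simp
qed

text \<open>Used for \<open>\<delta> u = 0\<close> and \<open>d v = 0\<close>: only the constant coefficient survives.\<close>

lemma hom_eval_annihilate:
  assumes "form_operator A k l F" "\<And>\<theta>. \<theta> \<in> forms A k \<Longrightarrow> F (E \<theta>) = 0"
  shows "F (hom_eval \<epsilon> N p E \<omega>) = smul (\<epsilon> ^ N * coeff p 0) (F \<omega>)"
proof -
  have "F ((E ^^ Suc i) \<omega>) = 0" for i
    by (simp add: assms(2) funpow_forms[OF E \<omega>])
  then show ?thesis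
    unfolding hom_eval_def form_operator_sum[OF A assms(1) funpow_forms[OF E \<omega>]]
    by (intro form_eqI, subst sum.atMost_shift) (simp add: smul_apply sum_form_apply del: funpow.simps)
qed

end

section \<open>The polynomials in the variable of the operators\<close>

text \<open>The polynomials of the solution operators in the variable \<open>x = y - \<beta>/2 (\<beta>/2 - 1)\<close> or
  \<open>x = y - \<beta>/2 (\<beta>/2 + 1)\<close>, for which \<open>\<epsilon> x\<close> is replaced by \<open>\<delta> d\<close> or \<open>d \<delta>\<close>.\<close>

definition shifted_s_plus :: "complex \<Rightarrow> complex \<Rightarrow> nat \<Rightarrow> complex poly" where
  "shifted_s_plus \<beta> lam n = pcompose (s_plus \<beta> lam n) [:\<beta>/2 * (\<beta>/2 - 1), 1:]"

definition shifted_s_minus :: "complex \<Rightarrow> complex \<Rightarrow> nat \<Rightarrow> complex poly" where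
  "shifted_s_minus \<beta> lam n = pcompose (s_minus \<beta> lam n) [:\<beta>/2 * (\<beta>/2 + 1), 1:]"

definition shifted_s_one :: "complex \<Rightarrow> complex \<Rightarrow> nat \<Rightarrow> complex poly" where
  "shifted_s_one \<beta> lam n = pcompose (s_one \<beta> lam n) [:\<beta>/2 * (\<beta>/2 + 1), 1:]"

lemma degree_shifted:
  "degree (shifted_s_plus \<beta> lam n) \<le> n" "degree (shifted_s_minus \<beta> lam n) \<le> n" "degree (shifted_s_one \<beta> lam n) \<le> n"
  using degree_s_plus degree_s_minus degree_s_one
  by (simp_all add: shifted_s_plus_def shifted_s_minus_def shifted_s_one_def degree_pcompose)

lemma poly_shifted:
  "poly (shifted_s_plus \<beta> lam n) x = dual_hahn (lam - \<beta>/2) (\<beta>/2 - 1) n (x + \<beta>/2 * (\<beta>/2 - 1))"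
  "poly (shifted_s_minus \<beta> lam n) x = dual_hahn (lam - \<beta>/2) (\<beta>/2 + 1) n (x + \<beta>/2 * (\<beta>/2 + 1))"
  "poly (shifted_s_one \<beta> lam n) x = sigma_one \<beta> lam n (x + \<beta>/2 * (\<beta>/2 + 1)) - sigma_one \<beta> lam n (\<beta>/2 * (\<beta>/2 + 1))"
  by (simp_all add: shifted_s_plus_def shifted_s_minus_def shifted_s_one_def poly_pcompose
      poly_s_plus poly_s_minus poly_s_one add.commute)

lemma shifted_s_one_0: "coeff (shifted_s_one \<beta> lam n) 0 = 0"
  using poly_shifted(3)[of \<beta> lam n 0] by (simp add: poly_0_coeff_0)

lemma sigma_one_shifted:
  "sigma_one \<beta> lam n (x + \<beta>/2 * (\<beta>/2 + 1)) = poly (shifted_s_one \<beta> lam n) x + (lam - \<beta>) * coeff (shifted_s_plus \<beta> lam n) 0"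
  using poly_shifted(1)[of \<beta> lam n 0] dual_hahn_plus_eq_sigma_one[of lam \<beta> n]
  by (simp add: poly_shifted(3) poly_0_coeff_0)

lemma shifted_s_plus_recurrence:
  "shifted_s_plus \<beta> lam (Suc n) = smult (b_coeff \<beta> lam (2 * int n + 2) / 4) (shifted_s_plus \<beta> lam n)
    + pCons 0 (shifted_s_plus \<beta> lam n)
    + smult (a_coeff \<beta> lam (2 * int n) * c_coeff \<beta> lam (2 * int n + 2) / 16) (shifted_s_plus \<beta> lam (n - 1))"
proof (rule poly_ext)
  fix x
  show "poly (shifted_s_plus \<beta> lam (Suc n)) x = poly (smult (b_coeff \<beta> lam (2 * int n + 2) / 4) (shifted_s_plus \<beta> lam n)
    + pCons 0 (shifted_s_plus \<beta> lam n)
    + smult (a_coeff \<beta> lam (2 * int n) * c_coeff \<beta> lam (2 * int n + 2) / 16) (shifted_s_plus \<beta> lam (n - 1))) x"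
    using dual_hahn_plus_recurrence[where \<beta> = \<beta> and lam = lam and n = n and x = x]
    by (simp add: poly_shifted algebra_simps)
qed

lemma shifted_s_one_recurrence:
  "shifted_s_one \<beta> lam (Suc n) = smult (b_coeff \<beta> lam (2 * int n + 2) / 4) (shifted_s_one \<beta> lam n)
    + pCons 0 (shifted_s_one \<beta> lam n)
    + smult (a_coeff \<beta> lam (2 * int n) * c_coeff \<beta> lam (2 * int n + 2) / 16) (shifted_s_one \<beta> lam (n - 1))
    + pCons 0 [:(lam - \<beta>) * coeff (shifted_s_plus \<beta> lam n) 0:]
    + smult 2 (pCons 0 (shifted_s_minus \<beta> lam n))
    - smult (a_coeff \<beta> lam (2 * int n) * a_coeff \<beta> lam (2 * int n - 2) / 8) (pCons 0 (shifted_s_minus \<beta> lam (n - 2)))"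
  (is "_ = ?r")
proof (rule poly_ext)
  fix x
  define p q r where "p = b_coeff \<beta> lam (2 * int n + 2) / 4"
    and "q = a_coeff \<beta> lam (2 * int n) * c_coeff \<beta> lam (2 * int n + 2) / 16"
    and "r = a_coeff \<beta> lam (2 * int n) * a_coeff \<beta> lam (2 * int n - 2) / 8"
  note rec = sigma_one_recurrence[where \<beta> = \<beta> and lam = lam and n = n,
      unfolded sigma_one_shifted poly_shifted(2)[symmetric], folded p_def q_def r_def]
  have rec_0: "(lam - \<beta>) * coeff (shifted_s_plus \<beta> lam (Suc n)) 0
    = p * ((lam - \<beta>) * coeff (shifted_s_plus \<beta> lam n) 0) + q * ((lam - \<beta>) * coeff (shifted_s_plus \<beta> lam (n - 1)) 0)"
    using rec[of 0]
    by (simp only: poly_0_coeff_0 shifted_s_one_0 add_0_left add_0_right mult_zero_right mult_zero_left diff_zero)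
  have "poly ?r x = p * poly (shifted_s_one \<beta> lam n) x + x * poly (shifted_s_one \<beta> lam n) x
    + q * poly (shifted_s_one \<beta> lam (n - 1)) x + x * ((lam - \<beta>) * coeff (shifted_s_plus \<beta> lam n) 0)
    + 2 * x * poly (shifted_s_minus \<beta> lam n) x - r * x * poly (shifted_s_minus \<beta> lam (n - 2)) x"
    by (simp add: p_def q_def r_def)
  then show "poly (shifted_s_one \<beta> lam (Suc n)) x = poly ?r x"
    using rec[of x] rec_0 by algebra
qed

lemma shifted_s_minus_relation:
  "smult (A_coeff \<beta> lam (2 * int n + 2)) (shifted_s_minus \<beta> lam n)
    = smult (B_coeff \<beta> lam (2 * int n + 2) / 4 * a_coeff \<beta> lam (2 * int n)) (shifted_s_minus \<beta> lam (n - 1))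
    + smult (a_coeff \<beta> lam (2 * int n)) (pCons 0 (shifted_s_minus \<beta> lam (n - 1)))
    + smult (C_coeff \<beta> lam (2 * int n + 2) / 16 * a_coeff \<beta> lam (2 * int n) * a_coeff \<beta> lam (2 * int n - 2))
        (shifted_s_minus \<beta> lam (n - 2))
    - smult (a_coeff \<beta> lam (2 * int n) * a_coeff \<beta> lam (2 * int n - 2) / 4) (pCons 0 (shifted_s_minus \<beta> lam (n - 2)))
    + smult (D_coeff \<beta> lam (2 * int n + 2) / 64 * a_coeff \<beta> lam (2 * int n) * a_coeff \<beta> lam (2 * int n - 2)
        * a_coeff \<beta> lam (2 * int n - 4)) (shifted_s_minus \<beta> lam (n - 3))
    + smult 2 (shifted_s_one \<beta> lam n + [:(lam - \<beta>) * coeff (shifted_s_plus \<beta> lam n) 0:])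
    + smult (a_coeff \<beta> lam (2 * int n) / 2)
        (shifted_s_one \<beta> lam (n - 1) + [:(lam - \<beta>) * coeff (shifted_s_plus \<beta> lam (n - 1)) 0:])"
  (is "_ = ?r")
proof (rule poly_ext)
  fix x
  show "poly (smult (A_coeff \<beta> lam (2 * int n + 2)) (shifted_s_minus \<beta> lam n)) x = poly ?r x"
    using sigma_one_minus_relation[of \<beta> lam n x] unfolding sigma_one_shifted poly_shifted(2)[symmetric]
    by (simp add: algebra_simps)
qed

section \<open>The recurrences for forms\<close>

text \<open>The properties of \<open>\<delta>\<close> on which the recurrences depend.\<close>

locale codifferential_complex =
  fixes A :: "('a::topological_space, 'n::finite) chart set" and \<delta> :: "('a, 'n) form \<Rightarrow> ('a, 'n) form"
  assumes atlas: "oriented_atlas A"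
    and codiff: "\<And>k. form_operator A (k + 1) k \<delta>"
    and codiff_codiff: "\<And>k \<omega>. \<omega> \<in> forms A k \<Longrightarrow> \<delta> (\<delta> \<omega>) = 0"
begin

abbreviation "d \<equiv> ext_deriv A"

lemma codiff': "form_operator A k (k - 1) \<delta>"
  using codiff[of "k - 1"] by simp

lemma d_operator: "form_operator A k (k + 1) d"
  unfolding form_operator_def
  using ext_deriv_forms[OF atlas] ext_deriv_smul ext_deriv_add by blast

lemma d_operator': "form_operator A (k - 1) k d"
  using d_operator[of "k - 1"] by simp

lemma coclosed_operator: "form_operator A k k (\<delta> \<circ> d)"
  by (rule form_operator_compose[OF d_operator codiff])

lemma closed_operator: "form_operator A k k (d \<circ> \<delta>)"
  by (rule form_operator_compose[OF codiff' d_operator'])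

lemma zero_simps: "d 0 = 0" "\<delta> 0 = 0"
  by (rule form_operator_0[OF d_operator], rule form_operator_0[OF codiff])

lemma hodge_zero: "hodge_laplacian A \<delta> 0 = 0"
  by (simp add: hodge_laplacian_def zero_simps)

context
  fixes \<epsilon> \<beta> lam :: complex and k :: int and \<phi> :: "('a, 'n) form"
  assumes \<phi>: "\<phi> \<in> forms A k"
begin

abbreviation "\<omega>m \<equiv> omega_minus A \<delta> \<epsilon> \<beta> lam \<phi>"
abbreviation "\<omega>p \<equiv> omega_plus A \<delta> \<epsilon> \<beta> lam \<phi>"

text \<open>The parts of \<open>\<omega>\<^sup>+\<close> in \<open>u\<close> and in \<open>v\<close>, and \<open>\<omega>\<^sup>-\<close>, before division by \<open>(\<lambda> - \<beta>) a\<^sub>2 a\<^sub>4 \<dots>\<close>; the inverse of this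
  product is the \<open>normalizer\<close> below. In terms of these numerators the recurrences involve no division by \<open>a\<^sub>2\<^sub>i\<close>.\<close>

definition "coclosed_part n = hom_eval \<epsilon> n (shifted_s_plus \<beta> lam n) (\<delta> \<circ> d) \<phi>"
definition "closed_part n = hom_eval \<epsilon> n (shifted_s_one \<beta> lam n) (d \<circ> \<delta>) \<phi>"
definition "minus_numerator n = hom_eval \<epsilon> n (shifted_s_minus \<beta> lam n) (\<delta> \<circ> d) (\<delta> \<phi>)"
definition "plus_numerator n = smul (lam - \<beta>) (coclosed_part n) + closed_part n"
definition "plus_constant n = (lam - \<beta>) * coeff (shifted_s_plus \<beta> lam n) 0"

lemma codiff_\<phi>: "\<delta> \<phi> \<in> forms A (k - 1)"
  by (rule form_operatorD(1)[OF codiff' \<phi>])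

lemma numerator_forms: "coclosed_part n \<in> forms A k" "closed_part n \<in> forms A k" "minus_numerator n \<in> forms A (k - 1)" "plus_numerator n \<in> forms A k"
proof -
  show U: "coclosed_part n \<in> forms A k" and V: "closed_part n \<in> forms A k"
    unfolding coclosed_part_def closed_part_def by (rule hom_eval_forms[OF atlas coclosed_operator \<phi>], rule hom_eval_forms[OF atlas closed_operator \<phi>])
  show "minus_numerator n \<in> forms A (k - 1)"
    unfolding minus_numerator_def by (rule hom_eval_forms[OF atlas coclosed_operator codiff_\<phi>])
  show "plus_numerator n \<in> forms A k"
    unfolding plus_numerator_def by (intro forms_add[OF atlas] forms_smul[OF atlas] U V)
qed

lemma codiff_hom_eval_closed: "\<delta> (hom_eval \<epsilon> n p (d \<circ> \<delta>) \<phi>) = hom_eval \<epsilon> n p (\<delta> \<circ> d) (\<delta> \<phi>)"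
  by (rule hom_eval_intertwine[OF atlas closed_operator \<phi> codiff']) simp

lemma codiff_coclosed_part: "\<delta> (coclosed_part n) = smul (\<epsilon> ^ n * coeff (shifted_s_plus \<beta> lam n) 0) (\<delta> \<phi>)"
  unfolding coclosed_part_def
  by (rule hom_eval_annihilate[OF atlas coclosed_operator \<phi> codiff'])
    (simp add: codiff_codiff[OF form_operatorD(1)[OF d_operator]])

lemma d_closed_part: "d (closed_part n) = 0"
proof -
  have "d (closed_part n) = smul (\<epsilon> ^ n * coeff (shifted_s_one \<beta> lam n) 0) (d \<phi>)"
    unfolding closed_part_def
    by (rule hom_eval_annihilate[OF atlas closed_operator \<phi> d_operator])
      (simp add: ext_deriv_ext_deriv[OF atlas form_operatorD(1)[OF codiff']])
  then show ?thesis
    by (simp add: shifted_s_one_0 smul_def zero_fun_def)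
qed

lemma codiff_minus_numerator: "\<delta> (minus_numerator n) = 0"
proof -
  have "\<delta> (minus_numerator n) = smul (\<epsilon> ^ n * coeff (shifted_s_minus \<beta> lam n) 0) (\<delta> (\<delta> \<phi>))"
    unfolding minus_numerator_def
    by (rule hom_eval_annihilate[OF atlas coclosed_operator codiff_\<phi> codiff'])
      (simp add: codiff_codiff[OF form_operatorD(1)[OF d_operator]])
  then show ?thesis
    by (simp add: codiff_codiff[OF \<phi>] smul_def zero_fun_def)
qed

lemma hodge_minus_numerator: "hodge_laplacian A \<delta> (minus_numerator n) = (\<delta> \<circ> d) (minus_numerator n)"
  by (simp add: hodge_laplacian_def codiff_minus_numerator zero_simps)

lemma codiff_plus_numerator: "\<delta> (plus_numerator n) = hom_eval \<epsilon> n (shifted_s_one \<beta> lam n + [:plus_constant n:]) (\<delta> \<circ> d) (\<delta> \<phi>)"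
proof -
  have "\<delta> (plus_numerator n) = smul (lam - \<beta>) (\<delta> (coclosed_part n)) + \<delta> (closed_part n)"
    unfolding plus_numerator_def
    using form_operatorD[OF codiff' numerator_forms(1)] form_operatorD(3)[OF codiff' forms_smul[OF atlas numerator_forms(1)] numerator_forms(2)]
    by simp
  also have "\<dots> = hom_eval \<epsilon> n (shifted_s_one \<beta> lam n + [:plus_constant n:]) (\<delta> \<circ> d) (\<delta> \<phi>)"
    unfolding codiff_coclosed_part hom_eval_add hom_eval_const closed_part_def codiff_hom_eval_closed plus_constant_def
    by (rule form_eqI) (simp add: smul_apply algebra_simps)
  finally show ?thesis .
qed

text \<open>The last summand arises because \<open>v\<close> annihilates all of the coclosed part except its constant term.\<close>

lemma hodge_plus_numerator:
  "hodge_laplacian A \<delta> (plus_numerator n) = smul (lam - \<beta>) ((\<delta> \<circ> d) (coclosed_part n)) + (d \<circ> \<delta>) (closed_part n)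
    + (d \<circ> \<delta>) (hom_eval \<epsilon> n [:plus_constant n:] (d \<circ> \<delta>) \<phi>)"
proof -
  note U = numerator_forms(1)[of n] and V = numerator_forms(2)[of n]
  have "d (plus_numerator n) = smul (lam - \<beta>) (d (coclosed_part n)) + d (closed_part n)"
    unfolding plus_numerator_def using form_operatorD(2)[OF d_operator U] form_operatorD(3)[OF d_operator forms_smul[OF atlas U] V] by simp
  then have 1: "\<delta> (d (plus_numerator n)) = smul (lam - \<beta>) ((\<delta> \<circ> d) (coclosed_part n))"
    using form_operatorD(2)[OF codiff form_operatorD(1)[OF d_operator U]] by (simp add: d_closed_part)
  have 2: "(d \<circ> \<delta>) (plus_numerator n) = smul (lam - \<beta>) ((d \<circ> \<delta>) (coclosed_part n)) + (d \<circ> \<delta>) (closed_part n)"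
    unfolding plus_numerator_def using form_operatorD(2)[OF closed_operator U] form_operatorD(3)[OF closed_operator forms_smul[OF atlas U] V] by simp
  have 3: "(d \<circ> \<delta>) (coclosed_part n) = smul (\<epsilon> ^ n * coeff (shifted_s_plus \<beta> lam n) 0) (d (\<delta> \<phi>))"
    using form_operatorD(2)[OF d_operator codiff_\<phi>] by (simp add: codiff_coclosed_part)
  have 4: "(d \<circ> \<delta>) (hom_eval \<epsilon> n [:plus_constant n:] (d \<circ> \<delta>) \<phi>) = smul (\<epsilon> ^ n * plus_constant n) (d (\<delta> \<phi>))"
    unfolding hom_eval_const using form_operatorD(2)[OF closed_operator \<phi>] by simp
  show ?thesis
    unfolding hodge_laplacian_def 1 4 using 2 3
    by (intro form_eqI) (simp add: smul_apply plus_constant_def algebra_simps)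
qed

lemma d_minus_numerator: "d (minus_numerator n) = (d \<circ> \<delta>) (hom_eval \<epsilon> n (shifted_s_minus \<beta> lam n) (d \<circ> \<delta>) \<phi>)"
  unfolding minus_numerator_def by (simp add: codiff_hom_eval_closed[symmetric])

text \<open>The factor \<open>a\<^sub>0 = 0\<close> removes the terms of negative index.\<close>

lemma a_coeff_vanish:
  "a_coeff \<beta> lam (2 * int n) \<noteq> 0 \<Longrightarrow> n \<ge> 1"
  "a_coeff \<beta> lam (2 * int n) * a_coeff \<beta> lam (2 * int n - 2) \<noteq> 0 \<Longrightarrow> n \<ge> 2"
  "a_coeff \<beta> lam (2 * int n) * a_coeff \<beta> lam (2 * int n - 2) * a_coeff \<beta> lam (2 * int n - 4) \<noteq> 0 \<Longrightarrow> n \<ge> 3"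
proof -
  have zero: "a_coeff \<beta> lam 0 = 0" by (simp add: a_coeff_def)
  show "a_coeff \<beta> lam (2 * int n) \<noteq> 0 \<Longrightarrow> n \<ge> 1"
    using zero by (cases n) auto
  show "a_coeff \<beta> lam (2 * int n) * a_coeff \<beta> lam (2 * int n - 2) \<noteq> 0 \<Longrightarrow> n \<ge> 2"
    using zero by (cases "n = 0"; cases "n = 1") auto
  show "a_coeff \<beta> lam (2 * int n) * a_coeff \<beta> lam (2 * int n - 2) * a_coeff \<beta> lam (2 * int n - 4) \<noteq> 0 \<Longrightarrow> n \<ge> 3"
    using zero by (cases "n = 0"; cases "n = 1"; cases "n = 2") auto
qed

lemma plus_numerator_recurrence:
  fixes n :: nat
  defines "j \<equiv> 2 * int n + 2"
  shows "plus_numerator (Suc n) = smul (b_coeff \<beta> lam j / 4 * \<epsilon>) (plus_numerator n) + hodge_laplacian A \<delta> (plus_numerator n)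
    + smul (a_coeff \<beta> lam (2 * int n) * c_coeff \<beta> lam j / 16 * \<epsilon>\<^sup>2) (plus_numerator (n - 1))
    + smul 2 (d (minus_numerator n))
    - smul (a_coeff \<beta> lam (2 * int n) * a_coeff \<beta> lam (2 * int n - 2) / 8 * \<epsilon>\<^sup>2) (d (minus_numerator (n - 2)))"
proof -
  note a = a_coeff_vanish[of n]
  note U_rules = hom_eval_pCons[OF atlas coclosed_operator \<phi>]
  note V_rules = hom_eval_pCons[OF atlas closed_operator \<phi>]
  note deg = degree_shifted
  let ?a1 = "a_coeff \<beta> lam (2 * int n)" and ?a2 = "a_coeff \<beta> lam (2 * int n - 2)"
  let ?H = "\<lambda>p. hom_eval \<epsilon> (Suc n) p (\<delta> \<circ> d) \<phi>" and ?K = "\<lambda>p. hom_eval \<epsilon> (Suc n) p (d \<circ> \<delta>) \<phi>"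
  note shp = hom_eval_shift_pCons[OF atlas closed_operator \<phi>]
  have U1: "?H (smult (b_coeff \<beta> lam j / 4) (shifted_s_plus \<beta> lam n)) = smul (b_coeff \<beta> lam j / 4 * \<epsilon> ^ 1) (coclosed_part n)"
    unfolding coclosed_part_def by (rule hom_eval_shift[OF deg(1)]) simp
  have U2: "?H (smult (?a1 * c_coeff \<beta> lam j / 16) (shifted_s_plus \<beta> lam (n - 1)))
      = smul (?a1 * c_coeff \<beta> lam j / 16 * \<epsilon>\<^sup>2) (coclosed_part (n - 1))"
    unfolding coclosed_part_def by (rule hom_eval_shift[OF deg(1)]) (use a in auto)
  have U: "coclosed_part (Suc n) = smul (b_coeff \<beta> lam j / 4 * \<epsilon> ^ 1) (coclosed_part n) + (\<delta> \<circ> d) (coclosed_part n)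
    + smul (?a1 * c_coeff \<beta> lam j / 16 * \<epsilon>\<^sup>2) (coclosed_part (n - 1))"
    unfolding coclosed_part_def[of "Suc n"] shifted_s_plus_recurrence[of \<beta> lam n, folded j_def] hom_eval_add U_rules U1 U2
    by (simp only: coclosed_part_def)
  have V1: "?K (smult (b_coeff \<beta> lam j / 4) (shifted_s_one \<beta> lam n)) = smul (b_coeff \<beta> lam j / 4 * \<epsilon> ^ 1) (closed_part n)"
    unfolding closed_part_def by (rule hom_eval_shift[OF deg(3)]) simp
  have V2: "?K (smult (?a1 * c_coeff \<beta> lam j / 16) (shifted_s_one \<beta> lam (n - 1)))
      = smul (?a1 * c_coeff \<beta> lam j / 16 * \<epsilon>\<^sup>2) (closed_part (n - 1))"
    unfolding closed_part_def by (rule hom_eval_shift[OF deg(3)]) (use a in auto)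
  have V3: "?K (smult 2 (pCons 0 (shifted_s_minus \<beta> lam n))) = smul (2 * \<epsilon> ^ 0) (d (minus_numerator n))"
    unfolding d_minus_numerator by (rule shp[OF deg(2)]) simp
  have V4: "?K (smult (?a1 * ?a2 / 8) (pCons 0 (shifted_s_minus \<beta> lam (n - 2))))
      = smul (?a1 * ?a2 / 8 * \<epsilon>\<^sup>2) (d (minus_numerator (n - 2)))"
    unfolding d_minus_numerator by (rule shp[OF deg(2)]) (use a in auto)
  have V: "closed_part (Suc n) = smul (b_coeff \<beta> lam j / 4 * \<epsilon> ^ 1) (closed_part n) + (d \<circ> \<delta>) (closed_part n)
    + smul (?a1 * c_coeff \<beta> lam j / 16 * \<epsilon>\<^sup>2) (closed_part (n - 1))
    + (d \<circ> \<delta>) (hom_eval \<epsilon> n [:plus_constant n:] (d \<circ> \<delta>) \<phi>)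
    + smul (2 * \<epsilon> ^ 0) (d (minus_numerator n))
    - smul (?a1 * ?a2 / 8 * \<epsilon>\<^sup>2) (d (minus_numerator (n - 2)))"
    unfolding closed_part_def[of "Suc n"] shifted_s_one_recurrence[of \<beta> lam n, folded j_def plus_constant_def] hom_eval_add hom_eval_diff
      V1 V2 V3 V4 V_rules
    by (simp only: closed_part_def)
  show ?thesis
    unfolding plus_numerator_def[of "Suc n"] U V hodge_plus_numerator
    by (intro form_eqI) (simp add: smul_apply plus_numerator_def field_simps)
qed

lemma minus_numerator_recurrence:
  fixes n :: nat
  defines "j \<equiv> 2 * int n + 2"
  shows "smul (A_coeff \<beta> lam j) (minus_numerator n)
    = smul (B_coeff \<beta> lam j / 4 * a_coeff \<beta> lam (2 * int n) * \<epsilon>) (minus_numerator (n - 1))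
    + smul (a_coeff \<beta> lam (2 * int n)) (hodge_laplacian A \<delta> (minus_numerator (n - 1)))
    + smul (C_coeff \<beta> lam j / 16 * (a_coeff \<beta> lam (2 * int n) * a_coeff \<beta> lam (2 * int n - 2)) * \<epsilon>\<^sup>2) (minus_numerator (n - 2))
    - smul (a_coeff \<beta> lam (2 * int n) * a_coeff \<beta> lam (2 * int n - 2) / 4 * \<epsilon>) (hodge_laplacian A \<delta> (minus_numerator (n - 2)))
    + smul (D_coeff \<beta> lam j / 64 * (a_coeff \<beta> lam (2 * int n) * a_coeff \<beta> lam (2 * int n - 2) * a_coeff \<beta> lam (2 * int n - 4)) * \<epsilon> ^ 3) (minus_numerator (n - 3))
    + smul 2 (\<delta> (plus_numerator n))
    + smul (a_coeff \<beta> lam (2 * int n) / 2 * \<epsilon>) (\<delta> (plus_numerator (n - 1)))"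
proof -
  note a = a_coeff_vanish[of n]
  note sh = hom_eval_shift[of _ _ _ n _ \<epsilon> "\<delta> \<circ> d" "\<delta> \<phi>"]
  note shp = hom_eval_shift_pCons[OF atlas coclosed_operator codiff_\<phi>, of _ _ _ n]
  note deg = degree_shifted
  let ?a1 = "a_coeff \<beta> lam (2 * int n)" and ?a2 = "a_coeff \<beta> lam (2 * int n - 2)" and ?a3 = "a_coeff \<beta> lam (2 * int n - 4)"
  let ?H = "\<lambda>p. hom_eval \<epsilon> n p (\<delta> \<circ> d) (\<delta> \<phi>)"
  have 1: "?H (smult (B_coeff \<beta> lam j / 4 * ?a1) (shifted_s_minus \<beta> lam (n - 1)))
      = smul (B_coeff \<beta> lam j / 4 * ?a1 * \<epsilon> ^ 1) (minus_numerator (n - 1))"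
    unfolding minus_numerator_def by (rule sh[OF deg(2)]) (use a in auto)
  have 2: "?H (smult ?a1 (pCons 0 (shifted_s_minus \<beta> lam (n - 1)))) = smul (?a1 * \<epsilon> ^ 0) ((\<delta> \<circ> d) (minus_numerator (n - 1)))"
    unfolding minus_numerator_def by (rule shp[OF deg(2)]) (use a in auto)
  have 3: "?H (smult (C_coeff \<beta> lam j / 16 * ?a1 * ?a2) (shifted_s_minus \<beta> lam (n - 2)))
      = smul (C_coeff \<beta> lam j / 16 * ?a1 * ?a2 * \<epsilon> ^ 2) (minus_numerator (n - 2))"
    unfolding minus_numerator_def by (rule sh[OF deg(2)]) (use a in auto)
  have 4: "?H (smult (?a1 * ?a2 / 4) (pCons 0 (shifted_s_minus \<beta> lam (n - 2))))
      = smul (?a1 * ?a2 / 4 * \<epsilon> ^ 1) ((\<delta> \<circ> d) (minus_numerator (n - 2)))"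
    unfolding minus_numerator_def by (rule shp[OF deg(2)]) (use a in auto)
  have 5: "?H (smult (D_coeff \<beta> lam j / 64 * ?a1 * ?a2 * ?a3) (shifted_s_minus \<beta> lam (n - 3)))
      = smul (D_coeff \<beta> lam j / 64 * ?a1 * ?a2 * ?a3 * \<epsilon> ^ 3) (minus_numerator (n - 3))"
    unfolding minus_numerator_def by (rule sh[OF deg(2)]) (use a in auto)
  have 6: "?H (smult 2 (shifted_s_one \<beta> lam n + [:plus_constant n:])) = smul 2 (\<delta> (plus_numerator n))"
    unfolding codiff_plus_numerator hom_eval_smult ..
  have degc: "degree (shifted_s_one \<beta> lam (n - 1) + [:plus_constant (n - 1):]) \<le> n - 1"
    by (rule degree_add_le) (simp_all add: deg)
  have 7: "?H (smult (?a1 / 2) (shifted_s_one \<beta> lam (n - 1) + [:plus_constant (n - 1):])) = smul (?a1 / 2 * \<epsilon> ^ 1) (\<delta> (plus_numerator (n - 1)))"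
    unfolding codiff_plus_numerator by (rule sh[OF degc]) (use a in auto)
  have "smul (A_coeff \<beta> lam j) (minus_numerator n) = ?H (smult (A_coeff \<beta> lam j) (shifted_s_minus \<beta> lam n))"
    unfolding minus_numerator_def hom_eval_smult ..
  also note shifted_s_minus_relation[of \<beta> lam n, folded j_def plus_constant_def]
  finally show ?thesis
    unfolding hom_eval_add hom_eval_diff 1 2 3 4 5 6 7 hodge_minus_numerator
    by (simp only: mult.assoc power_one_right power_0 mult_1_right)
qed

definition "normalizer n = inverse ((lam - \<beta>) * (\<Prod>i=1..n. a_coeff \<beta> lam (2 * int i)))"

lemma T_minus_eq: "T_minus A \<delta> \<epsilon> \<beta> lam (Suc n) \<phi> = smul (normalizer n) (minus_numerator n)"
  by (simp add: T_minus_def normalizer_def minus_numerator_def scaled_eval_eq_hom_eval shifted_s_minus_def)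

lemma T_plus_eq: "T_plus A \<delta> \<epsilon> \<beta> lam n \<phi> = smul (normalizer n) (plus_numerator n)"
  by (simp add: T_plus_def normalizer_def plus_numerator_def coclosed_part_def closed_part_def scaled_eval_eq_hom_eval shifted_s_plus_def shifted_s_one_def)

lemma normalizer_pred:
  assumes "n > 0" "a_coeff \<beta> lam (2 * int n) \<noteq> 0"
  shows "normalizer n * a_coeff \<beta> lam (2 * int n) = normalizer (n - 1)"
proof -
  obtain n' where "n = Suc n'" using assms(1) by (cases n) auto
  then show ?thesis using assms(2) by (simp add: normalizer_def)
qed

lemma plus_numerator_0:
  assumes "lam \<noteq> \<beta>"
  shows "smul (normalizer 0) (plus_numerator 0) = \<phi>"
proof -
  have "shifted_s_plus \<beta> lam 0 = 1" "shifted_s_one \<beta> lam 0 = 0"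
    by (simp_all add: shifted_s_plus_def shifted_s_one_def s_plus_def s_one_def R_poly_def R1_poly_def)
  then show ?thesis
    using assms by (intro form_eqI) (simp add: normalizer_def plus_numerator_def coclosed_part_def closed_part_def hom_eval_def smul_apply)
qed

lemma omega_eq:
  "\<omega>m (2 * int (Suc n)) = smul (normalizer n) (minus_numerator n)"
  "lam \<noteq> \<beta> \<Longrightarrow> \<omega>p (2 * int n) = smul (normalizer n) (plus_numerator n)"
proof -
  have "nat (2 * int (Suc n) div 2) = Suc n" by simp
  then show "\<omega>m (2 * int (Suc n)) = smul (normalizer n) (minus_numerator n)"
    by (simp add: omega_minus_def T_minus_eq)
  show "\<omega>p (2 * int n) = smul (normalizer n) (plus_numerator n)" if "lam \<noteq> \<beta>"
    using plus_numerator_0[OF that] by (cases "n = 0") (simp_all add: omega_plus_def T_plus_eq)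
qed

lemma omega_vanish:
  "j \<le> 0 \<or> odd j \<Longrightarrow> \<omega>m j = 0"
  "j < 0 \<or> odd j \<Longrightarrow> \<omega>p j = 0"
  by (auto simp: omega_minus_def omega_plus_def)

lemma omega_forms:
  "\<omega>m j \<in> forms A (k - 1)" "\<omega>p j \<in> forms A k"
proof -
  show "\<omega>m j \<in> forms A (k - 1)"
  proof (cases "nat (j div 2)")
    case 0
    then show ?thesis by (auto simp: omega_minus_def forms_0)
  next
    case (Suc n)
    then show ?thesis by (simp add: omega_minus_def T_minus_eq forms_0 forms_smul[OF atlas] numerator_forms)
  qed
  show "\<omega>p j \<in> forms A k"
    by (simp add: omega_plus_def T_plus_eq forms_0 forms_smul[OF atlas] numerator_forms \<phi>)
qed

text \<open>Passing to a lower index replaces the normalizer by the one of index \<open>n\<close> times factors \<open>a\<^sub>2\<^sub>i\<close>. For small \<open>n\<close> both sides vanish.\<close>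

lemma omega_pred:
  assumes lam: "lam \<noteq> \<beta>" and a: "\<And>i. 0 < i \<Longrightarrow> i \<le> n \<Longrightarrow> a_coeff \<beta> lam (2 * int i) \<noteq> 0"
  shows "\<omega>m (2 * int n) = smul (normalizer n * a_coeff \<beta> lam (2 * int n)) (minus_numerator (n - 1))" (is ?eq1)
    and "\<omega>m (2 * int n - 2)
      = smul (normalizer n * (a_coeff \<beta> lam (2 * int n) * a_coeff \<beta> lam (2 * int n - 2))) (minus_numerator (n - 2))" (is ?eq2)
    and "\<omega>m (2 * int n - 4)
      = smul (normalizer n * (a_coeff \<beta> lam (2 * int n) * a_coeff \<beta> lam (2 * int n - 2) * a_coeff \<beta> lam (2 * int n - 4))) (minus_numerator (n - 3))" (is ?eq3)
    and "\<omega>p (2 * int n - 2) = smul (normalizer n * a_coeff \<beta> lam (2 * int n)) (plus_numerator (n - 1))" (is ?eq4)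
proof -
  have zero: "smul 0 \<theta> = 0" for \<theta> :: "('a, 'n) form" by (intro form_eqI) (simp add: smul_apply)
  have r1: "normalizer n * a_coeff \<beta> lam (2 * int n) = normalizer (n - 1)" if "n \<ge> 1"
    using normalizer_pred[of n] a[of n] that by simp
  have r2: "normalizer n * (a_coeff \<beta> lam (2 * int n) * a_coeff \<beta> lam (2 * int n - 2)) = normalizer (n - 2)" if "n \<ge> 2"
  proof -
    have "2 * int (n - 1) = 2 * int n - 2" "n - 1 - 1 = n - 2" using that by auto
    then show ?thesis
      using normalizer_pred[of "n - 1"] a[of "n - 1"] r1 that by (simp add: mult.assoc[symmetric])
  qed
  have r3: "normalizer n * (a_coeff \<beta> lam (2 * int n) * a_coeff \<beta> lam (2 * int n - 2) * a_coeff \<beta> lam (2 * int n - 4)) = normalizer (n - 3)"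
    if "n \<ge> 3"
  proof -
    have "2 * int (n - 2) = 2 * int n - 4" "n - 2 - 1 = n - 3" using that by auto
    then show ?thesis
      using normalizer_pred[of "n - 2"] a[of "n - 2"] r2 that by (simp add: mult.assoc[symmetric])
  qed
  show ?eq1
  proof (cases "n \<ge> 1")
    case True
    then have "2 * int n = 2 * int (Suc (n - 1))" by simp
    then show ?thesis unfolding r1[OF True] using omega_eq(1)[of "n - 1"] by metis
  next
    case False
    then have "a_coeff \<beta> lam (2 * int n) = 0" using a_coeff_vanish(1)[of n] by blast
    then show ?thesis using False by (simp add: zero omega_vanish)
  qed
  show ?eq2
  proof (cases "n \<ge> 2")
    case True
    then have "2 * int n - 2 = 2 * int (Suc (n - 2))" by simp
    then show ?thesis unfolding r2[OF True] using omega_eq(1)[of "n - 2"] by metis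
  next
    case False
    then have "a_coeff \<beta> lam (2 * int n) * a_coeff \<beta> lam (2 * int n - 2) = 0" using a_coeff_vanish(2)[of n] by blast
    then show ?thesis using False by (simp only: mult_zero_right zero) (simp add: omega_vanish)
  qed
  show ?eq3
  proof (cases "n \<ge> 3")
    case True
    then have "2 * int n - 4 = 2 * int (Suc (n - 3))" by simp
    then show ?thesis unfolding r3[OF True] using omega_eq(1)[of "n - 3"] by metis
  next
    case False
    then have "a_coeff \<beta> lam (2 * int n) * a_coeff \<beta> lam (2 * int n - 2) * a_coeff \<beta> lam (2 * int n - 4) = 0"
      using a_coeff_vanish(3)[of n] by blast
    then show ?thesis using False by (simp only: mult_zero_right zero) (simp add: omega_vanish)
  qed
  show ?eq4
  proof (cases "n \<ge> 1")
    case True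
    then have "2 * int n - 2 = 2 * int (n - 1)" by simp
    then show ?thesis unfolding r1[OF True] using omega_eq(2)[OF lam, of "n - 1"] by metis
  next
    case False
    then have "a_coeff \<beta> lam (2 * int n) = 0" using a_coeff_vanish(1)[of n] by blast
    then show ?thesis using False by (simp add: zero omega_vanish)
  qed
qed

lemma hodge_operator: "form_operator A l l (hodge_laplacian A \<delta>)"
  unfolding form_operator_def hodge_laplacian_def
proof (intro ballI conjI allI)
  fix \<omega> \<eta> a assume \<omega>: "\<omega> \<in> forms A l" and \<eta>: "\<eta> \<in> forms A l"
  note c = form_operatorD[OF closed_operator \<omega>, unfolded o_def] form_operatorD[OF coclosed_operator \<omega>, unfolded o_def]
  show "d (\<delta> (\<omega> + \<eta>)) + \<delta> (d (\<omega> + \<eta>)) = d (\<delta> \<omega>) + \<delta> (d \<omega>) + (d (\<delta> \<eta>) + \<delta> (d \<eta>))"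
    unfolding c(3)[OF \<eta>] c(6)[OF \<eta>] by (simp only: ac_simps)
next
  fix \<omega> a assume \<omega>: "\<omega> \<in> forms A l"
  note c = form_operatorD[OF closed_operator \<omega>, unfolded o_def] form_operatorD[OF coclosed_operator \<omega>, unfolded o_def]
  show "d (\<delta> \<omega>) + \<delta> (d \<omega>) \<in> forms A l" by (rule forms_add[OF atlas c(1) c(4)])
  show "d (\<delta> (smul a \<omega>)) + \<delta> (d (smul a \<omega>)) = smul a (d (\<delta> \<omega>) + \<delta> (d \<omega>))"
    unfolding c(2) c(5) by (intro form_eqI) (simp add: smul_apply algebra_simps)
qed

lemma recurrences_even:
  assumes lam: "lam \<noteq> \<beta>" and a: "\<And>i. 0 < i \<Longrightarrow> i \<le> Suc n \<Longrightarrow> a_coeff \<beta> lam (2 * int i) \<noteq> 0"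
    and \<kappa>: "\<epsilon> = 4 * \<kappa>"
  shows "recurrence_minus A \<delta> \<kappa> \<beta> lam (\<omega>m) (\<omega>p) (2 * int n + 2)"
    and "recurrence_plus A \<delta> \<kappa> \<beta> lam (\<omega>m) (\<omega>p) (2 * int n + 2)"
proof -
  define j where "j = 2 * int n + 2"
  define a1 a2 a3 where "a1 = a_coeff \<beta> lam (2 * int n)" and "a2 = a_coeff \<beta> lam (2 * int n - 2)"
    and "a3 = a_coeff \<beta> lam (2 * int n - 4)"
  have idx: "j - 2 = 2 * int n" "j - 4 = 2 * int n - 2" "j - 6 = 2 * int n - 4" "2 * int (Suc n) = j"
    by (simp_all add: j_def)
  have a': "a_coeff \<beta> lam (2 * int i) \<noteq> 0" if "0 < i" "i \<le> n" for i using a that by simp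
  have m0: "\<omega>m j = smul (normalizer n) (minus_numerator n)" using omega_eq(1)[of n] unfolding idx .
  have m1: "\<omega>m (j - 2) = smul (normalizer n * a1) (minus_numerator (n - 1))"
    unfolding idx a1_def by (rule omega_pred(1)[OF lam a'])
  have m2: "\<omega>m (j - 4) = smul (normalizer n * (a1 * a2)) (minus_numerator (n - 2))"
    unfolding idx a1_def a2_def by (rule omega_pred(2)[OF lam a'])
  have m3: "\<omega>m (j - 6) = smul (normalizer n * (a1 * a2 * a3)) (minus_numerator (n - 3))"
    unfolding idx a1_def a2_def a3_def by (rule omega_pred(3)[OF lam a'])
  have p1: "\<omega>p (j - 2) = smul (normalizer n) (plus_numerator n)"
    unfolding idx by (rule omega_eq(2)[OF lam])
  have p2: "\<omega>p (j - 4) = smul (normalizer n * a1) (plus_numerator (n - 1))"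
    unfolding idx a1_def by (rule omega_pred(4)[OF lam a'])
  have p0: "smul (a_coeff \<beta> lam j) (\<omega>p j) = smul (normalizer n) (plus_numerator (Suc n))"
  proof -
    have "normalizer (Suc n) * a_coeff \<beta> lam j = normalizer n"
      using normalizer_pred[of "Suc n"] a[of "Suc n"] unfolding idx by simp
    then show ?thesis
      using omega_eq(2)[OF lam, of "Suc n"] unfolding idx
      by (intro form_eqI) (simp add: smul_apply mult.assoc[symmetric] mult.commute[of "a_coeff \<beta> lam j"])
  qed
  note lin = form_operatorD(2)[OF hodge_operator numerator_forms(3)] form_operatorD(2)[OF hodge_operator numerator_forms(4)]
    form_operatorD(2)[OF codiff' numerator_forms(4)] form_operatorD(2)[OF d_operator numerator_forms(3)]
  show "recurrence_minus A \<delta> \<kappa> \<beta> lam \<omega>m \<omega>p (2 * int n + 2)"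
    unfolding recurrence_minus_def j_def[symmetric] m0 m1 m2 m3 p1 p2 lin
    using arg_cong[OF minus_numerator_recurrence[of n, folded j_def a1_def a2_def a3_def], of "smul (normalizer n)"]
    by (simp add: fun_eq_iff smul_apply \<kappa> power_mult_distrib algebra_simps)
  show "recurrence_plus A \<delta> \<kappa> \<beta> lam \<omega>m \<omega>p (2 * int n + 2)"
    unfolding recurrence_plus_def j_def[symmetric] p0 m0 m2 p1 p2 lin
    using arg_cong[OF plus_numerator_recurrence[of n, folded j_def a1_def a2_def], of "smul (normalizer n)"]
    by (simp add: fun_eq_iff smul_apply \<kappa> power_mult_distrib algebra_simps)
qed

text \<open>The assumption on \<open>lam\<close> says that \<open>a\<^sub>2\<^sub>i\<close> does not vanish for \<open>1 \<le> i \<le> M\<close>.\<close>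

lemma solves_recurrences_up_to:
  assumes lam: "lam \<noteq> \<beta>" and a: "\<And>i. 0 < i \<Longrightarrow> i \<le> M \<Longrightarrow> lam \<noteq> \<beta>/2 - of_nat i"
    and \<kappa>: "\<epsilon> = 4 * \<kappa>" and k: "k = int p"
  shows "solves_recurrences A \<delta> \<kappa> \<beta> lam p \<phi> (\<omega>m) (\<omega>p) (2 * int M)"
  unfolding solves_recurrences_def
proof (intro conjI allI impI ballI)
  show "\<omega>m 0 = 0" "\<omega>p 0 = \<phi>" by (simp_all add: omega_minus_def omega_plus_def)
  show "\<omega>m j = 0" "\<omega>p j = 0" if "j < 0 \<or> odd j" for j
    using that by (auto simp: omega_vanish)
  show "\<omega>m j \<in> forms A (int p - 1)" "\<omega>p j \<in> forms A (int p)" for j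
    using omega_forms k by auto
  have a': "a_coeff \<beta> lam (2 * int i) \<noteq> 0" if "0 < i" "i \<le> M" for i
  proof -
    have "lam - \<beta>/2 + of_nat i \<noteq> 0" using a[OF that] by (simp add: algebra_simps eq_diff_eq)
    then show ?thesis using that unfolding recurrence_coeffs_even by simp
  qed
  fix j assume j: "j \<in> {1..2 * int M}"
  have "recurrence_minus A \<delta> \<kappa> \<beta> lam \<omega>m \<omega>p j \<and> recurrence_plus A \<delta> \<kappa> \<beta> lam \<omega>m \<omega>p j"
  proof (cases "even j")
    case True
    then obtain i where i: "j = 2 * i" by (elim evenE)
    define n where "n = nat (i - 1)"
    have n: "j = 2 * int n + 2" "Suc n \<le> M" using i j by (auto simp: n_def)
    have "a_coeff \<beta> lam (2 * int i) \<noteq> 0" if "0 < i" "i \<le> Suc n" for i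
      using a' that n(2) by simp
    from recurrences_even[OF lam this \<kappa>] show ?thesis unfolding n(1) by blast
  next
    case False
    have "smul x 0 = (0 :: ('a, 'n) form)" for x by (simp add: smul_def zero_fun_def)
    then show ?thesis
      using False by (simp add: recurrence_minus_def recurrence_plus_def omega_vanish hodge_zero zero_simps)
  qed
  then show "recurrence_minus A \<delta> \<kappa> \<beta> lam \<omega>m \<omega>p j" "recurrence_plus A \<delta> \<kappa> \<beta> lam \<omega>m \<omega>p j" by blast+
qed

end

end

section \<open>The theorem\<close>

lemma codifferential_complexI:
  fixes A :: "('a::{t2_space, second_countable_topology}, 'n::finite) chart set"
  assumes A: "oriented_atlas A" "riemannian_metric A h" "riemannian_measure A h vol" "is_codifferential A h vol \<delta>"
  shows "codifferential_complex A \<delta>"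
proof
  show "oriented_atlas A" by (fact A)
  show "form_operator A (k + 1) k \<delta>" for k
    unfolding form_operator_def
    using codifferential_forms[OF A] codifferential_add[OF A] codifferential_smul[OF A] by blast
  show "\<delta> (\<delta> \<omega>) = 0" if "\<omega> \<in> forms A k" for k \<omega>
    using codifferential_codifferential[OF A, of \<omega> "k - 2"] that by simp
qed

theorem theorem3p7:
  fixes A :: "('a::{t2_space, second_countable_topology}, 'n::finite) chart set"
    and h :: "('a, 'n) metric"
    and vol :: "'a measure"
    and \<delta> :: "('a, 'n) form \<Rightarrow> ('a, 'n) form"
    and J :: real
    and n p m :: nat
    and \<phi> :: "('a, 'n) form"
    and \<beta> lam :: complex
  assumes n: "n = CARD('n)" "n \<ge> 3"
    and p: "p \<le> n"
    and beta: "\<beta> = of_int (int n - 2 * int p)"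
    and manifold: "oriented_atlas A"
    and metric: "riemannian_metric A h"
    and einstein: "\<And>c q. c \<in> A \<Longrightarrow> q \<in> fst c \<Longrightarrow>
          ricci h c q = (2 * J / real n * (real n - 1)) *\<^sub>R h c q"
    and vol: "riemannian_measure A h vol"
    and codifferential: "is_codifferential A h vol \<delta>"
    and phi: "\<phi> \<in> forms A (int p)"
    and lam: "lam \<noteq> \<beta>"
  shows "((\<forall>N\<in>{1..m}. lam \<noteq> \<beta> / 2 - of_nat N) \<longrightarrow>
            solves_recurrences A \<delta> (of_real (J / (2 * real n))) \<beta> lam p \<phi>
              (omega_minus A \<delta> (of_real (2 * J / real n)) \<beta> lam \<phi>)
              (omega_plus A \<delta> (of_real (2 * J / real n)) \<beta> lam \<phi>) (2 * int m))
       \<and> (\<forall>N\<in>{1..m}. lam = \<beta> / 2 - of_nat N \<longrightarrow>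
            solves_recurrences A \<delta> (of_real (J / (2 * real n))) \<beta> lam p \<phi>
              (omega_minus A \<delta> (of_real (2 * J / real n)) \<beta> lam \<phi>)
              (omega_plus A \<delta> (of_real (2 * J / real n)) \<beta> lam \<phi>) (2 * (int N - 1)))"
proof -
  interpret codifferential_complex A \<delta>
    by (rule codifferential_complexI[OF manifold metric vol codifferential])
  have \<kappa>: "complex_of_real (2 * J / real n) = 4 * complex_of_real (J / (2 * real n))"
    by simp
  let ?solves = "solves_recurrences A \<delta> (of_real (J / (2 * real n))) \<beta> lam p \<phi>
    (omega_minus A \<delta> (of_real (2 * J / real n)) \<beta> lam \<phi>) (omega_plus A \<delta> (of_real (2 * J / real n)) \<beta> lam \<phi>)"
  note solves = solves_recurrences_up_to[OF phi lam _ \<kappa> refl]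
  show ?thesis
  proof (intro conjI impI ballI)
    assume "\<forall>N\<in>{1..m}. lam \<noteq> \<beta> / 2 - of_nat N"
    then show "?solves (2 * int m)"
      by (intro solves) auto
  next
    fix N assume N: "N \<in> {1..m}" "lam = \<beta> / 2 - of_nat N"
    have "?solves (2 * int (N - 1))"
      by (rule solves) (use N in auto)
    moreover have "int (N - 1) = int N - 1" using N(1) by auto
    ultimately show "?solves (2 * (int N - 1))"
      by simp
  qed
qed

end
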